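(* Let $X$ be an $n\times n$ random matrix with iid entries with mean $0$ and variance $\frac1n$. Let $k$ be a fixed positive integer, let $\delta>0$ be any constant, and let $s^*>1+\delta$ be a constant. Consider a deterministic $n\times n$ matrix $C$ of bounded rank and bounded operator norm such that $\mathrm{rank}(C)=k$ and $\|C\|\le s^*$. Assume that for all sufficiently large $n$ there are $\tilde k$ eigenvalues of $C$, denoted $c_1,\dots,c_{\tilde k}$, in the region $\{z\in\mathbb C:|z|>1+\delta\}$, and that all other eigenvalues of $C$ are contained in the region $\{z\in\mathbb C:|z|\le1+\delta/3\}$. Then, for every $j\in\{1,2,\dots,\tilde k\}$, there is exactly one eigenvalue of $X+C$ which converges to $c_j$ in probability. Moreover, in probability, for large $n$, all other eigenvalues of $X+C$ are contained in the region $\{z\in\mathbb C:|z|<1+\delta/2\}$.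
   Context: All limits are as $n\to\infty$; $C=C_n$ and the $c_j$ may depend on $n$, and "in probability, for large $n$" means with probability tending to $1$ as $n\to\infty$. *)

theory Defs
  imports
    "HOL-Probability.Probability"
    "Jordan_Normal_Form.Char_Poly"
    "Jordan_Normal_Form.DL_Rank"
begin

text \<open>Eigenvalues with algebraic multiplicity; for \<open>A \<in> carrier_mat n n\<close> this multiset has size \<open>n\<close>.\<close>

definition eigenvalue_mset :: "complex mat \<Rightarrow> complex multiset" where
  "eigenvalue_mset A = proots (char_poly A)"

definition vec_l2_norm :: "complex vec \<Rightarrow> real" where
  "vec_l2_norm v = sqrt (\<Sum>i<dim_vec v. (cmod (v $ i))\<^sup>2)"

definition mat_op_norm :: "complex mat \<Rightarrow> real" where
  "mat_op_norm A =
     (SUP v \<in> {v \<in> carrier_vec (dim_col A). vec_l2_norm v \<le> 1}. vec_l2_norm (A *\<^sub>v v))"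

text \<open>The atom distribution \<open>\<mu>\<close> is that of \<open>sqrt n\<close> times an entry. It does not depend on \<open>n\<close>.
  The variance of a complex variable is the expected squared modulus, with no condition on the
  pseudo-variance, so real entries are a special case.\<close>

definition standardized_law :: "complex measure \<Rightarrow> bool" where
  "standardized_law \<mu> \<longleftrightarrow> prob_space \<mu> \<and> sets \<mu> = sets borel \<and>
     integrable \<mu> (\<lambda>z. (cmod z)\<^sup>2) \<and> (LINT z|\<mu>. z) = 0 \<and> (LINT z|\<mu>. (cmod z)\<^sup>2) = 1"

definition iid_matrix :: "complex measure \<Rightarrow> nat \<Rightarrow> 'w measure \<Rightarrow> ('w \<Rightarrow> complex mat) \<Rightarrow> bool" where
  "iid_matrix \<mu> n M X \<longleftrightarrow>
     prob_space M \<and>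
     (\<forall>\<omega>\<in>space M. X \<omega> \<in> carrier_mat n n) \<and>
     prob_space.indep_vars M (\<lambda>_. borel) (\<lambda>(i, j) \<omega>. X \<omega> $$ (i, j)) ({..<n} \<times> {..<n}) \<and>
     (\<forall>i<n. \<forall>j<n. distr M borel (\<lambda>\<omega>. complex_of_real (sqrt (real n)) * X \<omega> $$ (i, j)) = \<mu>)"

text \<open>Probability tending to 1. Stated through measurable sub-events, so that it is meaningful
  without first proving that the event itself is measurable; for a measurable event it says exactly
  that its probability tends to 1.\<close>

definition whp :: "(nat \<Rightarrow> 'w measure) \<Rightarrow> (nat \<Rightarrow> 'w \<Rightarrow> bool) \<Rightarrow> bool" where
  "whp M P \<longleftrightarrow>
     (\<exists>E. (\<forall>n. E n \<in> sets (M n)) \<and> (\<forall>n. \<forall>\<omega>\<in>E n. P n \<omega>) \<and>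
          (\<lambda>n. measure (M n) (E n)) \<longlonglongrightarrow> 1)"

text \<open>\<open>Y n - a n\<close> tends to 0 in probability, where the centre \<open>a n\<close> is deterministic and may move
  with \<open>n\<close>.\<close>

definition converges_in_prob ::
    "(nat \<Rightarrow> 'w measure) \<Rightarrow> (nat \<Rightarrow> 'w \<Rightarrow> complex) \<Rightarrow> (nat \<Rightarrow> complex) \<Rightarrow> bool" where
  "converges_in_prob M Y a \<longleftrightarrow> (\<forall>\<epsilon>>0. whp M (\<lambda>n \<omega>. cmod (Y n \<omega> - a n) < \<epsilon>))"

end

theory Submission
  imports
    Defs
    "HOL-Complex_Analysis.Complex_Analysis"
    "HOL-Computational_Algebra.Polynomial_FPS"
    "Jordan_Normal_Form.Schur_Decomposition"
    "Jordan_Normal_Form.Gram_Schmidt"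
begin

text \<open>With \<open>d z = det (1 - z C)\<close>, \<open>p z = det (1 - z X)\<close> and \<open>q z = det (1 - z (X + C))\<close>, the eigenvalues
  of modulus greater than \<open>1 / r\<close> are the reciprocals of the zeros in the disc of radius \<open>r < 1\<close>. It is
  enough that on this disc \<open>p\<close> is bounded away from 0 and \<open>q / p\<close> is close to \<open>d\<close>, both with probability
  close to 1.

  The coefficients of \<open>p\<close> are sums of principal minors, which are orthogonal polynomials in the entries, so
  only two moments are needed to bound them, and they change little in mean square when the entries are
  truncated. For truncated, hence bounded, entries the power sums \<open>tr X\<^sup>m\<close> have bounded second moments by a
  count of pairs of closed walks. This bounds the Taylor coefficients of \<open>1 / p\<close>, hence \<open>p\<close> from below.

  Write \<open>C = U W\<close> with factors through dimension \<open>k\<close>. By Sylvester's identity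
  \<open>q / p = det (1 - z W (1 - z X)\<^sup>-\<^sup>1 U)\<close>, a determinant of fixed size, while \<open>d = det (1 - z W U)\<close>.
  Multiplied by \<open>p\<close>, the difference of the entries of \<open>W (1 - z X)\<^sup>-\<^sup>1 U\<close> and \<open>W U\<close> is a polynomial in
  the entries of \<open>X\<close>, whose second moment is of order \<open>1 / n\<close>, again by orthogonality.\<close>

section \<open>Zeros of products close to a given product\<close>

text \<open>With only two moments the operator norm of \<open>X\<close> need not stay bounded, so
  the resolvent is never estimated in norm; everything passes through determinants, whose
  coefficients stay bounded in mean square. The coefficients of \<open>1 / p\<close> come from power
  sums by Newton's recursion, and power sums involve higher moments, hence the truncation. Its level
  must not spoil the lower bound for \<open>p\<close>: the bounds for the power sums are free of it
  once \<open>n\<close> is large, so it is chosen after all constants except the threshold for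
  \<open>n\<close>.

  The matching of zeros is therefore quantitative, with a threshold that depends only on bounds for
  the eigenvalues and on their numbers. Convergence in probability asks for one labelling valid for
  all \<epsilon>; the labelling minimises a cost in which no \<epsilon> occurs.\<close>

lemma separated_multiple:
  fixes D :: "real set"
  assumes "finite D" "\<tau> > 0"
  shows "\<exists>i\<in>{1..card D + 1}. \<forall>d\<in>D. \<bar>d - real i * \<tau>\<bar> \<ge> \<tau> / 2"
proof (rule ccontr)
  assume "\<not> ?thesis"
  then have "\<forall>i\<in>{1..card D + 1}. \<exists>d\<in>D. \<bar>d - real i * \<tau>\<bar> < \<tau> / 2"
    by (meson not_le)
  then obtain f where f: "\<And>i. i \<in> {1..card D + 1} \<Longrightarrow> f i \<in> D \<and> \<bar>f i - real i * \<tau>\<bar> < \<tau> / 2"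
    by metis
  \<comment> \<open>Pigeonhole: a point is at distance less than \<open>\<tau> / 2\<close> from at
    most one multiple of \<tau>, so \<open>card D\<close> points cannot spoil
    \<open>card D + 1\<close> multiples.\<close>
  have "inj_on f {1..card D + 1}"
  proof (rule inj_onI)
    fix i j assume ij: "i \<in> {1..card D + 1}" "j \<in> {1..card D + 1}" "f i = f j"
    have "\<bar>real i * \<tau> - real j * \<tau>\<bar> < \<tau>"
      using f[OF ij(1)] f[OF ij(2)] ij(3) by linarith
    then have "\<bar>real i - real j\<bar> * \<tau> < 1 * \<tau>"
      using assms(2) by (simp add: left_diff_distrib[symmetric] abs_mult)
    then have "\<bar>real i - real j\<bar> < 1"
      using assms(2) by (simp only: mult_less_cancel_right_pos)
    then show "i = j" by linarith
  qed
  then have "card {1..card D + 1} \<le> card D"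
    using f assms(1) by (intro card_inj_on_le[of f]) auto
  then show False by simp
qed

section \<open>Products of factors \<open>1 - z * x\<close>: bounds, zeros, holomorphy\<close>

lemma norm_prod_list_ge:
  fixes g :: "'b \<Rightarrow> complex"
  assumes "\<And>x. x \<in> set xs \<Longrightarrow> norm (g x) \<ge> B" "B \<ge> 0"
  shows "norm (\<Prod>x\<leftarrow>xs. g x) \<ge> B ^ length xs"
  using assms(1)
proof (induction xs)
  case (Cons a xs)
  then show ?case using assms(2) by (simp add: norm_mult mult_mono)
qed simp

lemma norm_prod_list_le:
  fixes g :: "'b \<Rightarrow> complex"
  assumes "\<And>x. x \<in> set xs \<Longrightarrow> norm (g x) \<le> B"
  shows "norm (\<Prod>x\<leftarrow>xs. g x) \<le> B ^ length xs"
  using assms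
proof (induction xs)
  case (Cons a xs)
  have "0 \<le> B" using Cons.prems[of a] by (meson list.set_intros(1) norm_ge_zero order_trans)
  then show ?case using Cons by (simp add: norm_mult mult_mono)
qed simp

lemma norm_prod_mset_ge:
  fixes g :: "'b \<Rightarrow> complex"
  assumes "\<And>x. x \<in># X \<Longrightarrow> norm (g x) \<ge> B" "0 \<le> B"
  shows "norm (\<Prod>x\<in>#X. g x) \<ge> B ^ size X"
  using assms(1)
proof (induction X)
  case (add a X)
  then show ?case using assms(2) by (simp add: norm_mult mult_mono)
qed simp

lemma norm_prod_mset_le:
  fixes g :: "'b \<Rightarrow> complex"
  assumes "\<And>x. x \<in># X \<Longrightarrow> norm (g x) \<le> B"
  shows "norm (\<Prod>x\<in>#X. g x) \<le> B ^ size X"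
  using assms
proof (induction X)
  case (add a X)
  have "0 \<le> B" using add.prems[of a] by (meson union_single_eq_member norm_ge_zero order_trans)
  then show ?case using add by (simp add: norm_mult mult_mono)
qed simp

lemma prod_mset_eq_0_iff':
  fixes g :: "'b \<Rightarrow> complex"
  shows "(\<Prod>x\<in>#X. g x) = 0 \<longleftrightarrow> (\<exists>x\<in>#X. g x = 0)"
  by (induction X) auto

lemma holomorphic_on_prod_mset:
  "(\<lambda>z. \<Prod>x\<in>#X. 1 - z * x) holomorphic_on A"
  by (induction X) (auto intro!: holomorphic_intros)

lemma holomorphic_on_prod_list:
  "(\<lambda>z. \<Prod>x\<leftarrow>X. 1 - z * x) holomorphic_on A"
  by (induction X) (auto intro!: holomorphic_intros)

text \<open>The maximum modulus principle for the reciprocal. It serves in contrapositive form: a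
  function that is large on a sphere and small at its centre has a zero inside.\<close>

lemma minimum_modulus_cball:
  assumes "h holomorphic_on ball b \<rho>" "continuous_on (cball b \<rho>) h" "0 < \<rho>"
    and "\<And>z. z \<in> cball b \<rho> \<Longrightarrow> h z \<noteq> 0"
    and "\<And>z. z \<in> sphere b \<rho> \<Longrightarrow> norm (h z) \<ge> m" "0 < m"
  shows "norm (h b) \<ge> m"
proof -
  have "norm (inverse (h b)) \<le> inverse m"
  proof (rule maximum_modulus_frontier[of "\<lambda>z. inverse (h z)" "cball b \<rho>"])
    show "(\<lambda>z. inverse (h z)) holomorphic_on interior (cball b \<rho>)"
      using assms by (auto intro!: holomorphic_intros)
    show "continuous_on (closure (cball b \<rho>)) (\<lambda>z. inverse (h z))"
      using assms by (auto intro!: continuous_intros)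
    show "norm (inverse (h z)) \<le> inverse m" if "z \<in> frontier (cball b \<rho>)" for z
      using that assms(5)[of z] assms(3,6) by (auto simp: norm_inverse intro!: le_imp_inverse_le)
  qed (use assms in auto)
  then show ?thesis
    using assms(3,4,6) by (simp add: norm_inverse)
qed

text \<open>The zeros close to the reciprocals of the \<open>cs\<close> are split off one at a time: the minimum
  modulus principle produces a zero, and the maximum modulus principle transfers the closeness to
  the quotients.\<close>

lemma match_zeros:
  fixes r a b s \<epsilon> :: real and m N :: nat
  assumes r: "0 < r" "0 \<le> a" "r * a < 1" "1 < r * b" and "\<epsilon> > 0"
  shows "\<exists>\<eta>>0. \<forall>cs Sm S w. length cs = m \<longrightarrow> (\<forall>c\<in>set cs. b < norm c \<and> norm c \<le> s) \<longrightarrow>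
     (\<forall>x\<in>#Sm. norm x \<le> a) \<longrightarrow> size Sm \<le> N \<longrightarrow>
     w holomorphic_on ball 0 r \<longrightarrow> continuous_on (cball 0 r) w \<longrightarrow> (\<forall>z\<in>cball 0 r. w z \<noteq> 0) \<longrightarrow>
     (\<forall>z\<in>cball 0 r. norm ((\<Prod>x\<in>#S. 1 - z * x) * w z -
         (\<Prod>x\<leftarrow>cs. 1 - z * x) * (\<Prod>x\<in>#Sm. 1 - z * x)) \<le> \<eta>) \<longrightarrow>
     (\<exists>as S'. S = mset as + S' \<and> length as = m \<and> (\<forall>i<m. norm (as ! i - cs ! i) < \<epsilon>) \<and>
        (\<forall>x\<in>#S'. norm x < 1 / r))"
  using \<open>\<epsilon> > 0\<close>
\<comment> \<open>The threshold \<eta> is chosen before the lists, the multisets and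
  \<open>w\<close>, and \<open>size S\<close> does not enter it. In the application \<open>S\<close>
  has \<open>n\<close> elements, so this makes the choice uniform in \<open>n\<close>.\<close>
proof (induction m arbitrary: \<epsilon>)
  case 0
  \<comment> \<open>Half of a lower bound for the product over \<open>Sm\<close> on the disc; a zero
    \<open>1 / x\<close> of the product over \<open>S\<close> in the disc would contradict the
    closeness.\<close>
  define \<eta> where "\<eta> = (1 - r * a) ^ N / 2"
  have \<eta>: "\<eta> > 0" using r by (simp add: \<eta>_def)
  show ?case
  proof (intro exI[of _ \<eta>] conjI allI impI)
    fix cs :: "complex list" and Sm S :: "complex multiset" and w
    assume A: "length cs = 0" "\<forall>x\<in>#Sm. norm x \<le> a" "size Sm \<le> N"
      "\<forall>z\<in>cball 0 r. norm ((\<Prod>x\<in>#S. 1 - z * x) * w z -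
         (\<Prod>x\<leftarrow>cs. 1 - z * x) * (\<Prod>x\<in>#Sm. 1 - z * x)) \<le> \<eta>"
    have "norm x < 1 / r" if "x \<in># S" for x
    proof (rule ccontr)
      assume "\<not> norm x < 1 / r"
      then have x: "norm x \<ge> 1 / r" by simp
      have x0: "x \<noteq> 0" using x r by auto
      define z where "z = 1 / x"
      have z: "z \<in> cball 0 r"
        using x r x0 by (simp add: z_def norm_divide field_simps)
      have "(\<Prod>x\<in>#S. 1 - z * x) = 0"
        using that x0 by (subst prod_mset_eq_0_iff') (auto simp: z_def intro!: bexI[of _ x])
      with A(4)[rule_format, OF z] A(1) have le: "norm (\<Prod>x\<in>#Sm. 1 - z * x) \<le> \<eta>" by simp
      have "norm (\<Prod>x\<in>#Sm. 1 - z * x) \<ge> (1 - r * a) ^ size Sm"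
      proof (rule norm_prod_mset_ge)
        fix y assume "y \<in># Sm"
        then have "norm (z * y) \<le> r * a" using A(2) z r by (auto simp: norm_mult intro!: mult_mono)
        then show "1 - r * a \<le> norm (1 - z * y)"
          using norm_triangle_ineq2[of 1 "z * y"] by simp
      qed (use r in auto)
      moreover have "(1 - r * a) ^ size Sm \<ge> (1 - r * a) ^ N"
        using A(3) r by (intro power_decreasing) auto
      moreover have "(1 - r * a) ^ N > 0" using r by simp
      ultimately show False using le by (simp add: \<eta>_def)
    qed
    then show "\<exists>as S'. S = mset as + S' \<and> length as = 0 \<and> (\<forall>i<0. norm (as ! i - cs ! i) < \<epsilon>) \<and>
        (\<forall>x\<in>#S'. norm x < 1 / r)"
      by (intro exI[of _ "[]"] exI[of _ S]) auto
  qed (rule \<eta>)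
next
  case (Suc m)
  obtain \<eta>' where \<eta>': "\<eta>' > 0" and IH: "\<And>cs Sm S w. length cs = m \<Longrightarrow>
     (\<forall>c\<in>set cs. b < norm c \<and> norm c \<le> s) \<Longrightarrow>
     (\<forall>x\<in>#Sm. norm x \<le> a) \<Longrightarrow> size Sm \<le> N \<Longrightarrow>
     w holomorphic_on ball 0 r \<Longrightarrow> continuous_on (cball 0 r) w \<Longrightarrow> (\<forall>z\<in>cball 0 r. w z \<noteq> 0) \<Longrightarrow>
     (\<forall>z\<in>cball 0 r. norm ((\<Prod>x\<in>#S. 1 - z * x) * w z -
         (\<Prod>x\<leftarrow>cs. 1 - z * x) * (\<Prod>x\<in>#Sm. 1 - z * x)) \<le> \<eta>') \<Longrightarrow>
     (\<exists>as S'. S = mset as + S' \<and> length as = m \<and> (\<forall>i<m. norm (as ! i - cs ! i) < \<epsilon>) \<and>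
        (\<forall>x\<in>#S'. norm x < 1 / r))"
    using Suc.IH[OF Suc.prems] by blast
  have b0: "b > 0" using r by (smt (verit) mult_nonneg_nonpos)
  define t where "t = max s 1"
  have t: "t \<ge> 1" "s \<le> t" by (auto simp: t_def)
  \<comment> \<open>\<alpha> bounds \<open>norm (1 - z * c)\<close> from below on the circle of
    radius \<open>r\<close>; \<open>B\<close> bounds the product without the factor of
    \<open>c\<close> from above there.\<close>
  define \<alpha> where "\<alpha> = r * b - 1"
  have \<alpha>: "\<alpha> > 0" using r by (simp add: \<alpha>_def)
  define B where "B = (1 + r * t) ^ m * 2 ^ N"
  have B: "B > 0" using r t by (simp add: B_def add_pos_nonneg)
  \<comment> \<open>Three demands on the distance between \<open>c\<close> and the new member
    \<open>x\<close>: the accuracy \<epsilon>, the bound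
    \<open>norm (1 - z * x) \<ge> \<alpha> / 2\<close> on the circle, and an error of at most
    \<open>\<eta>' / 2\<close> when the factor of \<open>c\<close> is exchanged for that of
    \<open>x\<close>.\<close>
  define \<epsilon>1 where "\<epsilon>1 = min \<epsilon> (min (\<alpha> / (2 * r)) (\<eta>' * \<alpha> / (4 * B * r)))"
  have \<epsilon>1: "\<epsilon>1 > 0" "\<epsilon>1 \<le> \<epsilon>" "\<epsilon>1 \<le> \<alpha> / (2 * r)" "\<epsilon>1 \<le> \<eta>' * \<alpha> / (4 * B * r)"
    using Suc.prems r \<eta>' \<alpha> B by (auto simp: \<epsilon>1_def)
  \<comment> \<open>This radius keeps the disc around \<open>1 / c\<close> inside
    \<open>ball 0 r\<close>, forces \<open>norm x \<le> 2 * t\<close> for a zero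
    \<open>1 / x\<close> in it, and turns the distance of the reciprocals into
    \<open>norm (x - c) \<le> \<epsilon>1 / 2\<close>.\<close>
  define \<rho>0 where "\<rho>0 = min (r - 1 / b) (min (1 / (2 * t)) (\<epsilon>1 / (4 * t\<^sup>2)))"
  have rb: "r - 1 / b > 0" using r b0 by (simp add: field_simps)
  have \<rho>0: "\<rho>0 > 0" "\<rho>0 \<le> r - 1 / b" "\<rho>0 \<le> 1 / (2 * t)" "\<rho>0 \<le> \<epsilon>1 / (4 * t\<^sup>2)"
    using rb \<epsilon>1 t by (auto simp: \<rho>0_def)
  \<comment> \<open>The list has \<open>m + 1\<close> members, so \<open>m + 2\<close> multiples of
    \<tau> are on offer, the largest being \<open>\<rho>0\<close>.\<close>
  define \<tau> where "\<tau> = \<rho>0 / (real m + 2)"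
  have \<tau>: "\<tau> > 0" using \<rho>0 by (simp add: \<tau>_def)
  define m0 where "m0 = (b * \<tau> / 2) ^ Suc m * (1 - r * a) ^ N"
  have m0: "m0 > 0" using b0 \<tau> r by (simp add: m0_def)
  \<comment> \<open>On the chosen sphere \<open>h\<close> has modulus at least
    \<open>m0 - m0 / 3\<close>, at its centre at most \<open>m0 / 3\<close>; the value
    \<open>m0 / 2\<close> lies between. The second bound pays for the division by
    \<open>1 - z * x\<close>.\<close>
  define \<eta> where "\<eta> = min (m0 / 3) (\<alpha> * \<eta>' / 4)"
  have \<eta>: "\<eta> > 0" "\<eta> \<le> m0 / 3" "\<eta> \<le> \<alpha> * \<eta>' / 4" using m0 \<alpha> \<eta>' by (auto simp: \<eta>_def)
  show ?case
  proof (intro exI[of _ \<eta>] conjI allI impI)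
    fix cs0 :: "complex list" and Sm S :: "complex multiset" and w
    assume len: "length cs0 = Suc m" and cs0: "\<forall>c\<in>set cs0. b < norm c \<and> norm c \<le> s"
      and Sm: "\<forall>x\<in>#Sm. norm x \<le> a" "size Sm \<le> N"
      and w: "w holomorphic_on ball 0 r" "continuous_on (cball 0 r) w" "\<forall>z\<in>cball 0 r. w z \<noteq> 0"
      and close: "\<forall>z\<in>cball 0 r. norm ((\<Prod>x\<in>#S. 1 - z * x) * w z -
         (\<Prod>x\<leftarrow>cs0. 1 - z * x) * (\<Prod>x\<in>#Sm. 1 - z * x)) \<le> \<eta>"
    obtain c cs where cs: "cs0 = c # cs" using len by (cases cs0) auto
    define f where "f = (\<lambda>z. (\<Prod>x\<leftarrow>cs0. 1 - z * x) * (\<Prod>x\<in>#Sm. 1 - z * x))"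
    define h where "h = (\<lambda>z. (\<Prod>x\<in>#S. 1 - z * x) * w z)"
    have hf: "norm (h z - f z) \<le> \<eta>" if "z \<in> cball 0 r" for z
      using close that by (simp add: h_def f_def)
    have c: "b < norm c" "norm c \<le> t" using cs0 cs t by auto
    have c0: "c \<noteq> 0" using c b0 by auto
    define p where "p = 1 / c"
    have np: "norm p < 1 / b" using c b0 by (auto simp: p_def norm_divide intro!: divide_strict_left_mono mult_pos_pos)
    define D where "D = (\<lambda>y. dist p (1 / y)) ` set cs0"
    have cD: "card D \<le> Suc m" "finite D"
      using len card_length[of cs0] card_image_le[of "set cs0"] by (auto simp: D_def intro: order_trans)
    \<comment> \<open>Other members of the list may lie arbitrarily close to \<open>c\<close>, so no
      radius fixed in advance avoids all their reciprocals; it has to be adapted to the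
      list.\<close>
    obtain i where i: "i \<in> {1..card D + 1}" "\<forall>d\<in>D. \<bar>d - real i * \<tau>\<bar> \<ge> \<tau> / 2"
      using separated_multiple[OF cD(2) \<tau>] by auto
    define \<rho> where "\<rho> = real i * \<tau>"
    have \<rho>: "\<rho> > 0" "\<rho> \<le> \<rho>0"
    proof -
      show "\<rho> > 0" using i \<tau> by (simp add: \<rho>_def)
      have "real i \<le> real m + 2" using i cD by auto
      then have "real i * \<rho>0 \<le> (real m + 2) * \<rho>0" using \<rho>0(1) by (intro mult_right_mono) auto
      then show "\<rho> \<le> \<rho>0" by (simp add: \<rho>_def \<tau>_def field_simps)
    qed
    have sub: "cball p \<rho> \<subseteq> ball 0 r"
    proof
      fix z assume "z \<in> cball p \<rho>"
      then have "norm z \<le> norm p + \<rho>"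
        using norm_triangle_ineq2[of z p] by (simp add: dist_norm norm_minus_commute)
      then show "z \<in> ball 0 r" using np \<rho> \<rho>0 by simp
    qed
    have fge: "norm (f z) \<ge> m0" if z: "z \<in> sphere p \<rho>" for z
    proof -
      have zr: "norm z < r" using sub z by force
      have "norm (\<Prod>x\<leftarrow>cs0. 1 - z * x) \<ge> (b * \<tau> / 2) ^ length cs0"
      proof (rule norm_prod_list_ge)
        fix y assume y: "y \<in> set cs0"
        then have ny: "norm y \<ge> b" "y \<noteq> 0" using cs0 b0 by auto
        have "\<bar>dist p (1 / y) - \<rho>\<bar> \<ge> \<tau> / 2" using i(2) y by (auto simp: D_def \<rho>_def)
        moreover have "dist p z = \<rho>" using z by simp
        ultimately have "dist z (1 / y) \<ge> \<tau> / 2"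
          using dist_triangle[of p "1/y" z] dist_triangle[of p z "1/y"]
          by (smt (verit) dist_commute)
        then have "norm y * dist z (1 / y) \<ge> b * (\<tau> / 2)"
          using ny b0 \<tau> by (intro mult_mono) auto
        moreover have "norm (1 - z * y) = norm y * dist z (1 / y)"
        proof -
          have "1 - z * y = y * (1 / y - z)" using ny by (simp add: field_simps)
          then show ?thesis by (simp add: norm_mult dist_norm norm_minus_commute)
        qed
        ultimately show "b * \<tau> / 2 \<le> norm (1 - z * y)" by simp
      qed (use b0 \<tau> in auto)
      moreover have "norm (\<Prod>x\<in>#Sm. 1 - z * x) \<ge> (1 - r * a) ^ size Sm"
      proof (rule norm_prod_mset_ge)
        fix y assume "y \<in># Sm"
        then have "norm (z * y) \<le> r * a" using Sm zr r by (auto simp: norm_mult intro!: mult_mono)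
        then show "1 - r * a \<le> norm (1 - z * y)"
          using norm_triangle_ineq2[of 1 "z * y"] by simp
      qed (use r in auto)
      moreover have "(1 - r * a) ^ size Sm \<ge> (1 - r * a) ^ N"
        using Sm(2) r by (intro power_decreasing) auto
      ultimately show ?thesis
        unfolding f_def m0_def norm_mult len
        using b0 \<tau> r by (intro mult_mono) auto
    qed
    have hhol: "h holomorphic_on ball 0 r" "continuous_on (cball 0 r) h"
      using w unfolding h_def
      by (auto intro!: holomorphic_intros holomorphic_on_prod_mset continuous_intros
          holomorphic_on_imp_continuous_on[OF holomorphic_on_prod_mset])
    have "f p = 0" using c0 by (simp add: f_def cs p_def)
    have "\<exists>z0\<in>cball p \<rho>. h z0 = 0"
    proof (rule ccontr)
      assume nz: "\<not> ?thesis"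
      have "norm (h p) \<ge> m0 / 2"
      proof (rule minimum_modulus_cball[of h p \<rho> "m0 / 2"])
        show "h holomorphic_on ball p \<rho>"
          using hhol(1) sub by (meson ball_subset_cball holomorphic_on_subset subset_trans)
        show "continuous_on (cball p \<rho>) h"
          using hhol(2) sub by (meson ball_subset_cball continuous_on_subset subset_trans)
        show "m0 / 2 \<le> norm (h z)" if "z \<in> sphere p \<rho>" for z
        proof -
          have "z \<in> cball p \<rho>" using that by simp
          then have "z \<in> cball 0 r" using sub by (meson ball_subset_cball subsetD)
          then have "norm (h z - f z) \<le> \<eta>" by (rule hf)
          then show ?thesis
            using fge[OF that] \<eta>(2) m0 norm_triangle_ineq2[of "f z" "h z"]
            by (simp add: norm_minus_commute)
        qed
      qed (use \<rho> m0 nz in auto)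
      moreover have "p \<in> cball p \<rho>" using \<rho> by simp
      then have "p \<in> cball 0 r" using sub by (meson ball_subset_cball subsetD)
      then have "norm (h p) \<le> \<eta>" using hf[of p] \<open>f p = 0\<close> by simp
      ultimately show False using \<eta> m0 by linarith
    qed
    then obtain z0 where z0: "z0 \<in> cball p \<rho>" "h z0 = 0" by blast
    have z0r: "z0 \<in> cball 0 r" using z0(1) sub by (meson ball_subset_cball subsetD)
    then have "(\<Prod>x\<in>#S. 1 - z0 * x) = 0" using z0(2) w(3) by (auto simp: h_def)
    then obtain x where x: "x \<in># S" "1 - z0 * x = 0" by (auto simp: prod_mset_eq_0_iff')
    have x0: "x \<noteq> 0" using x by auto
    then have z0x: "z0 = 1 / x" using x by (simp add: field_simps)
    have xc: "norm (x - c) < \<epsilon>1"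
    proof -
      have d: "norm (1 / c - 1 / x) \<le> \<rho>0" using z0(1) \<rho> z0x by (simp add: p_def dist_norm)
      have "norm (1 / c) \<ge> 1 / t" using c c0 b0 by (simp add: norm_divide field_simps)
      then have "norm (1 / x) \<ge> 1 / t - 1 / (2 * t)"
        using d \<rho>0(3) norm_triangle_ineq2[of "1/c" "1/x"] by linarith
      then have "1 / norm x \<ge> 1 / (2 * t)" using t by (simp add: norm_divide field_simps)
      then have nx: "norm x \<le> 2 * t" using t x0 by (simp add: field_simps)
      have "x - c = (1 / c - 1 / x) * (x * c)" using c0 x0 by (simp add: field_simps)
      then have "norm (x - c) = norm (1 / c - 1 / x) * (norm x * norm c)" by (simp add: norm_mult)
      also have "\<dots> \<le> (\<epsilon>1 / (4 * t\<^sup>2)) * ((2 * t) * t)"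
        using d \<rho>0(4) nx c t \<epsilon>1(1) by (intro mult_mono) auto
      also have "\<dots> = \<epsilon>1 / 2" using t by (simp add: field_simps power2_eq_square)
      finally show ?thesis using \<epsilon>1(1) by linarith
    qed
    define S1 where "S1 = S - {#x#}"
    have S1: "S = add_mset x S1" using x by (simp add: S1_def)
    define f1 where "f1 = (\<lambda>z. (\<Prod>x\<leftarrow>cs. 1 - z * x) * (\<Prod>x\<in>#Sm. 1 - z * x))"
    define h1 where "h1 = (\<lambda>z. (\<Prod>x\<in>#S1. 1 - z * x) * w z)"
    \<comment> \<open>Inside the disc the factors \<open>1 - z * c\<close> and
      \<open>1 - z * x\<close> have zeros, so the estimate is made on the boundary only, where both
      are bounded away from 0.\<close>
    have close1: "norm (h1 z - f1 z) \<le> \<eta>'" if "z \<in> cball 0 r" for z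
    proof (rule maximum_modulus_frontier[of "\<lambda>z. h1 z - f1 z" "cball 0 r"])
      show "(\<lambda>z. h1 z - f1 z) holomorphic_on interior (cball 0 r)"
        using w unfolding h1_def f1_def
        by (auto intro!: holomorphic_intros holomorphic_on_prod_mset holomorphic_on_prod_list)
      show "continuous_on (closure (cball 0 r)) (\<lambda>z. h1 z - f1 z)"
        using w unfolding h1_def f1_def
        by (auto intro!: continuous_intros holomorphic_on_imp_continuous_on[OF holomorphic_on_prod_mset]
            holomorphic_on_imp_continuous_on[OF holomorphic_on_prod_list])
      fix z :: complex assume "z \<in> frontier (cball 0 r)"
      then have z: "norm z = r" using r by simp
      have "norm (z * c) \<ge> r * b" using z c r by (simp add: norm_mult)
      then have zc: "norm (1 - z * c) \<ge> \<alpha>"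
        using norm_triangle_ineq2[of "z * c" 1] by (simp add: norm_minus_commute \<alpha>_def)
      have "norm (z * (x - c)) \<le> r * \<epsilon>1" using z xc r by (simp add: norm_mult)
      also have "\<dots> \<le> \<alpha> / 2" using \<epsilon>1(3) r by (simp add: field_simps)
      finally have zx: "norm (1 - z * x) \<ge> \<alpha> / 2"
        using zc norm_triangle_ineq2[of "1 - z * c" "z * (x - c)"] by (simp add: algebra_simps)
      have zx0: "1 - z * x \<noteq> 0" using zx \<alpha> by auto
      have nf1: "norm (f1 z) \<le> B"
      proof -
        have "norm (\<Prod>x\<leftarrow>cs. 1 - z * x) \<le> (1 + r * t) ^ length cs"
        proof (rule norm_prod_list_le)
          fix y assume "y \<in> set cs"
          then have "norm y \<le> t" using cs0 cs t by auto
          then have "norm (z * y) \<le> r * t" using z r by (simp add: norm_mult)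
          then show "norm (1 - z * y) \<le> 1 + r * t"
            using norm_triangle_ineq4[of 1 "z * y"] by simp
        qed
        moreover have "norm (\<Prod>x\<in>#Sm. 1 - z * x) \<le> 2 ^ size Sm"
        proof (rule norm_prod_mset_le)
          fix y assume "y \<in># Sm"
          then have "norm (z * y) \<le> r * a" using Sm z r by (auto simp: norm_mult intro!: mult_mono)
          then show "norm (1 - z * y) \<le> 2"
            using norm_triangle_ineq4[of 1 "z * y"] r by simp
        qed
        moreover have "(2::real) ^ size Sm \<le> 2 ^ N" using Sm by (intro power_increasing) auto
        moreover have "length cs = m" using len cs by simp
        ultimately show ?thesis
          unfolding f1_def norm_mult B_def using r t by (intro mult_mono) (auto intro: order_trans)
      qed
      \<comment> \<open>Exchanging \<open>1 - z * c\<close> for \<open>1 - z * x\<close> costs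
        \<open>f1 z * (z * (x - c))\<close>, since the two factors differ by
        \<open>z * (x - c)\<close>.\<close>
      have eq: "h1 z - f1 z = (h z - f z) / (1 - z * x) + f1 z * (z * (x - c)) / (1 - z * x)"
      proof -
        have "h z = (1 - z * x) * h1 z" "f z = (1 - z * c) * f1 z"
          by (simp_all add: h_def h1_def S1 f_def f1_def cs)
        then have "h z - f z + f1 z * (z * (x - c)) = (1 - z * x) * (h1 z - f1 z)"
          by (simp add: algebra_simps)
        then show ?thesis using zx0 by (simp add: add_divide_distrib[symmetric])
      qed
      have "norm (h1 z - f1 z) \<le> norm ((h z - f z) / (1 - z * x)) + norm (f1 z * (z * (x - c)) / (1 - z * x))"
        unfolding eq by (rule norm_triangle_ineq)
      also have "norm ((h z - f z) / (1 - z * x)) \<le> \<eta> / (\<alpha> / 2)"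
        unfolding norm_divide using hf[of z] z zx \<alpha> \<eta> by (intro frac_le) auto
      also have "norm (f1 z * (z * (x - c)) / (1 - z * x)) \<le> (B * (r * \<epsilon>1)) / (\<alpha> / 2)"
        unfolding norm_divide
      proof (rule frac_le)
        show "norm (f1 z * (z * (x - c))) \<le> B * (r * \<epsilon>1)"
          unfolding norm_mult[of "f1 z"]
          using nf1 \<open>norm (z * (x - c)) \<le> r * \<epsilon>1\<close> B by (intro mult_mono) auto
      qed (use zx \<alpha> B r \<epsilon>1 in auto)
      also have "\<eta> / (\<alpha> / 2) \<le> \<eta>' / 2" using \<eta>(3) \<alpha> by (simp add: field_simps)
      also have "(B * (r * \<epsilon>1)) / (\<alpha> / 2) \<le> \<eta>' / 2"
        using \<epsilon>1(4) \<alpha> B r by (simp add: field_simps)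
      finally show "norm (h1 z - f1 z) \<le> \<eta>'" by simp
    qed (use that in auto)
    have "\<exists>as S'. S1 = mset as + S' \<and> length as = m \<and> (\<forall>i<m. norm (as ! i - cs ! i) < \<epsilon>) \<and>
        (\<forall>x\<in>#S'. norm x < 1 / r)"
    proof (rule IH[of cs Sm w S1])
      show "\<forall>z\<in>cball 0 r. norm ((\<Prod>x\<in>#S1. 1 - z * x) * w z -
         (\<Prod>x\<leftarrow>cs. 1 - z * x) * (\<Prod>x\<in>#Sm. 1 - z * x)) \<le> \<eta>'"
        using close1 by (simp add: h1_def f1_def)
    qed (use len cs cs0 Sm w in auto)
    then obtain as S' where as: "S1 = mset as + S'" "length as = m"
      "\<forall>i<m. norm (as ! i - cs ! i) < \<epsilon>" "\<forall>x\<in>#S'. norm x < 1 / r" by blast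
    show "\<exists>as S'. S = mset as + S' \<and> length as = Suc m \<and> (\<forall>i<Suc m. norm (as ! i - cs0 ! i) < \<epsilon>) \<and>
        (\<forall>x\<in>#S'. norm x < 1 / r)"
    proof (intro exI[of _ "x # as"] exI[of _ S'] conjI allI impI)
      fix i assume "i < Suc m"
      then show "norm ((x # as) ! i - cs0 ! i) < \<epsilon>"
        using as xc \<epsilon>1(2) cs by (cases i) auto
    qed (use as S1 in auto)
  qed (rule \<eta>)
qed

section \<open>Principal minors as sums over permutations\<close>

abbreviation perm_sign :: "('a \<Rightarrow> 'a) \<Rightarrow> complex" where
  "perm_sign \<sigma> \<equiv> of_int (sign \<sigma>)"

text \<open>The set of matrix positions occurring in one term of a determinant. Monomials are
  indexed by sets of positions because the orthogonality of products of independent entries depends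
  on these sets alone.\<close>

definition perm_graph :: "nat set \<Rightarrow> (nat \<Rightarrow> nat) \<Rightarrow> (nat \<times> nat) set" where
  "perm_graph I \<sigma> = (\<lambda>i. (i, \<sigma> i)) ` I"

definition minor_idx :: "nat \<Rightarrow> nat \<Rightarrow> (nat set \<times> (nat \<Rightarrow> nat)) set" where
  "minor_idx n k = (SIGMA I:{I. I \<subseteq> {..<n} \<and> card I = k}. {\<sigma>. \<sigma> permutes I})"

text \<open>The sum of the principal \<open>k \<times> k\<close> minors.\<close>

definition minor_sum :: "nat \<Rightarrow> nat \<Rightarrow> (nat \<times> nat \<Rightarrow> complex) \<Rightarrow> complex" where
  "minor_sum n k x = (\<Sum>(I, \<sigma>)\<in>minor_idx n k. perm_sign \<sigma> * (\<Prod>e\<in>perm_graph I \<sigma>. x e))"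

text \<open>Permutations of \<open>insert b I\<close> from which the arrow leaving \<open>b\<close>
  is removed: what remains on \<open>I\<close> are disjoint cycles and one path from
  \<open>\<sigma> b\<close> to \<open>b\<close>. These are the terms of the off-diagonal entries of
  the adjugate matrix.\<close>

definition open_idx :: "nat \<Rightarrow> nat \<Rightarrow> (nat \<times> nat set \<times> (nat \<Rightarrow> nat)) set" where
  "open_idx n k = (SIGMA b:{..<n}. SIGMA I:{I. I \<subseteq> {..<n} - {b} \<and> card I = k}.
      {\<sigma>. \<sigma> permutes insert b I \<and> \<sigma> b \<noteq> b})"

text \<open>Together with \<open>open_coeff\<close> these are, up to sign, the coefficients of a
  bilinear form of the resolvent minus its value at \<open>z = 0\<close>, multiplied by
  \<open>det (1 - z X)\<close>; see \<open>cramer_expand\<close>. Later \<open>u\<close> is a column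
  of \<open>U\<close> and \<open>v\<close> a row of \<open>W\<close>.\<close>

definition closed_coeff :: "nat \<Rightarrow> nat \<Rightarrow> (nat \<Rightarrow> complex) \<Rightarrow> (nat \<Rightarrow> complex) \<Rightarrow> (nat \<times> nat \<Rightarrow> complex) \<Rightarrow> complex"
  where "closed_coeff n k u v x =
    (\<Sum>(I, \<sigma>)\<in>minor_idx n k. (\<Sum>b\<in>I. u b * v b) * perm_sign \<sigma> * (\<Prod>e\<in>perm_graph I \<sigma>. x e))"

definition open_coeff :: "nat \<Rightarrow> nat \<Rightarrow> (nat \<Rightarrow> complex) \<Rightarrow> (nat \<Rightarrow> complex) \<Rightarrow> (nat \<times> nat \<Rightarrow> complex) \<Rightarrow> complex"
  where "open_coeff n k u v x =
    (\<Sum>(b, I, \<sigma>)\<in>open_idx n k. u b * v (\<sigma> b) * perm_sign \<sigma> * (\<Prod>e\<in>perm_graph I \<sigma>. x e))"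

lemma prod_perm_graph: "(\<Prod>e\<in>perm_graph I \<sigma>. x e) = (\<Prod>i\<in>I. x (i, \<sigma> i))"
  unfolding perm_graph_def by (subst prod.reindex) (auto simp: inj_on_def)

lemma card_perm_graph [simp]: "card (perm_graph I \<sigma>) = card I"
  unfolding perm_graph_def by (rule card_image) (auto simp: inj_on_def)

lemma finite_subset_idx: "finite {I. I \<subseteq> {..<n::nat} \<and> P I}"
  by (rule finite_subset[of _ "Pow {..<n}"]) auto

lemma finite_minor_idx [simp]: "finite (minor_idx n k)"
  unfolding minor_idx_def
  by (intro finite_SigmaI finite_subset_idx) (auto intro: finite_permutations finite_subset)

lemma finite_open_idx [simp]: "finite (open_idx n k)"
  unfolding open_idx_def
proof (intro finite_SigmaI)
  fix b I assume "I \<in> {I. I \<subseteq> {..<n} - {b} \<and> card I = k}"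
  then have "finite (insert b I)" by (auto intro: finite_subset)
  from finite_permutations[OF this] show "finite {\<sigma>. \<sigma> permutes insert b I \<and> \<sigma> b \<noteq> b}"
    by (rule finite_subset[rotated]) auto
qed (auto intro: finite_subset[of _ "Pow {..<n}"])

lemma perm_graph_subset: "I \<subseteq> {..<n} \<Longrightarrow> \<sigma> ` I \<subseteq> {..<n} \<Longrightarrow> perm_graph I \<sigma> \<subseteq> {..<n} \<times> {..<n}"
  by (auto simp: perm_graph_def)

lemma perm_graph_eqD:
  assumes "perm_graph I \<sigma> = perm_graph I' \<sigma>'"
  shows "I = I'" "\<And>i. i \<in> I \<Longrightarrow> \<sigma> i = \<sigma>' i"
proof -
  have "fst ` perm_graph I \<sigma> = I" "fst ` perm_graph I' \<sigma>' = I'"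
    by (auto simp: perm_graph_def image_image)
  then show "I = I'" using assms by simp
  fix i assume "i \<in> I"
  then have "(i, \<sigma> i) \<in> perm_graph I' \<sigma>'" using assms by (auto simp: perm_graph_def)
  then show "\<sigma> i = \<sigma>' i" by (auto simp: perm_graph_def)
qed

text \<open>Outside \<open>I\<close> the permutation is the identity, so its arrows on
  \<open>I\<close> determine it. Injectivity makes the terms of \<open>minor_sum\<close> pairwise
  orthogonal.\<close>

lemma inj_on_minor_idx: "inj_on (\<lambda>(I, \<sigma>). perm_graph I \<sigma>) (minor_idx n k)"
proof (rule inj_onI, clarify)
  fix I \<sigma> I' \<sigma>'
  assume A: "(I, \<sigma>) \<in> minor_idx n k" "(I', \<sigma>') \<in> minor_idx n k" "perm_graph I \<sigma> = perm_graph I' \<sigma>'"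
  note B = perm_graph_eqD[OF A(3)]
  have "\<sigma> i = \<sigma>' i" for i
  proof (cases "i \<in> I")
    case False
    then show ?thesis using A(1,2) B(1) by (auto simp: minor_idx_def permutes_def)
  qed (rule B(2))
  then show "I = I' \<and> \<sigma> = \<sigma>'" using B(1) by auto
qed

text \<open>Both ends of the open path can be read off its arrows: \<open>b\<close> is the only
  vertex entered but not left, \<open>\<sigma> b\<close> the only one left but not entered.\<close>

lemma image_open:
  assumes "b \<notin> I" "\<sigma> permutes insert b I" "\<sigma> b \<noteq> b"
  shows "\<sigma> ` I - I = {b}" "insert b I - \<sigma> ` I = {\<sigma> b}"
proof -
  have inj: "inj \<sigma>" using assms(2) permutes_inj by blast
  have im: "\<sigma> ` insert b I = insert b I" using assms(2) permutes_image by blast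
  have 1: "\<sigma> ` I = insert b I - {\<sigma> b}"
  proof -
    have "I = insert b I - {b}" using assms(1) by auto
    then have "\<sigma> ` I = \<sigma> ` insert b I - \<sigma> ` {b}" by (metis image_set_diff[OF inj])
    from this[unfolded im] show ?thesis by simp
  qed
  have "\<sigma> b \<in> insert b I" using im by blast
  then show "insert b I - \<sigma> ` I = {\<sigma> b}" "\<sigma> ` I - I = {b}" unfolding 1 using assms(1,3) by auto
qed

text \<open>Removing the arrow at \<open>b\<close> loses no information, as both ends of the path
  are visible in the graph. For \<open>\<sigma> b = b\<close> the vertex \<open>b\<close> could not
  be recovered, which is why \<open>open_idx\<close> excludes this case.\<close>

lemma inj_on_open_idx: "inj_on (\<lambda>(b, I, \<sigma>). perm_graph I \<sigma>) (open_idx n k)"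
proof (rule inj_onI)
  fix s t assume st: "s \<in> open_idx n k" "t \<in> open_idx n k"
    "(case s of (b, I, \<sigma>) \<Rightarrow> perm_graph I \<sigma>) = (case t of (b, I, \<sigma>) \<Rightarrow> perm_graph I \<sigma>)"
  obtain b I \<sigma> b' I' \<sigma>' where s: "s = (b, I, \<sigma>)" and t: "t = (b', I', \<sigma>')"
    by (metis surj_pair)
  have A: "(b, I, \<sigma>) \<in> open_idx n k" "(b', I', \<sigma>') \<in> open_idx n k" "perm_graph I \<sigma> = perm_graph I' \<sigma>'"
    using st by (auto simp: s t)
  note B = perm_graph_eqD[OF A(3)]
  have C: "b \<notin> I" "\<sigma> permutes insert b I" "\<sigma> b \<noteq> b" "b' \<notin> I" "\<sigma>' permutes insert b' I" "\<sigma>' b' \<noteq> b'"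
    using A B(1) by (auto simp: open_idx_def)
  have im: "\<sigma> ` I = \<sigma>' ` I" using B(2) by (intro image_cong) auto
  have b: "b = b'" using image_open(1)[OF C(1-3)] image_open(1)[OF C(4-6)] im by auto
  have sb: "\<sigma> b = \<sigma>' b" using image_open(2)[OF C(1-3)] image_open(2)[OF C(4-6)] im b by auto
  have "\<sigma> i = \<sigma>' i" for i
  proof (cases "i \<in> insert b I")
    case False
    then show ?thesis using C b by (auto simp: permutes_def)
  qed (use B(2) sb in auto)
  then show "s = t" using B(1) b by (auto simp: s t)
qed

section \<open>Expansion of \<open>det (1 - z X)\<close> into principal minors\<close>

lemma prod_add_expand:
  fixes f g :: "'a \<Rightarrow> complex"
  assumes "finite A"
  shows "(\<Prod>i\<in>A. f i + g i) = (\<Sum>I\<in>Pow A. (\<Prod>i\<in>I. f i) * (\<Prod>i\<in>A - I. g i))"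
  using assms
proof (induction A)
  case (insert a A)
  have disj: "Pow A \<inter> insert a ` Pow A = {}" using insert(2) by auto
  have inj: "inj_on (insert a) (Pow A)" using insert(2) by (auto simp: inj_on_def)
  have "(\<Sum>I\<in>Pow (insert a A). (\<Prod>i\<in>I. f i) * (\<Prod>i\<in>insert a A - I. g i)) =
     (\<Sum>I\<in>Pow A. (\<Prod>i\<in>I. f i) * (\<Prod>i\<in>insert a A - I. g i)) +
     (\<Sum>I\<in>Pow A. (\<Prod>i\<in>insert a I. f i) * (\<Prod>i\<in>insert a A - insert a I. g i))"
    unfolding Pow_insert using insert(1) disj inj
    by (simp add: sum.union_disjoint sum.reindex)
  also have "(\<Sum>I\<in>Pow A. (\<Prod>i\<in>I. f i) * (\<Prod>i\<in>insert a A - I. g i)) =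
     (\<Sum>I\<in>Pow A. g a * ((\<Prod>i\<in>I. f i) * (\<Prod>i\<in>A - I. g i)))"
  proof (rule sum.cong)
    fix I assume I: "I \<in> Pow A"
    then have "insert a A - I = insert a (A - I)" using insert(2) by auto
    then show "(\<Prod>i\<in>I. f i) * (\<Prod>i\<in>insert a A - I. g i) = g a * ((\<Prod>i\<in>I. f i) * (\<Prod>i\<in>A - I. g i))"
      using insert I by (simp add: mult_ac)
  qed simp
  also have "(\<Sum>I\<in>Pow A. (\<Prod>i\<in>insert a I. f i) * (\<Prod>i\<in>insert a A - insert a I. g i)) =
     (\<Sum>I\<in>Pow A. f a * ((\<Prod>i\<in>I. f i) * (\<Prod>i\<in>A - I. g i)))"
  proof (rule sum.cong)
    fix I assume I: "I \<in> Pow A"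
    then have "insert a A - insert a I = A - I" "a \<notin> I" "finite I"
      using insert by (auto intro: finite_subset)
    then show "(\<Prod>i\<in>insert a I. f i) * (\<Prod>i\<in>insert a A - insert a I. g i) = f a * ((\<Prod>i\<in>I. f i) * (\<Prod>i\<in>A - I. g i))"
      by (simp add: mult_ac)
  qed simp
  finally show ?case using insert by (simp add: sum_distrib_left[symmetric] algebra_simps)
qed simp

lemma permutes_iff_fixes:
  assumes "I \<subseteq> A"
  shows "\<sigma> permutes A \<and> (\<forall>i\<in>A - I. \<sigma> i = i) \<longleftrightarrow> \<sigma> permutes I"
proof (rule iffI)
  assume A: "\<sigma> permutes A \<and> (\<forall>i\<in>A - I. \<sigma> i = i)"
  show "\<sigma> permutes I"
    by (rule permutes_superset[OF conjunct1[OF A]]) (rule bspec[OF conjunct2[OF A]])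
next
  assume P: "\<sigma> permutes I"
  have "\<sigma> i = i" if "i \<in> A - I" for i
    using that by (intro permutes_not_in[OF P]) simp
  with permutes_subset[OF P assms] show "\<sigma> permutes A \<and> (\<forall>i\<in>A - I. \<sigma> i = i)"
    by blast
qed

text \<open>\<open>I\<close> collects the rows from which the entry of \<open>- z X\<close> is
  taken; the other rows contribute entries of the identity matrix, which vanish unless \<sigma>
  fixes these rows.\<close>

lemma prod_resolvent_expand:
  assumes "finite A"
  shows "(\<Prod>i\<in>A. (if \<sigma> i = i then 1 else 0) - z * x (i, \<sigma> i)) =
    (\<Sum>I\<in>Pow A. if \<forall>i\<in>A - I. \<sigma> i = i then (-z) ^ card I * (\<Prod>i\<in>I. x (i, \<sigma> i)) else (0::complex))"
proof -
  have "(\<Prod>i\<in>A. (if \<sigma> i = i then 1 else 0) - z * x (i, \<sigma> i)) =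
     (\<Prod>i\<in>A. (- z * x (i, \<sigma> i)) + (if \<sigma> i = i then 1 else 0))" by simp
  also have "\<dots> = (\<Sum>I\<in>Pow A. (\<Prod>i\<in>I. - z * x (i, \<sigma> i)) * (\<Prod>i\<in>A - I. if \<sigma> i = i then 1 else 0))"
    using assms by (rule prod_add_expand)
  also have "\<dots> = (\<Sum>I\<in>Pow A. if \<forall>i\<in>A - I. \<sigma> i = i then (-z) ^ card I * (\<Prod>i\<in>I. x (i, \<sigma> i)) else (0::complex))"
  proof (rule sum.cong)
    fix I
    have "(\<Prod>i\<in>A - I. if \<sigma> i = i then 1 else (0::complex)) = (if \<forall>i\<in>A - I. \<sigma> i = i then 1 else 0)"
      using assms by (auto intro!: prod_zero)
    moreover have "(\<Prod>i\<in>I. - z * x (i, \<sigma> i)) = (-z) ^ card I * (\<Prod>i\<in>I. x (i, \<sigma> i))"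
      by (simp only: prod.distrib prod_constant)
    ultimately show "(\<Prod>i\<in>I. - z * x (i, \<sigma> i)) * (\<Prod>i\<in>A - I. if \<sigma> i = i then 1 else 0) =
      (if \<forall>i\<in>A - I. \<sigma> i = i then (-z) ^ card I * (\<Prod>i\<in>I. x (i, \<sigma> i)) else (0::complex))" by simp
  qed simp
  finally show ?thesis .
qed

lemma sum_Pow_by_card:
  fixes h :: "nat set \<Rightarrow> complex"
  assumes "finite A" "card A \<le> n"
  shows "(\<Sum>I\<in>Pow A. h I) = (\<Sum>k\<le>n. \<Sum>I | I \<subseteq> A \<and> card I = k. h I)"
proof -
  have "(\<Sum>k\<le>n. \<Sum>I | I \<in> Pow A \<and> card I = k. h I) = (\<Sum>I\<in>Pow A. h I)"
    using assms by (intro sum.group) (auto dest: card_mono intro: order_trans)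
  then show ?thesis by simp
qed

lemma minor_sum_double:
  "minor_sum n k x = (\<Sum>I | I \<subseteq> {..<n} \<and> card I = k. \<Sum>\<sigma> | \<sigma> permutes I. perm_sign \<sigma> * (\<Prod>i\<in>I. x (i, \<sigma> i)))"
proof -
  have fp: "\<forall>I\<in>{I. I \<subseteq> {..<n} \<and> card I = k}. finite {\<sigma>. \<sigma> permutes I}"
    by (intro ballI finite_permutations finite_subset[OF _ finite_lessThan[of n]]) simp
  show ?thesis
    unfolding minor_sum_def minor_idx_def prod_perm_graph
    by (rule sum.Sigma[OF finite_subset_idx fp, symmetric])
qed

text \<open>For a given set \<open>I\<close> of rows, the permutations of \<open>{..<n}\<close> that
  fix all other rows are the permutations of \<open>I\<close>, and they add up to the principal
  minor on \<open>I\<close>.\<close>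

lemma det_expand:
  "(\<Sum>\<sigma> | \<sigma> permutes {..<n}. perm_sign \<sigma> * (\<Prod>i<n. (if \<sigma> i = i then 1 else 0) - z * x (i, \<sigma> i))) =
     (\<Sum>k\<le>n. (-z) ^ k * minor_sum n k x)"
proof -
  define g where "g = (\<lambda>\<sigma> I. if \<forall>i\<in>{..<n} - I. \<sigma> i = i then
        perm_sign \<sigma> * ((-z) ^ card I * (\<Prod>i\<in>I. x (i, \<sigma> i))) else 0)"
  have "(\<Sum>\<sigma> | \<sigma> permutes {..<n}. perm_sign \<sigma> * (\<Prod>i<n. (if \<sigma> i = i then 1 else 0) - z * x (i, \<sigma> i))) =
    (\<Sum>\<sigma> | \<sigma> permutes {..<n}. \<Sum>I\<in>Pow {..<n}. g \<sigma> I)"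
    unfolding prod_resolvent_expand[OF finite_lessThan] sum_distrib_left g_def
    by (rule sum.cong[OF refl], rule sum.cong[OF refl]) simp
  also have "\<dots> = (\<Sum>I\<in>Pow {..<n}. \<Sum>\<sigma> | \<sigma> permutes {..<n}. g \<sigma> I)"
    by (rule sum.swap)
  also have "\<dots> = (\<Sum>I\<in>Pow {..<n}. \<Sum>\<sigma> | \<sigma> permutes I. (-z) ^ card I * (perm_sign \<sigma> * (\<Prod>i\<in>I. x (i, \<sigma> i))))"
  proof (rule sum.cong)
    fix I assume "I \<in> Pow {..<n}"
    then have I: "I \<subseteq> {..<n}" by simp
    show "(\<Sum>\<sigma> | \<sigma> permutes {..<n}. g \<sigma> I) =
      (\<Sum>\<sigma> | \<sigma> permutes I. (-z) ^ card I * (perm_sign \<sigma> * (\<Prod>i\<in>I. x (i, \<sigma> i))))"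
    proof (rule sum.mono_neutral_cong_right)
      show "finite {\<sigma>. \<sigma> permutes {..<n}}" by (simp add: finite_permutations)
      show "{\<sigma>. \<sigma> permutes I} \<subseteq> {\<sigma>. \<sigma> permutes {..<n}}"
        using permutes_subset[OF _ I] by blast
      show "\<forall>\<sigma>\<in>{\<sigma>. \<sigma> permutes {..<n}} - {\<sigma>. \<sigma> permutes I}. g \<sigma> I = 0"
        using permutes_iff_fixes[OF I] unfolding g_def by (metis (mono_tags) DiffE mem_Collect_eq)
      show "g \<sigma> I = (-z) ^ card I * (perm_sign \<sigma> * (\<Prod>i\<in>I. x (i, \<sigma> i)))"
        if "\<sigma> \<in> {\<sigma>. \<sigma> permutes I}" for \<sigma>
      proof -
        have "\<forall>i\<in>{..<n} - I. \<sigma> i = i" using permutes_iff_fixes[OF I] that by blast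
        then show ?thesis by (simp add: g_def)
      qed
    qed
  qed simp
  also have "\<dots> = (\<Sum>k\<le>n. \<Sum>I | I \<subseteq> {..<n} \<and> card I = k. \<Sum>\<sigma> | \<sigma> permutes I. (-z) ^ card I * (perm_sign \<sigma> * (\<Prod>i\<in>I. x (i, \<sigma> i))))"
    by (rule sum_Pow_by_card) auto
  finally have 1: "(\<Sum>\<sigma> | \<sigma> permutes {..<n}. perm_sign \<sigma> * (\<Prod>i<n. (if \<sigma> i = i then 1 else 0) - z * x (i, \<sigma> i))) =
     (\<Sum>k\<le>n. \<Sum>I | I \<subseteq> {..<n} \<and> card I = k. \<Sum>\<sigma> | \<sigma> permutes I. (-z) ^ card I * (perm_sign \<sigma> * (\<Prod>i\<in>I. x (i, \<sigma> i))))" .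
  have 2: "(\<Sum>k\<le>n. \<Sum>I | I \<subseteq> {..<n} \<and> card I = k. \<Sum>\<sigma> | \<sigma> permutes I. (-z) ^ card I * (perm_sign \<sigma> * (\<Prod>i\<in>I. x (i, \<sigma> i)))) =
     (\<Sum>k\<le>n. (-z) ^ k * minor_sum n k x)"
    unfolding minor_sum_double sum_distrib_left
    apply (rule sum.cong[OF refl]) apply (rule sum.cong[OF refl]) apply (rule sum.cong[OF refl])
    apply (simp only: mem_Collect_eq)
    done
  show ?thesis by (rule trans[OF 1 2])
qed

section \<open>Second moments of polynomials in independent variables\<close>

definition centered_L2 :: "complex measure \<Rightarrow> (complex \<Rightarrow> complex) \<Rightarrow> bool" where
  "centered_L2 \<mu> f \<longleftrightarrow> f \<in> borel_measurable borel \<and> integrable \<mu> (\<lambda>z. (cmod (f z))\<^sup>2) \<and> (LINT z|\<mu>. f z) = 0"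

locale iid_family = prob_space M for M :: "'w measure" +
  fixes Y :: "'e \<Rightarrow> 'w \<Rightarrow> complex" and E :: "'e set" and \<mu> :: "complex measure"
  assumes finE: "finite E"
    and indep: "indep_vars (\<lambda>_. borel) Y E"
    and law: "\<And>e. e \<in> E \<Longrightarrow> distr M borel (Y e) = \<mu>"
    and prob_mu: "prob_space \<mu>" and sets_mu: "sets \<mu> = sets borel"
begin

lemma Y_measurable [measurable]: "e \<in> E \<Longrightarrow> Y e \<in> borel_measurable M"
  using indep by (auto simp: indep_vars_def)

lemma measurable_mu_iff: "g \<in> borel_measurable \<mu> \<longleftrightarrow> g \<in> borel_measurable borel"
  using measurable_cong_sets[OF sets_mu refl] by blast

lemma integrable_law:
  fixes g :: "complex \<Rightarrow> complex"
  assumes "e \<in> E" "integrable \<mu> g"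
  shows "integrable M (\<lambda>\<omega>. g (Y e \<omega>))" "(LINT \<omega>|M. g (Y e \<omega>)) = (LINT z|\<mu>. g z)"
proof -
  have "g \<in> borel_measurable borel" using assms(2) by (auto simp: measurable_mu_iff[symmetric])
  then show "integrable M (\<lambda>\<omega>. g (Y e \<omega>))" "(LINT \<omega>|M. g (Y e \<omega>)) = (LINT z|\<mu>. g z)"
    using assms law[OF assms(1), symmetric] by (simp_all add: integrable_distr_eq integral_distr)
qed

lemma expectation_prod:
  fixes g :: "'e \<Rightarrow> complex \<Rightarrow> complex"
  assumes "S \<subseteq> E" "\<And>e. e \<in> S \<Longrightarrow> integrable \<mu> (g e)"
  shows "integrable M (\<lambda>\<omega>. \<Prod>e\<in>S. g e (Y e \<omega>))"
    and "expectation (\<lambda>\<omega>. \<Prod>e\<in>S. g e (Y e \<omega>)) = (\<Prod>e\<in>S. LINT z|\<mu>. g e z)"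
proof -
  have fin: "finite S" using assms(1) finE finite_subset by blast
  have "indep_vars (\<lambda>_. borel) (\<lambda>e \<omega>. g e (Y e \<omega>)) S"
    using assms(2)
    by (intro indep_vars_compose2[where Y = g, OF indep_vars_subset[OF indep assms(1)]])
      (auto simp: measurable_mu_iff[symmetric])
  note * = this
  have int: "integrable M (\<lambda>\<omega>. g e (Y e \<omega>))" if "e \<in> S" for e
    using integrable_law(1)[of e "g e"] assms that by auto
  show "integrable M (\<lambda>\<omega>. \<Prod>e\<in>S. g e (Y e \<omega>))"
    by (rule indep_vars_integrable[OF fin * int])
  have "expectation (\<lambda>\<omega>. \<Prod>e\<in>S. g e (Y e \<omega>)) = (\<Prod>e\<in>S. expectation (\<lambda>\<omega>. g e (Y e \<omega>)))"
    by (rule indep_vars_lebesgue_integral[OF fin * int])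
  also have "\<dots> = (\<Prod>e\<in>S. LINT z|\<mu>. g e z)"
    using integrable_law(2) assms by (intro prod.cong) auto
  finally show "expectation (\<lambda>\<omega>. \<Prod>e\<in>S. g e (Y e \<omega>)) = (\<Prod>e\<in>S. LINT z|\<mu>. g e z)" .
qed

lemma integrable_mult_L2:
  fixes f g :: "complex \<Rightarrow> complex"
  assumes "f \<in> borel_measurable \<mu>" "g \<in> borel_measurable \<mu>"
    "integrable \<mu> (\<lambda>z. (cmod (f z))\<^sup>2)" "integrable \<mu> (\<lambda>z. (cmod (g z))\<^sup>2)"
  shows "integrable \<mu> (\<lambda>z. f z * g z)"
proof (rule Bochner_Integration.integrable_bound[OF Bochner_Integration.integrable_add[OF assms(3,4)]])
  show "AE z in \<mu>. norm (f z * g z) \<le> norm ((cmod (f z))\<^sup>2 + (cmod (g z))\<^sup>2)"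
  proof (rule AE_I2)
    fix z
    have "2 * (cmod (f z) * cmod (g z)) \<le> (cmod (f z))\<^sup>2 + (cmod (g z))\<^sup>2"
      using sum_squares_bound[of "cmod (f z)" "cmod (g z)"] by simp
    moreover have "0 \<le> cmod (f z) * cmod (g z)" by simp
    ultimately show "norm (f z * g z) \<le> norm ((cmod (f z))\<^sup>2 + (cmod (g z))\<^sup>2)"
      by (simp add: norm_mult, linarith)
  qed
qed (use assms in auto)

lemma integrable_of_L2:
  assumes "f \<in> borel_measurable borel" "integrable \<mu> (\<lambda>z. (cmod (f z))\<^sup>2)"
  shows "integrable \<mu> f"
proof -
  interpret mu: prob_space \<mu> by (rule prob_mu)
  show ?thesis
    using integrable_mult_L2[of f "\<lambda>_. 1"] assms by (simp add: measurable_mu_iff)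
qed

lemma expectation_prod_orthogonal:
  assumes f: "centered_L2 \<mu> f" and g: "centered_L2 \<mu> g" and "S \<subseteq> E" "T \<subseteq> E"
  shows "integrable M (\<lambda>\<omega>. (\<Prod>e\<in>S. f (Y e \<omega>)) * cnj (\<Prod>e\<in>T. g (Y e \<omega>)))" (is ?I)
    and "expectation (\<lambda>\<omega>. (\<Prod>e\<in>S. f (Y e \<omega>)) * cnj (\<Prod>e\<in>T. g (Y e \<omega>))) =
      (if S = T then (LINT z|\<mu>. f z * cnj (g z)) ^ card S else 0)" (is ?E)
proof -
  interpret mu: prob_space \<mu> by (rule prob_mu)
  \<comment> \<open>Independence is available only across different entries, so everything that
    depends on the entry \<open>e\<close> is gathered in one function.\<close>
  define h where "h = (\<lambda>e z. (if e \<in> S then f z else 1) * (if e \<in> T then cnj (g z) else 1))"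
  have fin: "finite S" "finite T" using assms finE finite_subset by blast+
  have eq: "(\<Prod>e\<in>S. f (Y e \<omega>)) * cnj (\<Prod>e\<in>T. g (Y e \<omega>)) = (\<Prod>e\<in>S \<union> T. h e (Y e \<omega>))" for \<omega>
  proof -
    have "(\<Prod>e\<in>S. f (Y e \<omega>)) = (\<Prod>e\<in>S \<union> T. if e \<in> S then f (Y e \<omega>) else 1)"
      using fin by (intro prod.mono_neutral_cong_left) auto
    moreover have "cnj (\<Prod>e\<in>T. g (Y e \<omega>)) = (\<Prod>e\<in>S \<union> T. if e \<in> T then cnj (g (Y e \<omega>)) else 1)"
      unfolding cnj_prod using fin by (intro prod.mono_neutral_cong_left) auto
    ultimately show ?thesis by (simp add: h_def prod.distrib)
  qed
  have mf: "f \<in> borel_measurable borel" "g \<in> borel_measurable borel"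
    "f \<in> borel_measurable \<mu>" "g \<in> borel_measurable \<mu>"
    using f g by (auto simp: centered_L2_def measurable_mu_iff)
  have intf: "integrable \<mu> f" "integrable \<mu> g" using f g by (auto simp: centered_L2_def intro: integrable_of_L2)
  have "cnj \<in> borel_measurable borel"
    by (intro borel_measurable_continuous_onI continuous_intros)
  from measurable_compose[OF mf(4) this] have mcg: "(\<lambda>z. cnj (g z)) \<in> borel_measurable \<mu>" .
  have intfg: "integrable \<mu> (\<lambda>z. f z * cnj (g z))"
    using f g mf by (intro integrable_mult_L2) (auto simp: centered_L2_def mcg)
  have inth: "integrable \<mu> (h e)" if "e \<in> S \<union> T" for e
    using that intf intfg by (cases "e \<in> S"; cases "e \<in> T") (auto simp: h_def)
  show ?I unfolding eq using assms inth by (intro expectation_prod) auto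
  have "expectation (\<lambda>\<omega>. (\<Prod>e\<in>S. f (Y e \<omega>)) * cnj (\<Prod>e\<in>T. g (Y e \<omega>))) =
      (\<Prod>e\<in>S \<union> T. LINT z|\<mu>. h e z)"
    unfolding eq using assms inth by (intro expectation_prod) auto
  also have "\<dots> = (if S = T then (LINT z|\<mu>. f z * cnj (g z)) ^ card S else 0)"
  proof (cases "S = T")
    case True
    then show ?thesis by (auto simp: h_def)
  next
    case False
    then obtain e where e: "e \<in> S \<union> T" "\<not> (e \<in> S \<and> e \<in> T)" by blast
    have "(LINT z|\<mu>. h e z) = 0"
      using e f g by (auto simp: h_def centered_L2_def)
    then show ?thesis using False e fin by (auto intro!: prod_zero)
  qed
  finally show ?E .
qed

end

text \<open>Pythagoras in L2: the cross terms of the expanded square vanish.\<close>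

lemma second_moment_orthogonal:
  fixes Z :: "'i \<Rightarrow> 'w \<Rightarrow> complex" and a :: "'i \<Rightarrow> complex"
  assumes "finite J"
    and "\<And>i j. i \<in> J \<Longrightarrow> j \<in> J \<Longrightarrow> integrable M (\<lambda>\<omega>. Z i \<omega> * cnj (Z j \<omega>))"
    and "\<And>i j. i \<in> J \<Longrightarrow> j \<in> J \<Longrightarrow> i \<noteq> j \<Longrightarrow> (LINT \<omega>|M. Z i \<omega> * cnj (Z j \<omega>)) = 0"
    and "\<And>i. i \<in> J \<Longrightarrow> (LINT \<omega>|M. Z i \<omega> * cnj (Z i \<omega>)) = complex_of_real (v i)"
  shows "integrable M (\<lambda>\<omega>. (cmod (\<Sum>i\<in>J. a i * Z i \<omega>))\<^sup>2)"
    and "(LINT \<omega>|M. (cmod (\<Sum>i\<in>J. a i * Z i \<omega>))\<^sup>2) = (\<Sum>i\<in>J. (cmod (a i))\<^sup>2 * v i)"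
proof -
  have eq: "complex_of_real ((cmod (\<Sum>i\<in>J. a i * Z i \<omega>))\<^sup>2) =
      (\<Sum>i\<in>J. \<Sum>j\<in>J. (a i * cnj (a j)) * (Z i \<omega> * cnj (Z j \<omega>)))" for \<omega>
    by (subst complex_norm_square) (simp add: sum_product mult_ac)
  have int: "integrable M (\<lambda>\<omega>. complex_of_real ((cmod (\<Sum>i\<in>J. a i * Z i \<omega>))\<^sup>2))"
    unfolding eq using assms(2) by (intro Bochner_Integration.integrable_sum integrable_mult_right) auto
  from integrable_Re[OF this] show 1: "integrable M (\<lambda>\<omega>. (cmod (\<Sum>i\<in>J. a i * Z i \<omega>))\<^sup>2)"
    by simp
  have "complex_of_real (LINT \<omega>|M. (cmod (\<Sum>i\<in>J. a i * Z i \<omega>))\<^sup>2) =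
      (LINT \<omega>|M. (\<Sum>i\<in>J. \<Sum>j\<in>J. (a i * cnj (a j)) * (Z i \<omega> * cnj (Z j \<omega>))))"
    unfolding eq[symmetric] by (simp del: of_real_power)
  also have "\<dots> = (\<Sum>i\<in>J. \<Sum>j\<in>J. (a i * cnj (a j)) * (LINT \<omega>|M. Z i \<omega> * cnj (Z j \<omega>)))"
    using assms(2) by (simp add: Bochner_Integration.integral_sum)
  also have "\<dots> = (\<Sum>i\<in>J. \<Sum>j\<in>J. if j = i then (a i * cnj (a i)) * complex_of_real (v i) else 0)"
    using assms(3,4) by (intro sum.cong) auto
  also have "\<dots> = (\<Sum>i\<in>J. complex_of_real ((cmod (a i))\<^sup>2 * v i))"
    using assms(1) by (intro sum.cong) (auto simp: complex_norm_square[symmetric])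
  finally show "(LINT \<omega>|M. (cmod (\<Sum>i\<in>J. a i * Z i \<omega>))\<^sup>2) = (\<Sum>i\<in>J. (cmod (a i))\<^sup>2 * v i)"
    by (simp only: of_real_sum[symmetric] of_real_eq_iff)
qed

context iid_family
begin

text \<open>Injectivity of \<open>S\<close> makes the monomials orthogonal, and the second moment of
  a monomial is a power of that of a single factor.\<close>

lemma second_moment_chaos:
  assumes "finite J" "inj_on S J" "\<And>i. i \<in> J \<Longrightarrow> S i \<subseteq> E" "centered_L2 \<mu> f"
  shows "integrable M (\<lambda>\<omega>. (cmod (\<Sum>i\<in>J. a i * (\<Prod>e\<in>S i. f (Y e \<omega>))))\<^sup>2)" (is ?I)
    and "expectation (\<lambda>\<omega>. (cmod (\<Sum>i\<in>J. a i * (\<Prod>e\<in>S i. f (Y e \<omega>))))\<^sup>2) =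
      (\<Sum>i\<in>J. (cmod (a i))\<^sup>2 * (LINT z|\<mu>. (cmod (f z))\<^sup>2) ^ card (S i))" (is ?E)
proof -
  have f: "(LINT z|\<mu>. f z * cnj (f z)) = complex_of_real (LINT z|\<mu>. (cmod (f z))\<^sup>2)"
    by (simp add: complex_norm_square[symmetric] del: of_real_power)
  have A: "integrable M (\<lambda>\<omega>. (\<Prod>e\<in>S i. f (Y e \<omega>)) * cnj (\<Prod>e\<in>S j. f (Y e \<omega>)))"
    if "i \<in> J" "j \<in> J" for i j
    using that assms by (intro expectation_prod_orthogonal) auto
  have B: "expectation (\<lambda>\<omega>. (\<Prod>e\<in>S i. f (Y e \<omega>)) * cnj (\<Prod>e\<in>S j. f (Y e \<omega>))) = 0"
    if "i \<in> J" "j \<in> J" "i \<noteq> j" for i j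
    using that assms(2) by (subst expectation_prod_orthogonal) (auto simp: assms inj_on_def)
  have C: "expectation (\<lambda>\<omega>. (\<Prod>e\<in>S i. f (Y e \<omega>)) * cnj (\<Prod>e\<in>S i. f (Y e \<omega>))) =
     complex_of_real ((LINT z|\<mu>. (cmod (f z))\<^sup>2) ^ card (S i))" if "i \<in> J" for i
    using that by (subst expectation_prod_orthogonal) (auto simp: assms f)
  show ?I by (rule second_moment_orthogonal(1)[OF assms(1) A B C])
  show ?E by (rule second_moment_orthogonal(2)[OF assms(1) A B C])
qed

text \<open>The same monomials are formed in \<open>f\<close> and in \<open>g\<close>. For different
  index sets all four mixed products are orthogonal, so only the diagonal survives; it measures how
  far a truncation moves a coefficient.\<close>

lemma second_moment_chaos_diff:
  assumes "finite J" "inj_on S J" "\<And>i. i \<in> J \<Longrightarrow> S i \<subseteq> E" "centered_L2 \<mu> f" "centered_L2 \<mu> g"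
  shows "integrable M (\<lambda>\<omega>. (cmod (\<Sum>i\<in>J. a i * ((\<Prod>e\<in>S i. f (Y e \<omega>)) - (\<Prod>e\<in>S i. g (Y e \<omega>)))))\<^sup>2)" (is ?I)
    and "expectation (\<lambda>\<omega>. (cmod (\<Sum>i\<in>J. a i * ((\<Prod>e\<in>S i. f (Y e \<omega>)) - (\<Prod>e\<in>S i. g (Y e \<omega>)))))\<^sup>2) =
      (\<Sum>i\<in>J. (cmod (a i))\<^sup>2 * ((LINT z|\<mu>. (cmod (f z))\<^sup>2) ^ card (S i)
         - 2 * Re ((LINT z|\<mu>. f z * cnj (g z)) ^ card (S i)) + (LINT z|\<mu>. (cmod (g z))\<^sup>2) ^ card (S i)))" (is ?E)
proof -
  have ff: "(LINT z|\<mu>. f z * cnj (f z)) = complex_of_real (LINT z|\<mu>. (cmod (f z))\<^sup>2)" for f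
    by (simp add: complex_norm_square[symmetric] del: of_real_power)
  have gf: "(LINT z|\<mu>. g z * cnj (f z)) = cnj (LINT z|\<mu>. f z * cnj (g z))"
    by (simp add: mult.commute flip: Bochner_Integration.integral_cnj)
  let ?F = "\<lambda>i \<omega>. (\<Prod>e\<in>S i. f (Y e \<omega>))" and ?G = "\<lambda>i \<omega>. (\<Prod>e\<in>S i. g (Y e \<omega>))"
  have eq: "(?F i \<omega> - ?G i \<omega>) * cnj (?F j \<omega> - ?G j \<omega>) = (?F i \<omega> * cnj (?F j \<omega>) + ?G i \<omega> * cnj (?G j \<omega>)) -
       (?F i \<omega> * cnj (?G j \<omega>) + ?G i \<omega> * cnj (?F j \<omega>))" for i j \<omega>
    by (simp add: algebra_simps)
  have int: "integrable M (\<lambda>\<omega>. ?F i \<omega> * cnj (?F j \<omega>))" "integrable M (\<lambda>\<omega>. ?G i \<omega> * cnj (?G j \<omega>))"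
    "integrable M (\<lambda>\<omega>. ?F i \<omega> * cnj (?G j \<omega>))" "integrable M (\<lambda>\<omega>. ?G i \<omega> * cnj (?F j \<omega>))"
    if "i \<in> J" "j \<in> J" for i j
    using that assms by (intro expectation_prod_orthogonal; auto)+
  have A: "integrable M (\<lambda>\<omega>. (?F i \<omega> - ?G i \<omega>) * cnj (?F j \<omega> - ?G j \<omega>))"
    if "i \<in> J" "j \<in> J" for i j
    unfolding eq using int[OF that] by (intro Bochner_Integration.integrable_diff Bochner_Integration.integrable_add)
  have X: "expectation (\<lambda>\<omega>. (?F i \<omega> - ?G i \<omega>) * cnj (?F j \<omega> - ?G j \<omega>)) =
     (expectation (\<lambda>\<omega>. ?F i \<omega> * cnj (?F j \<omega>)) + expectation (\<lambda>\<omega>. ?G i \<omega> * cnj (?G j \<omega>))) -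
     (expectation (\<lambda>\<omega>. ?F i \<omega> * cnj (?G j \<omega>)) + expectation (\<lambda>\<omega>. ?G i \<omega> * cnj (?F j \<omega>)))"
    if "i \<in> J" "j \<in> J" for i j
    unfolding eq Bochner_Integration.integral_diff[OF
        Bochner_Integration.integrable_add[OF int(1,2)[OF that]]
        Bochner_Integration.integrable_add[OF int(3,4)[OF that]]]
      Bochner_Integration.integral_add[OF int(1,2)[OF that]]
      Bochner_Integration.integral_add[OF int(3,4)[OF that]] ..
  have B: "expectation (\<lambda>\<omega>. (?F i \<omega> - ?G i \<omega>) * cnj (?F j \<omega> - ?G j \<omega>)) = 0"
    if "i \<in> J" "j \<in> J" "i \<noteq> j" for i j
  proof -
    have "S i \<noteq> S j" using that assms(2) by (auto simp: inj_on_def)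
    then show ?thesis using that assms by (simp add: X expectation_prod_orthogonal(2) del: cnj_prod complex_cnj_diff)
  qed
  have C: "expectation (\<lambda>\<omega>. (?F i \<omega> - ?G i \<omega>) * cnj (?F i \<omega> - ?G i \<omega>)) =
     complex_of_real ((LINT z|\<mu>. (cmod (f z))\<^sup>2) ^ card (S i)
         - 2 * Re ((LINT z|\<mu>. f z * cnj (g z)) ^ card (S i)) + (LINT z|\<mu>. (cmod (g z))\<^sup>2) ^ card (S i))"
    if "i \<in> J" for i
  proof -
    have "w + cnj w = complex_of_real (2 * Re w)" for w by (simp add: complex_add_cnj)
    note * = this[of "(LINT z|\<mu>. f z * cnj (g z)) ^ card (S i)"]
    from * show ?thesis
      using that assms by (simp add: X[OF that that] expectation_prod_orthogonal(2) ff gf del: cnj_prod complex_cnj_diff)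
  qed
  show ?I by (rule second_moment_orthogonal(1)[OF assms(1) A B C])
  show ?E by (rule second_moment_orthogonal(2)[OF assms(1) A B C])
qed

text \<open>The variance of the modulus is nonnegative.\<close>

lemma expectation_norm_le:
  fixes Z :: "'w \<Rightarrow> complex"
  assumes "Z \<in> borel_measurable M" "integrable M (\<lambda>\<omega>. (cmod (Z \<omega>))\<^sup>2)"
  shows "integrable M (\<lambda>\<omega>. cmod (Z \<omega>))"
    and "expectation (\<lambda>\<omega>. cmod (Z \<omega>)) \<le> sqrt (expectation (\<lambda>\<omega>. (cmod (Z \<omega>))\<^sup>2))"
proof -
  show 1: "integrable M (\<lambda>\<omega>. cmod (Z \<omega>))"
    by (rule square_integrable_imp_integrable[OF _ assms(2)]) (use assms(1) in auto)
  have "0 \<le> variance (\<lambda>\<omega>. cmod (Z \<omega>))" by (rule Bochner_Integration.integral_nonneg) auto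
  also have "\<dots> = expectation (\<lambda>\<omega>. (cmod (Z \<omega>))\<^sup>2) - (expectation (\<lambda>\<omega>. cmod (Z \<omega>)))\<^sup>2"
    by (rule variance_eq[OF 1 assms(2)])
  finally show "expectation (\<lambda>\<omega>. cmod (Z \<omega>)) \<le> sqrt (expectation (\<lambda>\<omega>. (cmod (Z \<omega>))\<^sup>2))"
    by (intro real_le_rsqrt) simp
qed

end

section \<open>Cramer's rule expanded into cycles and open paths\<close>

lemma open_coeff_triple:
  "open_coeff n k u v x = (\<Sum>b<n. \<Sum>I | I \<subseteq> {..<n} - {b} \<and> card I = k.
     \<Sum>\<sigma> | \<sigma> permutes insert b I \<and> \<sigma> b \<noteq> b. u b * v (\<sigma> b) * perm_sign \<sigma> * (\<Prod>i\<in>I. x (i, \<sigma> i)))"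
proof -
  have f1: "\<forall>I\<in>{I. I \<subseteq> {..<n} - {b} \<and> card I = k}. finite {\<sigma>. \<sigma> permutes insert b I \<and> \<sigma> b \<noteq> b}" for b
  proof
    fix I assume "I \<in> {I. I \<subseteq> {..<n} - {b} \<and> card I = k}"
    then have "finite (insert b I)" by (auto intro: finite_subset)
    from finite_permutations[OF this] show "finite {\<sigma>. \<sigma> permutes insert b I \<and> \<sigma> b \<noteq> b}"
      by (rule finite_subset[rotated]) auto
  qed
  have f2: "finite {I. I \<subseteq> {..<n} - {b} \<and> card I = k}" for b
    by (auto intro: finite_subset[of _ "Pow {..<n}"])
  have f3: "\<forall>b\<in>{..<n}. finite (SIGMA I:{I. I \<subseteq> {..<n} - {b} \<and> card I = k}. {\<sigma>. \<sigma> permutes insert b I \<and> \<sigma> b \<noteq> b})"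
    using f1 f2 by (intro ballI finite_SigmaI) auto
  show ?thesis
    unfolding open_coeff_def open_idx_def prod_perm_graph
    unfolding sum.Sigma[OF f2 f1] sum.Sigma[OF finite_lessThan f3] by (rule refl)
qed

lemma closed_coeff_double:
  "closed_coeff n k u v x = (\<Sum>I | I \<subseteq> {..<n} \<and> card I = k. \<Sum>\<sigma> | \<sigma> permutes I.
     (\<Sum>b\<in>I. u b * v b) * perm_sign \<sigma> * (\<Prod>i\<in>I. x (i, \<sigma> i)))"
proof -
  have fp: "\<forall>I\<in>{I. I \<subseteq> {..<n} \<and> card I = k}. finite {\<sigma>. \<sigma> permutes I}"
    by (intro ballI finite_permutations finite_subset[OF _ finite_lessThan[of n]]) simp
  show ?thesis
    unfolding closed_coeff_def minor_idx_def prod_perm_graph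
    by (rule sum.Sigma[OF finite_subset_idx fp, symmetric])
qed

lemma sum_permutations_fixing:
  fixes h :: "(nat \<Rightarrow> nat) \<Rightarrow> complex"
  assumes "I \<subseteq> A" "finite A"
  shows "(\<Sum>\<sigma> | \<sigma> permutes A. if \<forall>i\<in>A - I. \<sigma> i = i then h \<sigma> else 0) = (\<Sum>\<sigma> | \<sigma> permutes I. h \<sigma>)"
proof (rule sum.mono_neutral_cong_right)
  show "finite {\<sigma>. \<sigma> permutes A}" using assms by (simp add: finite_permutations)
  show "{\<sigma>. \<sigma> permutes I} \<subseteq> {\<sigma>. \<sigma> permutes A}"
    using permutes_subset[OF _ assms(1)] by blast
  show "\<forall>\<sigma>\<in>{\<sigma>. \<sigma> permutes A} - {\<sigma>. \<sigma> permutes I}. (if \<forall>i\<in>A - I. \<sigma> i = i then h \<sigma> else 0) = 0"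
    using permutes_iff_fixes[OF assms(1)] by (metis (mono_tags) DiffE mem_Collect_eq)
  show "(if \<forall>i\<in>A - I. \<sigma> i = i then h \<sigma> else 0) = h \<sigma>" if "\<sigma> \<in> {\<sigma>. \<sigma> permutes I}" for \<sigma>
  proof -
    have "\<forall>i\<in>A - I. \<sigma> i = i" using permutes_iff_fixes[OF assms(1)] that by blast
    then show ?thesis by (rule if_P)
  qed
qed

text \<open>By Cramer's rule the first sum is the bilinear form of the adjugate of
  \<open>1 - z X\<close> in \<open>v\<close> and \<open>u\<close>. Its diagonal part consists of
  \<open>u b * v b\<close> times the principal minors avoiding \<open>b\<close>; subtracting all
  principal minors leaves, with a minus sign, those containing \<open>b\<close>, which is the closed
  part. The off-diagonal part is the open one.\<close>

lemma cramer_expand: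
  fixes x :: "nat \<times> nat \<Rightarrow> complex" and u v :: "nat \<Rightarrow> complex" and z :: complex
  defines "A \<equiv> \<lambda>i j. (if j = i then 1 else 0) - z * x (i, j)"
  shows "(\<Sum>a<n. v a * (\<Sum>\<sigma> | \<sigma> permutes {..<n}. perm_sign \<sigma> * (\<Prod>i<n. if \<sigma> i = a then u i else A i (\<sigma> i)))) -
     (\<Sum>b<n. u b * v b) * (\<Sum>k\<le>n. (-z) ^ k * minor_sum n k x) =
     (\<Sum>k\<le>n. (-z) ^ k * (open_coeff n k u v x - closed_coeff n k u v x))"
proof -
  define P where "P = {\<sigma>. \<sigma> permutes {..<n}}"
  define T where "T = (\<lambda>I. \<Sum>\<sigma> | \<sigma> permutes I. (-z) ^ card I * (perm_sign \<sigma> * (\<Prod>i\<in>I. x (i, \<sigma> i))))"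
  define U where "U = (\<lambda>b I. \<Sum>\<sigma> | \<sigma> permutes insert b I \<and> \<sigma> b \<noteq> b.
      (-z) ^ card I * (u b * v (\<sigma> b) * perm_sign \<sigma> * (\<Prod>i\<in>I. x (i, \<sigma> i))))"
  \<comment> \<open>Exactly one row uses the replaced column \<open>a\<close>. With \<open>b\<close>
    for this row, \<open>a = \<sigma> b\<close>, and the sum over columns becomes a sum over
    rows.\<close>
  have 1: "(\<Sum>a<n. v a * (\<Prod>i<n. if \<sigma> i = a then u i else A i (\<sigma> i))) =
     (\<Sum>b<n. u b * v (\<sigma> b) * (\<Prod>i\<in>{..<n} - {b}. A i (\<sigma> i)))" if "\<sigma> \<in> P" for \<sigma>
  proof -
    have p: "\<sigma> permutes {..<n}" using that by (simp add: P_def)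
    have inj: "\<sigma> i = \<sigma> b \<longleftrightarrow> i = b" for i b using permutes_inj[OF p] by (simp add: inj_eq)
    have "(\<Sum>a<n. v a * (\<Prod>i<n. if \<sigma> i = a then u i else A i (\<sigma> i))) =
       (\<Sum>b<n. v (\<sigma> b) * (\<Prod>i<n. if \<sigma> i = \<sigma> b then u i else A i (\<sigma> i)))"
      by (rule sum.reindex_bij_betw[OF permutes_imp_bij[OF p], symmetric])
    also have "\<dots> = (\<Sum>b<n. u b * v (\<sigma> b) * (\<Prod>i\<in>{..<n} - {b}. A i (\<sigma> i)))"
    proof (rule sum.cong[OF refl])
      fix b assume "b \<in> {..<n}"
      then have "(\<Prod>i<n. if i = b then u i else A i (\<sigma> i)) = u b * (\<Prod>i\<in>{..<n} - {b}. if i = b then u i else A i (\<sigma> i))"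
        by (subst prod.remove[of _ b]) auto
      also have "(\<Prod>i\<in>{..<n} - {b}. if i = b then u i else A i (\<sigma> i)) = (\<Prod>i\<in>{..<n} - {b}. A i (\<sigma> i))"
        by (rule prod.cong[OF refl]) auto
      finally show "v (\<sigma> b) * (\<Prod>i<n. if \<sigma> i = \<sigma> b then u i else A i (\<sigma> i)) =
          u b * v (\<sigma> b) * (\<Prod>i\<in>{..<n} - {b}. A i (\<sigma> i))"
        unfolding inj by (simp only: mult_ac)
    qed
    finally show ?thesis .
  qed
  \<comment> \<open>The rows other than \<open>b\<close> are expanded as for the determinant, and
    the result is split according to whether \<sigma> fixes \<open>b\<close>.\<close>
  have 2: "(\<Sum>\<sigma>\<in>P. u b * v (\<sigma> b) * perm_sign \<sigma> * (\<Prod>i\<in>{..<n} - {b}. A i (\<sigma> i))) =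
     (\<Sum>I\<in>Pow ({..<n} - {b}). U b I) + u b * v b * (\<Sum>I\<in>Pow ({..<n} - {b}). T I)" if b: "b < n" for b
  proof -
    have "(\<Sum>\<sigma>\<in>P. u b * v (\<sigma> b) * perm_sign \<sigma> * (\<Prod>i\<in>{..<n} - {b}. A i (\<sigma> i))) =
      (\<Sum>\<sigma>\<in>P. \<Sum>I\<in>Pow ({..<n} - {b}). if \<forall>i\<in>{..<n} - insert b I. \<sigma> i = i then
         (-z) ^ card I * (u b * v (\<sigma> b) * perm_sign \<sigma> * (\<Prod>i\<in>I. x (i, \<sigma> i))) else 0)"
    proof (rule sum.cong[OF refl])
      fix \<sigma>
      have d: "{..<n} - {b} - I = {..<n} - insert b I" for I by auto
      have "(\<Prod>i\<in>{..<n} - {b}. A i (\<sigma> i)) = (\<Sum>I\<in>Pow ({..<n} - {b}). if \<forall>i\<in>{..<n} - insert b I. \<sigma> i = i then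
         (-z) ^ card I * (\<Prod>i\<in>I. x (i, \<sigma> i)) else 0)"
        unfolding A_def by (subst prod_resolvent_expand) (simp_all only: d finite_Diff finite_lessThan)
      then show "u b * v (\<sigma> b) * perm_sign \<sigma> * (\<Prod>i\<in>{..<n} - {b}. A i (\<sigma> i)) =
         (\<Sum>I\<in>Pow ({..<n} - {b}). if \<forall>i\<in>{..<n} - insert b I. \<sigma> i = i then
         (-z) ^ card I * (u b * v (\<sigma> b) * perm_sign \<sigma> * (\<Prod>i\<in>I. x (i, \<sigma> i))) else 0)"
        by (simp only: sum_distrib_left) (rule sum.cong[OF refl], simp only: if_distrib[of "(*) _"] mult_zero_right mult_zero_left mult_ac)
    qed
    also have "\<dots> = (\<Sum>I\<in>Pow ({..<n} - {b}). \<Sum>\<sigma>\<in>P. if \<forall>i\<in>{..<n} - insert b I. \<sigma> i = i then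
         (-z) ^ card I * (u b * v (\<sigma> b) * perm_sign \<sigma> * (\<Prod>i\<in>I. x (i, \<sigma> i))) else 0)"
      by (rule sum.swap)
    also have "\<dots> = (\<Sum>I\<in>Pow ({..<n} - {b}). U b I + u b * v b * T I)"
    proof (rule sum.cong[OF refl])
      fix I assume "I \<in> Pow ({..<n} - {b})"
      then have I: "I \<subseteq> {..<n}" "b \<notin> I" "insert b I \<subseteq> {..<n}" using b by auto
      have fin: "finite {\<sigma>. \<sigma> permutes insert b I}"
        by (rule finite_permutations) (rule finite_subset[OF I(3) finite_lessThan])
      let ?h = "\<lambda>\<sigma>. (-z) ^ card I * (u b * v (\<sigma> b) * perm_sign \<sigma> * (\<Prod>i\<in>I. x (i, \<sigma> i)))"
      have eq: "{\<sigma>. \<sigma> permutes insert b I} \<inter> {\<sigma>. \<sigma> b = b} = {\<sigma>. \<sigma> permutes I}"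
      proof (rule Set.set_eqI)
        fix \<sigma>
        have "insert b I - I = {b}" using I by auto
        then show "\<sigma> \<in> {\<sigma>. \<sigma> permutes insert b I} \<inter> {\<sigma>. \<sigma> b = b} \<longleftrightarrow> \<sigma> \<in> {\<sigma>. \<sigma> permutes I}"
          using permutes_iff_fixes[of I "insert b I" \<sigma>] by blast
      qed
      have "(\<Sum>\<sigma>\<in>P. if \<forall>i\<in>{..<n} - insert b I. \<sigma> i = i then ?h \<sigma> else 0) = (\<Sum>\<sigma> | \<sigma> permutes insert b I. ?h \<sigma>)"
        unfolding P_def by (rule sum_permutations_fixing[OF I(3) finite_lessThan])
      also have "\<dots> = (\<Sum>\<sigma> \<in> {\<sigma>. \<sigma> permutes insert b I} \<inter> {\<sigma>. \<sigma> b = b}. ?h \<sigma>) +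
          (\<Sum>\<sigma> \<in> {\<sigma>. \<sigma> permutes insert b I} \<inter> - {\<sigma>. \<sigma> b = b}. ?h \<sigma>)"
        by (rule sum.Int_Diff[OF fin, unfolded Diff_eq])
      also have "(\<Sum>\<sigma> \<in> {\<sigma>. \<sigma> permutes insert b I} \<inter> - {\<sigma>. \<sigma> b = b}. ?h \<sigma>) = U b I"
        unfolding U_def by (rule sum.cong) auto
      also have "(\<Sum>\<sigma> \<in> {\<sigma>. \<sigma> permutes insert b I} \<inter> {\<sigma>. \<sigma> b = b}. ?h \<sigma>) = u b * v b * T I"
        unfolding eq T_def sum_distrib_left
      proof (rule sum.cong[OF refl])
        fix \<sigma> assume "\<sigma> \<in> {\<sigma>. \<sigma> permutes I}"
        then have "\<sigma> b = b" using I(2) permutes_not_in by (metis mem_Collect_eq)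
        then show "?h \<sigma> = u b * v b * ((-z) ^ card I * (perm_sign \<sigma> * (\<Prod>i\<in>I. x (i, \<sigma> i))))"
          by (simp only: mult_ac)
      qed
      finally show "(\<Sum>\<sigma>\<in>P. if \<forall>i\<in>{..<n} - insert b I. \<sigma> i = i then ?h \<sigma> else 0) = U b I + u b * v b * T I"
        by (simp only: add.commute)
    qed
    finally show ?thesis by (simp only: sum.distrib sum_distrib_left)
  qed
  have 3: "(\<Sum>k\<le>n. (-z) ^ k * minor_sum n k x) = (\<Sum>I\<in>Pow {..<n}. T I)"
    unfolding sum_Pow_by_card[OF finite_lessThan[of n], of n, simplified] minor_sum_double sum_distrib_left T_def
    by (rule sum.cong[OF refl], rule sum.cong[OF refl], rule sum.cong[OF refl]) simp
  have 4: "(\<Sum>k\<le>n. (-z) ^ k * open_coeff n k u v x) = (\<Sum>b<n. \<Sum>I\<in>Pow ({..<n} - {b}). U b I)"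
  proof -
    have "(\<Sum>b<n. \<Sum>I\<in>Pow ({..<n} - {b}). U b I) = (\<Sum>b<n. \<Sum>k\<le>n. \<Sum>I | I \<subseteq> {..<n} - {b} \<and> card I = k. U b I)"
      by (intro sum.cong refl sum_Pow_by_card) (auto intro: order_trans[OF card_Diff1_le])
    also have "\<dots> = (\<Sum>k\<le>n. \<Sum>b<n. \<Sum>I | I \<subseteq> {..<n} - {b} \<and> card I = k. U b I)" by (rule sum.swap)
    also have "\<dots> = (\<Sum>k\<le>n. (-z) ^ k * open_coeff n k u v x)"
      unfolding open_coeff_triple sum_distrib_left U_def
      by (rule sum.cong[OF refl], rule sum.cong[OF refl], rule sum.cong[OF refl], rule sum.cong[OF refl]) simp
    finally show ?thesis by (rule sym)
  qed
  have 5: "(\<Sum>k\<le>n. (-z) ^ k * closed_coeff n k u v x) = (\<Sum>I\<in>Pow {..<n}. (\<Sum>b\<in>I. u b * v b) * T I)"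
    unfolding sum_Pow_by_card[OF finite_lessThan[of n], of n, simplified] closed_coeff_double sum_distrib_left T_def
    by (rule sum.cong[OF refl], rule sum.cong[OF refl], rule sum.cong[OF refl]) (simp add: mult_ac)
  \<comment> \<open>For each \<open>b\<close>, the sets \<open>I\<close> avoiding it and those
    containing it make up all sets.\<close>
  have 6: "(\<Sum>b<n. u b * v b * (\<Sum>I\<in>Pow ({..<n} - {b}). T I)) + (\<Sum>I\<in>Pow {..<n}. (\<Sum>b\<in>I. u b * v b) * T I) =
     (\<Sum>b<n. u b * v b) * (\<Sum>I\<in>Pow {..<n}. T I)"
  proof -
    have a: "(\<Sum>b\<in>I. u b * v b) * T I = (\<Sum>b<n. if b \<in> I then u b * v b * T I else 0)" if "I \<in> Pow {..<n}" for I
    proof -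
      have "{..<n} \<inter> I = I" using that by auto
      then show ?thesis by (simp add: sum.inter_restrict[symmetric] sum_distrib_right)
    qed
    have "(\<Sum>I\<in>Pow {..<n}. (\<Sum>b\<in>I. u b * v b) * T I) = (\<Sum>I\<in>Pow {..<n}. \<Sum>b<n. if b \<in> I then u b * v b * T I else 0)"
      by (rule sum.cong[OF refl a])
    also have "\<dots> = (\<Sum>b<n. \<Sum>I\<in>Pow {..<n}. if b \<in> I then u b * v b * T I else 0)" by (rule sum.swap)
    finally have b: "(\<Sum>I\<in>Pow {..<n}. (\<Sum>b\<in>I. u b * v b) * T I) = \<dots>" .
    have c: "u b * v b * (\<Sum>I\<in>Pow ({..<n} - {b}). T I) = (\<Sum>I\<in>Pow {..<n}. if b \<notin> I then u b * v b * T I else 0)" for b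
    proof -
      have "Pow ({..<n} - {b}) = {I \<in> Pow {..<n}. b \<notin> I}" by auto
      then have *: "Pow ({..<n} - {b}) = {I \<in> Pow {..<n}. b \<notin> I}" .
      show ?thesis unfolding * sum_distrib_left by (rule sum.inter_filter) simp
    qed
    show ?thesis
      unfolding b c sum.distrib[symmetric] sum_product
      by (rule sum.cong[OF refl], rule sum.cong[OF refl]) simp
  qed
  have "(\<Sum>a<n. v a * (\<Sum>\<sigma>\<in>P. perm_sign \<sigma> * (\<Prod>i<n. if \<sigma> i = a then u i else A i (\<sigma> i)))) =
     (\<Sum>\<sigma>\<in>P. perm_sign \<sigma> * (\<Sum>a<n. v a * (\<Prod>i<n. if \<sigma> i = a then u i else A i (\<sigma> i))))"
    unfolding sum_distrib_left by (subst sum.swap) (simp only: mult_ac)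
  also have "\<dots> = (\<Sum>\<sigma>\<in>P. perm_sign \<sigma> * (\<Sum>b<n. u b * v (\<sigma> b) * (\<Prod>i\<in>{..<n} - {b}. A i (\<sigma> i))))"
    by (rule sum.cong[OF refl]) (simp only: 1)
  also have "\<dots> = (\<Sum>b<n. \<Sum>\<sigma>\<in>P. u b * v (\<sigma> b) * perm_sign \<sigma> * (\<Prod>i\<in>{..<n} - {b}. A i (\<sigma> i)))"
    unfolding sum_distrib_left by (subst sum.swap) (simp only: mult_ac)
  also have "\<dots> = (\<Sum>b<n. (\<Sum>I\<in>Pow ({..<n} - {b}). U b I) + u b * v b * (\<Sum>I\<in>Pow ({..<n} - {b}). T I))"
    by (rule sum.cong[OF refl], rule 2) simp
  also have "\<dots> = (\<Sum>k\<le>n. (-z) ^ k * open_coeff n k u v x) + (\<Sum>b<n. u b * v b * (\<Sum>I\<in>Pow ({..<n} - {b}). T I))"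
    unfolding sum.distrib 4 by (rule refl)
  finally have 7: "(\<Sum>a<n. v a * (\<Sum>\<sigma>\<in>P. perm_sign \<sigma> * (\<Prod>i<n. if \<sigma> i = a then u i else A i (\<sigma> i)))) =
    (\<Sum>k\<le>n. (-z) ^ k * open_coeff n k u v x) + (\<Sum>b<n. u b * v b * (\<Sum>I\<in>Pow ({..<n} - {b}). T I))" .
  show ?thesis
    unfolding P_def[symmetric] 7 3 6[symmetric] right_diff_distrib sum_subtractf 5 by simp
qed

section \<open>Counting the graphs and summing their weights\<close>

lemma minor_graph_subset:
  assumes "t \<in> minor_idx n k"
  shows "(case t of (I, \<sigma>) \<Rightarrow> perm_graph I \<sigma>) \<subseteq> {..<n} \<times> {..<n}"
proof -
  obtain I \<sigma> where t: "t = (I, \<sigma>)" by (cases t)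
  have I: "I \<subseteq> {..<n}" "\<sigma> permutes I" using assms unfolding t minor_idx_def by blast+
  then have "\<sigma> ` I \<subseteq> {..<n}" by (simp only: permutes_image)
  with I(1) show ?thesis unfolding t by (simp only: case_prod_conv perm_graph_subset)
qed

lemma open_graph_subset:
  assumes "t \<in> open_idx n k"
  shows "(case t of (b, I, \<sigma>) \<Rightarrow> perm_graph I \<sigma>) \<subseteq> {..<n} \<times> {..<n}"
proof -
  obtain b I \<sigma> where t: "t = (b, I, \<sigma>)" by (cases t)
  have I: "I \<subseteq> {..<n}" "insert b I \<subseteq> {..<n}" "\<sigma> permutes insert b I"
    using assms unfolding t open_idx_def by blast+
  have "\<sigma> ` I \<subseteq> \<sigma> ` insert b I" by blast
  also have "\<dots> = insert b I" by (rule permutes_image[OF I(3)])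
  finally have "\<sigma> ` I \<subseteq> {..<n}" using I(2) by (rule subset_trans)
  with I(1) show ?thesis unfolding t by (simp only: case_prod_conv perm_graph_subset)
qed

lemma card_minor_idx: "card (minor_idx n k) = (n choose k) * fact k"
proof -
  have "card (minor_idx n k) = (\<Sum>I | I \<subseteq> {..<n} \<and> card I = k. card {\<sigma>. \<sigma> permutes I})"
    unfolding minor_idx_def
    by (rule card_SigmaI[OF finite_subset_idx])
      (intro ballI finite_permutations finite_subset[OF _ finite_lessThan[of n]], simp)
  also have "\<dots> = (\<Sum>I | I \<subseteq> {..<n} \<and> card I = k. fact k)"
    by (rule sum.cong[OF refl]) (auto intro: card_permutations finite_subset)
  also have "\<dots> = (n choose k) * fact k"
    using n_subsets[of "{..<n}" k] by simp
  finally show ?thesis .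
qed

lemma card_minor_idx_le: "real (card (minor_idx n k)) \<le> real n ^ k"
  unfolding card_minor_idx by (metis binomial_fact_pow of_nat_le_iff of_nat_power)

text \<open>Double counting: removing \<open>b\<close> maps the sets containing it injectively to
  sets of size \<open>k - 1\<close>.\<close>

lemma sum_subsets_le:
  fixes w :: "nat \<Rightarrow> real"
  assumes "\<And>b. w b \<ge> 0" and "k \<ge> 1"
  shows "(\<Sum>I | I \<subseteq> {..<n} \<and> card I = k. \<Sum>b\<in>I. w b) \<le> real (n choose (k - 1)) * (\<Sum>b<n. w b)"
proof -
  let ?S = "{I. I \<subseteq> {..<n} \<and> card I = k}"
  have fin: "finite ?S" by (rule finite_subset_idx)
  have "(\<Sum>I\<in>?S. \<Sum>b\<in>I. w b) = (\<Sum>I\<in>?S. \<Sum>b<n. if b \<in> I then w b else 0)"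
  proof (rule sum.cong[OF refl])
    fix I assume "I \<in> ?S"
    then have "{..<n} \<inter> I = I" by auto
    then show "(\<Sum>b\<in>I. w b) = (\<Sum>b<n. if b \<in> I then w b else 0)"
      by (simp add: sum.inter_restrict[symmetric])
  qed
  also have "\<dots> = (\<Sum>b<n. \<Sum>I\<in>?S. if b \<in> I then w b else 0)" by (rule sum.swap)
  also have "\<dots> = (\<Sum>b<n. real (card {I \<in> ?S. b \<in> I}) * w b)"
    using fin by (simp add: sum.inter_filter[symmetric])
  also have "\<dots> \<le> (\<Sum>b<n. real (n choose (k - 1)) * w b)"
  proof (intro sum_mono mult_right_mono assms(1))
    fix b
    have "card {I \<in> ?S. b \<in> I} \<le> card {I. I \<subseteq> {..<n} \<and> card I = k - 1}"
    proof (rule card_inj_on_le[of "\<lambda>I. I - {b}"])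
      show "inj_on (\<lambda>I. I - {b}) {I \<in> ?S. b \<in> I}"
        by (intro inj_onI) (metis (mono_tags, lifting) insert_Diff mem_Collect_eq)
      show "(\<lambda>I. I - {b}) ` {I \<in> ?S. b \<in> I} \<subseteq> {I. I \<subseteq> {..<n} \<and> card I = k - 1}"
        by (auto simp: card_Diff_singleton)
      show "finite {I. I \<subseteq> {..<n} \<and> card I = k - 1}" by (rule finite_subset_idx)
    qed
    then show "real (card {I \<in> ?S. b \<in> I}) \<le> real (n choose (k - 1))"
      using n_subsets[of "{..<n}" "k - 1"] by simp
  qed
  finally show ?thesis by (simp add: sum_distrib_left)
qed

text \<open>The source of the decay in \<open>n\<close>: \<open>k\<close> entries of variance at
  most \<open>1 / n\<close> stand against a count with only \<open>k - 1\<close> free vertices,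
  because one vertex is tied to a fixed vector.\<close>

lemma fact_binomial_le:
  assumes "k \<ge> 1" "n \<ge> 1" "0 \<le> q" "q \<le> 1 / real n"
  shows "fact k * real (n choose (k - 1)) * q ^ k \<le> real k / real n"
proof -
  obtain m where k: "k = Suc m" using assms(1) by (cases k) auto
  have "real ((n choose m) * fact m) \<le> real (n ^ m)" by (simp only: of_nat_le_iff binomial_fact_pow)
  then have 1: "fact m * real (n choose m) \<le> real n ^ m" by (simp add: mult.commute)
  have "fact k * real (n choose (k - 1)) * q ^ k = real k * (fact m * real (n choose m)) * q ^ k"
    by (simp add: k)
  also have "\<dots> \<le> real k * real n ^ m * (1 / real n) ^ k"
    using 1 assms by (intro mult_mono power_mono mult_nonneg_nonneg) auto
  also have "\<dots> = real k / real n" using assms(2) by (simp add: k field_simps)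
  finally show ?thesis .
qed

lemma real_sign_square [simp]: "(real_of_int (sign \<sigma>))\<^sup>2 = 1"
  by (simp add: sign_def)

lemma real_abs_sign [simp]: "\<bar>real_of_int (sign \<sigma>)\<bar> = 1"
  by (simp add: sign_def)

text \<open>\<open>U\<close> and \<open>V\<close> are the squared weights at the two ends of the
  open path. For given \<open>b\<close> and \<open>I\<close>, each \<open>c\<close> in
  \<open>I\<close> is the image of \<open>b\<close> under \<open>fact k\<close> permutations, so
  both ends are summed against their weights and only \<open>k - 1\<close> further vertices are
  free.\<close>

lemma sum_open_weights_le:
  fixes U V :: "nat \<Rightarrow> real"
  assumes UV: "\<And>b. U b \<ge> 0" "\<And>b. V b \<ge> 0" and nq: "n \<ge> 1" "0 \<le> q" "q \<le> 1 / real n"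
  shows "(\<Sum>(b, I, \<sigma>)\<in>open_idx n k. U b * V (\<sigma> b)) * q ^ k \<le> real k / real n * ((\<Sum>b<n. U b) * (\<Sum>b<n. V b))"
proof -
  have fI: "finite (insert b I)" if "I \<subseteq> {..<n} - {b}" for b and I :: "nat set"
    using that by (auto intro: finite_subset)
  have f0: "finite {\<sigma>. \<sigma> permutes insert b I}" if "I \<subseteq> {..<n} - {b}" for b and I :: "nat set"
    by (rule finite_permutations[OF fI[OF that]])
  have f1: "\<forall>I\<in>{I. I \<subseteq> {..<n} - {b} \<and> card I = k}. finite {\<sigma>. \<sigma> permutes insert b I \<and> \<sigma> b \<noteq> b}" for b
  proof
    fix I assume "I \<in> {I. I \<subseteq> {..<n} - {b} \<and> card I = k}"
    then have "I \<subseteq> {..<n} - {b}" by simp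
    from f0[OF this] show "finite {\<sigma>. \<sigma> permutes insert b I \<and> \<sigma> b \<noteq> b}"
      by (rule finite_subset[rotated]) auto
  qed
  have f2: "finite {I. I \<subseteq> {..<n} - {b} \<and> card I = k}" for b
    by (auto intro: finite_subset[of _ "Pow {..<n}"])
  have f3: "\<forall>b\<in>{..<n}. finite (SIGMA I:{I. I \<subseteq> {..<n} - {b} \<and> card I = k}. {\<sigma>. \<sigma> permutes insert b I \<and> \<sigma> b \<noteq> b})"
    using f1 f2 by (intro ballI finite_SigmaI) auto
  have "(\<Sum>(b, I, \<sigma>)\<in>open_idx n k. U b * V (\<sigma> b)) = (\<Sum>b<n. \<Sum>I | I \<subseteq> {..<n} - {b} \<and> card I = k.
     \<Sum>\<sigma> | \<sigma> permutes insert b I \<and> \<sigma> b \<noteq> b. U b * V (\<sigma> b))"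
    unfolding open_idx_def
    unfolding sum.Sigma[OF f2 f1] sum.Sigma[OF finite_lessThan f3] by (rule refl)
  also have "\<dots> = (\<Sum>b<n. \<Sum>I | I \<subseteq> {..<n} - {b} \<and> card I = k. U b * (fact k * (\<Sum>c\<in>I. V c)))"
  proof (rule sum.cong[OF refl], rule sum.cong[OF refl])
    fix b I assume b: "b \<in> {..<n}" and "I \<in> {I. I \<subseteq> {..<n} - {b} \<and> card I = k}"
    then have I: "I \<subseteq> {..<n} - {b}" "card I = k" "b \<notin> I" "finite I" by (auto intro: finite_subset)
    have "(\<Sum>\<sigma> | \<sigma> permutes insert b I \<and> \<sigma> b \<noteq> b. U b * V (\<sigma> b)) =
       (\<Sum>\<sigma> | \<sigma> permutes insert b I. if \<sigma> b \<noteq> b then U b * V (\<sigma> b) else 0)"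
      using sum.inter_filter[OF f0[OF I(1)], of "\<lambda>\<sigma>. U b * V (\<sigma> b)" "\<lambda>\<sigma>. \<sigma> b \<noteq> b"] by simp
    \<comment> \<open>A permutation of \<open>insert b I\<close> is a permutation of
      \<open>I\<close> followed by the transposition of \<open>b\<close> with its image
      \<open>c\<close>.\<close>
    also have "\<dots> = (\<Sum>c\<in>insert b I. \<Sum>q | q permutes I. if (Transposition.transpose b c \<circ> q) b \<noteq> b
        then U b * V ((Transposition.transpose b c \<circ> q) b) else 0)"
      by (rule sum_over_permutations_insert[OF I(4,3)])
    also have "\<dots> = (\<Sum>c\<in>insert b I. \<Sum>q | q permutes I. if c \<noteq> b then U b * V c else 0)"
    proof (rule sum.cong[OF refl], rule sum.cong[OF refl])
      fix c q assume "q \<in> {q. q permutes I}"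
      then have "q b = b" using permutes_not_in[of q I b] I(3) by blast
      then have "(Transposition.transpose b c \<circ> q) b = c" by simp
      then show "(if (Transposition.transpose b c \<circ> q) b \<noteq> b
        then U b * V ((Transposition.transpose b c \<circ> q) b) else 0) = (if c \<noteq> b then U b * V c else 0)" by simp
    qed
    also have "\<dots> = (\<Sum>c\<in>insert b I. fact k * (if c \<noteq> b then U b * V c else 0))"
      using card_permutations[OF I(2,4)] by simp
    also have "\<dots> = (\<Sum>c\<in>I. fact k * (U b * V c))"
      using I(3,4) by (subst sum.insert) (auto intro!: sum.cong)
    finally show "(\<Sum>\<sigma> | \<sigma> permutes insert b I \<and> \<sigma> b \<noteq> b. U b * V (\<sigma> b)) = U b * (fact k * (\<Sum>c\<in>I. V c))"
      by (simp add: sum_distrib_left mult_ac)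
  qed
  also have "\<dots> \<le> (\<Sum>b<n. \<Sum>I | I \<subseteq> {..<n} \<and> card I = k. U b * (fact k * (\<Sum>c\<in>I. V c)))"
    using UV by (intro sum_mono sum_mono2 finite_subset_idx) (auto intro!: mult_nonneg_nonneg sum_nonneg)
  also have "\<dots> = (\<Sum>b<n. U b) * (fact k * (\<Sum>I | I \<subseteq> {..<n} \<and> card I = k. \<Sum>c\<in>I. V c))"
    by (simp only: sum_distrib_left[symmetric] sum_distrib_right[symmetric])
  finally have le: "(\<Sum>(b, I, \<sigma>)\<in>open_idx n k. U b * V (\<sigma> b)) \<le> \<dots>" .
  show ?thesis
  proof (cases "k = 0")
    case True
    have "(\<Sum>I | I \<subseteq> {..<n} \<and> card I = k. \<Sum>c\<in>I. V c) = 0"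
      using True by (intro sum.neutral) (auto dest: finite_subset)
    then show ?thesis using le True by simp
  next
    case False
    then have k: "k \<ge> 1" by simp
    have "(\<Sum>(b, I, \<sigma>)\<in>open_idx n k. U b * V (\<sigma> b)) * q ^ k \<le>
      (\<Sum>b<n. U b) * (fact k * (real (n choose (k - 1)) * (\<Sum>b<n. V b))) * q ^ k"
      using UV nq by (intro mult_right_mono order_trans[OF le] mult_left_mono sum_subsets_le k) (auto intro: sum_nonneg)
    also have "\<dots> = (fact k * real (n choose (k - 1)) * q ^ k) * ((\<Sum>b<n. U b) * (\<Sum>b<n. V b))"
      by simp
    also have "\<dots> \<le> real k / real n * ((\<Sum>b<n. U b) * (\<Sum>b<n. V b))"
      using UV by (intro mult_right_mono fact_binomial_le k nq mult_nonneg_nonneg sum_nonneg)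
    finally show ?thesis .
  qed
qed

text \<open>Cauchy-Schwarz for the sum over the marked vertex costs a factor \<open>k\<close>;
  afterwards the marked vertex carries the weights of both vectors and is no longer free.\<close>

lemma sum_closed_weights_le:
  fixes u v :: "nat \<Rightarrow> complex"
  assumes nq: "n \<ge> 1" "0 \<le> q" "q \<le> 1 / real n"
  shows "(\<Sum>(I, \<sigma>)\<in>minor_idx n k. (cmod (\<Sum>b\<in>I. u b * v b))\<^sup>2) * q ^ k
     \<le> (real k)\<^sup>2 / real n * ((\<Sum>b<n. (cmod (u b))\<^sup>2) * (\<Sum>b<n. (cmod (v b))\<^sup>2))"
proof -
  have fp: "\<forall>I\<in>{I. I \<subseteq> {..<n} \<and> card I = k}. finite {\<sigma>. \<sigma> permutes I}"
    by (intro ballI finite_permutations finite_subset[OF _ finite_lessThan[of n]]) simp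
  define w where "w = (\<lambda>b. (cmod (u b))\<^sup>2 * (cmod (v b))\<^sup>2)"
  have w: "w b \<ge> 0" for b by (simp add: w_def)
  have "(\<Sum>(I, \<sigma>)\<in>minor_idx n k. (cmod (\<Sum>b\<in>I. u b * v b))\<^sup>2) =
     (\<Sum>I | I \<subseteq> {..<n} \<and> card I = k. \<Sum>\<sigma> | \<sigma> permutes I. (cmod (\<Sum>b\<in>I. u b * v b))\<^sup>2)"
    unfolding minor_idx_def by (rule sum.Sigma[OF finite_subset_idx fp, symmetric])
  also have "\<dots> \<le> (\<Sum>I | I \<subseteq> {..<n} \<and> card I = k. fact k * (real k * (\<Sum>b\<in>I. w b)))"
  proof (rule sum_mono)
    fix I assume "I \<in> {I. I \<subseteq> {..<n} \<and> card I = k}"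
    then have I: "card I = k" "finite I" by (auto intro: finite_subset)
    have "(cmod (\<Sum>b\<in>I. u b * v b))\<^sup>2 \<le> (\<Sum>b\<in>I. cmod (u b * v b))\<^sup>2"
      by (intro power_mono norm_sum) auto
    also have "\<dots> \<le> (\<Sum>b\<in>I. (cmod (u b * v b))\<^sup>2) * real (card I)"
      by (rule sum_squared_le_sum_of_squares)
    also have "\<dots> = real k * (\<Sum>b\<in>I. w b)"
      using I by (simp add: w_def norm_mult power_mult_distrib)
    finally show "(\<Sum>\<sigma> | \<sigma> permutes I. (cmod (\<Sum>b\<in>I. u b * v b))\<^sup>2) \<le> fact k * (real k * (\<Sum>b\<in>I. w b))"
      using card_permutations[OF I] by simp
  qed
  also have "\<dots> = real k * (fact k * (\<Sum>I | I \<subseteq> {..<n} \<and> card I = k. \<Sum>b\<in>I. w b))"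
    by (simp add: sum_distrib_left mult_ac)
  finally have le: "(\<Sum>(I, \<sigma>)\<in>minor_idx n k. (cmod (\<Sum>b\<in>I. u b * v b))\<^sup>2) \<le> \<dots>" .
  show ?thesis
  proof (cases "k = 0")
    case False
    then have k: "k \<ge> 1" by simp
    have "(\<Sum>(I, \<sigma>)\<in>minor_idx n k. (cmod (\<Sum>b\<in>I. u b * v b))\<^sup>2) * q ^ k \<le>
       real k * (fact k * (real (n choose (k - 1)) * (\<Sum>b<n. w b))) * q ^ k"
      using nq by (intro mult_right_mono order_trans[OF le] mult_left_mono sum_subsets_le k w) auto
    also have "\<dots> = real k * (fact k * real (n choose (k - 1)) * q ^ k) * (\<Sum>b<n. w b)" by simp
    also have "\<dots> \<le> (real k)\<^sup>2 / real n * (\<Sum>b<n. w b)"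
      unfolding power2_eq_square times_divide_eq_right[symmetric]
      by (intro mult_right_mono mult_left_mono fact_binomial_le k nq sum_nonneg w) auto
    finally have le2: "(\<Sum>(I, \<sigma>)\<in>minor_idx n k. (cmod (\<Sum>b\<in>I. u b * v b))\<^sup>2) * q ^ k
      \<le> (real k)\<^sup>2 / real n * (\<Sum>b<n. w b)" .
    have "(\<Sum>b<n. w b) \<le> (\<Sum>b<n. (cmod (u b))\<^sup>2 * (\<Sum>b<n. (cmod (v b))\<^sup>2))"
      unfolding w_def by (intro sum_mono mult_left_mono member_le_sum) auto
    also have "\<dots> = (\<Sum>b<n. (cmod (u b))\<^sup>2) * (\<Sum>b<n. (cmod (v b))\<^sup>2)" by (rule sum_distrib_right[symmetric])
    finally show ?thesis by (intro order_trans[OF le2] mult_left_mono) auto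
  qed (use le in auto)
qed

text \<open>\<open>Y\<close> holds the unscaled entries, whose law does not depend on
  \<open>n\<close>. Scaling by \<open>1 / sqrt n\<close> and truncation are put into a function
  \<open>f\<close> applied to the entries, so the same results serve the matrix and its
  truncation.\<close>

locale iid_array = iid_family M Y "{..<n} \<times> {..<n}" \<mu>
  for M :: "'w measure" and Y :: "nat \<times> nat \<Rightarrow> 'w \<Rightarrow> complex" and n :: nat and \<mu> +
  assumes n: "n \<ge> 1"
begin

abbreviation "E \<equiv> {..<n} \<times> {..<n}"

text \<open>There are at most \<open>n ^ k\<close> monomials, each of second moment at most
  \<open>1 / n ^ k\<close>. The bound is uniform in \<open>k\<close> and \<open>n\<close>, which
  controls the determinant on every disc of radius less than 1.\<close>

lemma second_moment_minor_sum:
  assumes f: "centered_L2 \<mu> f"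
    and q: "(LINT z|\<mu>. (cmod (f z))\<^sup>2) \<le> 1 / real n"
  shows "integrable M (\<lambda>\<omega>. (cmod (minor_sum n k (\<lambda>e. f (Y e \<omega>))))\<^sup>2)"
    and "expectation (\<lambda>\<omega>. (cmod (minor_sum n k (\<lambda>e. f (Y e \<omega>))))\<^sup>2) \<le> 1"
proof -
  let ?S = "\<lambda>(I, \<sigma>). perm_graph I \<sigma>"
  let ?q = "LINT z|\<mu>. (cmod (f z))\<^sup>2"
  have q0: "?q \<ge> 0" by (rule Bochner_Integration.integral_nonneg) simp
  have eq: "minor_sum n k (\<lambda>e. f (Y e \<omega>)) = (\<Sum>t\<in>minor_idx n k. perm_sign (snd t) * (\<Prod>e\<in>?S t. f (Y e \<omega>)))" for \<omega>
    by (simp add: minor_sum_def case_prod_beta)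
  have S: "?S t \<subseteq> E" if "t \<in> minor_idx n k" for t
    by (rule minor_graph_subset[OF that])
  have card: "card (?S t) = k" if "t \<in> minor_idx n k" for t
    using that by (auto simp: minor_idx_def)
  show "integrable M (\<lambda>\<omega>. (cmod (minor_sum n k (\<lambda>e. f (Y e \<omega>))))\<^sup>2)"
    unfolding eq by (rule second_moment_chaos(1)[OF finite_minor_idx inj_on_minor_idx S f])
  have "expectation (\<lambda>\<omega>. (cmod (minor_sum n k (\<lambda>e. f (Y e \<omega>))))\<^sup>2) =
     (\<Sum>t\<in>minor_idx n k. (cmod (perm_sign (snd t)))\<^sup>2 * ?q ^ card (?S t))"
    unfolding eq by (rule second_moment_chaos(2)[OF finite_minor_idx inj_on_minor_idx S f])
  also have "\<dots> = real (card (minor_idx n k)) * ?q ^ k" using card by simp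
  also have "\<dots> \<le> real n ^ k * (1 / real n) ^ k"
    using q q0 by (intro mult_mono card_minor_idx_le power_mono) auto
  also have "\<dots> = 1" using n by (simp add: power_one_over)
  finally show "expectation (\<lambda>\<omega>. (cmod (minor_sum n k (\<lambda>e. f (Y e \<omega>))))\<^sup>2) \<le> 1" .
qed

text \<open>The number of monomials cancels against the scaling, so the bound is governed by the
  atom distribution and the degree alone.\<close>

lemma second_moment_minor_sum_diff:
  assumes f: "centered_L2 \<mu> f" "centered_L2 \<mu> g"
  defines "x \<equiv> \<lambda>\<omega> e. f (Y e \<omega>) / sqrt (real n)" and "y \<equiv> \<lambda>\<omega> e. g (Y e \<omega>) / sqrt (real n)"
  shows "integrable M (\<lambda>\<omega>. (cmod (minor_sum n k (x \<omega>) - minor_sum n k (y \<omega>)))\<^sup>2)"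
    and "expectation (\<lambda>\<omega>. (cmod (minor_sum n k (x \<omega>) - minor_sum n k (y \<omega>)))\<^sup>2) \<le>
       \<bar>(LINT z|\<mu>. (cmod (f z))\<^sup>2) ^ k - 2 * Re ((LINT z|\<mu>. f z * cnj (g z)) ^ k) + (LINT z|\<mu>. (cmod (g z))\<^sup>2) ^ k\<bar>"
proof -
  let ?S = "\<lambda>(I, \<sigma>). perm_graph I \<sigma>"
  define F where "F = (\<lambda>z. f z / sqrt (real n))"
  define G where "G = (\<lambda>z. g z / sqrt (real n))"
  have FG: "centered_L2 \<mu> F" "centered_L2 \<mu> G"
    using f by (auto simp: centered_L2_def F_def G_def norm_divide power_divide)
  have i1: "(LINT z|\<mu>. (cmod (F z))\<^sup>2) = (LINT z|\<mu>. (cmod (f z))\<^sup>2) / real n"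
    "(LINT z|\<mu>. (cmod (G z))\<^sup>2) = (LINT z|\<mu>. (cmod (g z))\<^sup>2) / real n"
    by (simp_all add: F_def G_def norm_divide power_divide)
  have "F z * cnj (G z) = f z * cnj (g z) / complex_of_real (real n)" for z
    by (simp add: F_def G_def of_real_mult[symmetric] del: of_real_mult)
  then have i2: "(LINT z|\<mu>. F z * cnj (G z)) = (LINT z|\<mu>. f z * cnj (g z)) / complex_of_real (real n)"
    by simp
  have eq: "minor_sum n k (x \<omega>) - minor_sum n k (y \<omega>) = (\<Sum>t\<in>minor_idx n k. perm_sign (snd t) *
      ((\<Prod>e\<in>?S t. F (Y e \<omega>)) - (\<Prod>e\<in>?S t. G (Y e \<omega>))))" for \<omega>
    by (simp add: minor_sum_def case_prod_beta x_def y_def F_def G_def sum_subtractf right_diff_distrib)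
  have S: "?S t \<subseteq> E" if "t \<in> minor_idx n k" for t
    by (rule minor_graph_subset[OF that])
  have card: "card (?S t) = k" if "t \<in> minor_idx n k" for t
    using that by (auto simp: minor_idx_def)
  show "integrable M (\<lambda>\<omega>. (cmod (minor_sum n k (x \<omega>) - minor_sum n k (y \<omega>)))\<^sup>2)"
    unfolding eq by (rule second_moment_chaos_diff(1)[OF finite_minor_idx inj_on_minor_idx S FG])
  let ?V = "(LINT z|\<mu>. (cmod (f z))\<^sup>2) ^ k - 2 * Re ((LINT z|\<mu>. f z * cnj (g z)) ^ k) + (LINT z|\<mu>. (cmod (g z))\<^sup>2) ^ k"
  have "expectation (\<lambda>\<omega>. (cmod (minor_sum n k (x \<omega>) - minor_sum n k (y \<omega>)))\<^sup>2) =
     (\<Sum>t\<in>minor_idx n k. (cmod (perm_sign (snd t)))\<^sup>2 * ((LINT z|\<mu>. (cmod (F z))\<^sup>2) ^ card (?S t)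
         - 2 * Re ((LINT z|\<mu>. F z * cnj (G z)) ^ card (?S t)) + (LINT z|\<mu>. (cmod (G z))\<^sup>2) ^ card (?S t)))"
    unfolding eq by (rule second_moment_chaos_diff(2)[OF finite_minor_idx inj_on_minor_idx S FG])
  also have "\<dots> = real (card (minor_idx n k)) * ((LINT z|\<mu>. (cmod (F z))\<^sup>2) ^ k
         - 2 * Re ((LINT z|\<mu>. F z * cnj (G z)) ^ k) + (LINT z|\<mu>. (cmod (G z))\<^sup>2) ^ k)"
    using card by simp
  also have "\<dots> = real (card (minor_idx n k)) / real n ^ k * ?V"
    unfolding i1 i2 power_divide of_real_power[symmetric] Re_divide_of_real
    using n by (simp add: field_simps)
  also have "\<dots> \<le> real (card (minor_idx n k)) / real n ^ k * \<bar>?V\<bar>"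
    by (intro mult_left_mono) auto
  also have "\<dots> \<le> 1 * \<bar>?V\<bar>"
    using card_minor_idx_le[of n k] n by (intro mult_right_mono) (auto simp: divide_le_eq_1)
  finally show "expectation (\<lambda>\<omega>. (cmod (minor_sum n k (x \<omega>) - minor_sum n k (y \<omega>)))\<^sup>2) \<le> \<bar>?V\<bar>" by simp
qed

text \<open>Open and closed part are estimated separately, each by \<open>k^2 / n\<close> times the
  squared lengths of the vectors. This smallness is the reason why the outliers of
  \<open>X + C\<close> sit near those of \<open>C\<close>.\<close>

lemma second_moment_open_closed:
  assumes f: "centered_L2 \<mu> f"
    and q: "(LINT z|\<mu>. (cmod (f z))\<^sup>2) \<le> 1 / real n"
  defines "x \<equiv> \<lambda>\<omega> e. f (Y e \<omega>)"
  shows "integrable M (\<lambda>\<omega>. (cmod (open_coeff n k u v (x \<omega>) - closed_coeff n k u v (x \<omega>)))\<^sup>2)"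
    and "expectation (\<lambda>\<omega>. (cmod (open_coeff n k u v (x \<omega>) - closed_coeff n k u v (x \<omega>)))\<^sup>2)
      \<le> (2 * real k)\<^sup>2 / real n * ((\<Sum>b<n. (cmod (u b))\<^sup>2) * (\<Sum>b<n. (cmod (v b))\<^sup>2))"
proof -
  let ?S = "\<lambda>(I, \<sigma>). perm_graph I \<sigma>" and ?T = "\<lambda>(b, I, \<sigma>). perm_graph I \<sigma>"
  let ?q = "LINT z|\<mu>. (cmod (f z))\<^sup>2" and ?a = "\<lambda>(I, \<sigma>). (\<Sum>b\<in>I. u b * v b) * perm_sign \<sigma>"
    and ?b = "\<lambda>(b, I, \<sigma>). u b * v (\<sigma> b) * perm_sign \<sigma>"
  let ?W = "(\<Sum>b<n. (cmod (u b))\<^sup>2) * (\<Sum>b<n. (cmod (v b))\<^sup>2)"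
  have W: "?W \<ge> 0" by (intro mult_nonneg_nonneg sum_nonneg) auto
  have q0: "?q \<ge> 0" by (rule Bochner_Integration.integral_nonneg) simp
  have eq1: "closed_coeff n k u v (x \<omega>) = (\<Sum>t\<in>minor_idx n k. ?a t * (\<Prod>e\<in>?S t. f (Y e \<omega>)))" for \<omega>
    by (simp add: closed_coeff_def case_prod_beta x_def)
  have eq2: "open_coeff n k u v (x \<omega>) = (\<Sum>t\<in>open_idx n k. ?b t * (\<Prod>e\<in>?T t. f (Y e \<omega>)))" for \<omega>
    by (simp add: open_coeff_def case_prod_beta x_def)
  have S: "?S t \<subseteq> E" if "t \<in> minor_idx n k" for t
    by (rule minor_graph_subset[OF that])
  have T: "?T t \<subseteq> E" if "t \<in> open_idx n k" for t
    by (rule open_graph_subset[OF that])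
  have card: "card (?S t) = k" if "t \<in> minor_idx n k" for t
    using that by (auto simp: minor_idx_def)
  have card2: "card (?T t) = k" if "t \<in> open_idx n k" for t
    using that by (auto simp: open_idx_def)
  have I1: "integrable M (\<lambda>\<omega>. (cmod (closed_coeff n k u v (x \<omega>)))\<^sup>2)"
    unfolding eq1 by (rule second_moment_chaos(1)[OF finite_minor_idx inj_on_minor_idx S f])
  have I2: "integrable M (\<lambda>\<omega>. (cmod (open_coeff n k u v (x \<omega>)))\<^sup>2)"
    unfolding eq2 by (rule second_moment_chaos(1)[OF finite_open_idx inj_on_open_idx T f])
  have "expectation (\<lambda>\<omega>. (cmod (closed_coeff n k u v (x \<omega>)))\<^sup>2) =
     (\<Sum>t\<in>minor_idx n k. (cmod (?a t))\<^sup>2 * ?q ^ card (?S t))"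
    unfolding eq1 by (rule second_moment_chaos(2)[OF finite_minor_idx inj_on_minor_idx S f])
  also have "\<dots> = (\<Sum>(I, \<sigma>)\<in>minor_idx n k. (cmod (\<Sum>b\<in>I. u b * v b))\<^sup>2) * ?q ^ k"
    unfolding sum_distrib_right[where A = "minor_idx n k"] using card by (intro sum.cong refl) (auto simp: norm_mult)
  also have "\<dots> \<le> (real k)\<^sup>2 / real n * ?W" by (rule sum_closed_weights_le[OF n q0 q])
  finally have E1: "expectation (\<lambda>\<omega>. (cmod (closed_coeff n k u v (x \<omega>)))\<^sup>2) \<le> (real k)\<^sup>2 / real n * ?W" .
  have "expectation (\<lambda>\<omega>. (cmod (open_coeff n k u v (x \<omega>)))\<^sup>2) =
     (\<Sum>t\<in>open_idx n k. (cmod (?b t))\<^sup>2 * ?q ^ card (?T t))"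
    unfolding eq2 by (rule second_moment_chaos(2)[OF finite_open_idx inj_on_open_idx T f])
  also have "\<dots> = (\<Sum>(b, I, \<sigma>)\<in>open_idx n k. (cmod (u b))\<^sup>2 * (cmod (v (\<sigma> b)))\<^sup>2) * ?q ^ k"
    unfolding sum_distrib_right[where A = "open_idx n k"] using card2
    by (intro sum.cong refl) (auto simp: norm_mult power_mult_distrib)
  also have "\<dots> \<le> real k / real n * ?W" by (rule sum_open_weights_le[OF _ _ n q0 q]) auto
  also have "\<dots> \<le> (real k)\<^sup>2 / real n * ?W"
  proof -
    have "real k \<le> (real k)\<^sup>2" by (cases k) (auto simp: power2_eq_square)
    then show ?thesis using W by (intro mult_right_mono divide_right_mono) auto
  qed
  finally have E2: "expectation (\<lambda>\<omega>. (cmod (open_coeff n k u v (x \<omega>)))\<^sup>2) \<le> (real k)\<^sup>2 / real n * ?W" .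
  have le: "(cmod (a - b))\<^sup>2 \<le> 2 * (cmod a)\<^sup>2 + 2 * (cmod b)\<^sup>2" for a b
  proof -
    have "(cmod (a - b))\<^sup>2 \<le> (cmod a + cmod b)\<^sup>2" by (intro power_mono norm_triangle_ineq4) auto
    also have "\<dots> \<le> 2 * (cmod a)\<^sup>2 + 2 * (cmod b)\<^sup>2"
      using sum_squares_bound[of "cmod a" "cmod b"] by (simp add: power2_sum)
    finally show ?thesis .
  qed
  have fm: "f \<in> borel_measurable borel" using f by (simp add: centered_L2_def)
  have Ym: "(\<lambda>\<omega>. f (Y e \<omega>)) \<in> borel_measurable M" if "e \<in> E" for e
    by (rule measurable_compose[OF Y_measurable[OF that] fm])
  have m1: "(\<lambda>\<omega>. closed_coeff n k u v (x \<omega>)) \<in> borel_measurable M"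
    unfolding eq1
    by (intro borel_measurable_sum borel_measurable_times borel_measurable_const borel_measurable_prod Ym) (use S in auto)
  have m2: "(\<lambda>\<omega>. open_coeff n k u v (x \<omega>)) \<in> borel_measurable M"
    unfolding eq2
    by (intro borel_measurable_sum borel_measurable_times borel_measurable_const borel_measurable_prod Ym) (use T in auto)
  have I3: "integrable M (\<lambda>\<omega>. 2 * (cmod (open_coeff n k u v (x \<omega>)))\<^sup>2 + 2 * (cmod (closed_coeff n k u v (x \<omega>)))\<^sup>2)"
    using I1 I2 by auto
  show I: "integrable M (\<lambda>\<omega>. (cmod (open_coeff n k u v (x \<omega>) - closed_coeff n k u v (x \<omega>)))\<^sup>2)"
    by (rule Bochner_Integration.integrable_bound[OF I3]) (use m1 m2 le in auto)
  have "expectation (\<lambda>\<omega>. (cmod (open_coeff n k u v (x \<omega>) - closed_coeff n k u v (x \<omega>)))\<^sup>2) \<le>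
    expectation (\<lambda>\<omega>. 2 * (cmod (open_coeff n k u v (x \<omega>)))\<^sup>2 + 2 * (cmod (closed_coeff n k u v (x \<omega>)))\<^sup>2)"
    by (rule integral_mono[OF I I3 le])
  also have "\<dots> = 2 * expectation (\<lambda>\<omega>. (cmod (open_coeff n k u v (x \<omega>)))\<^sup>2) +
     2 * expectation (\<lambda>\<omega>. (cmod (closed_coeff n k u v (x \<omega>)))\<^sup>2)"
    using I1 I2 by (subst Bochner_Integration.integral_add) auto
  also have "\<dots> \<le> (2 * real k)\<^sup>2 / real n * ?W"
    using E1 E2 by (simp add: power_mult_distrib)
  finally show "expectation (\<lambda>\<omega>. (cmod (open_coeff n k u v (x \<omega>) - closed_coeff n k u v (x \<omega>)))\<^sup>2)
      \<le> (2 * real k)\<^sup>2 / real n * ?W" .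
qed

end

section \<open>Closed walks\<close>

text \<open>The positions below \<open>2 * m\<close> carry two directed cycles, one on
  \<open>{..<m}\<close> and one on \<open>{m..<2 * m}\<close>; a pair of closed walks of length
  \<open>m\<close> is a single function \<open>w\<close> on them.\<close>

definition next_pos :: "nat \<Rightarrow> nat \<Rightarrow> nat" where
  "next_pos m p = (if Suc p = m then 0 else if Suc p = 2 * m then m else Suc p)"

definition edge :: "nat \<Rightarrow> (nat \<Rightarrow> nat) \<Rightarrow> nat \<Rightarrow> nat \<times> nat" where
  "edge m w p = (w p, w (next_pos m p))"

text \<open>All other pairs have expectation 0, since an entry that occurs once has mean 0 and is
  independent of the rest.\<close>

definition doubled :: "nat \<Rightarrow> (nat \<Rightarrow> nat) \<Rightarrow> bool" where
  "doubled m w \<longleftrightarrow> (\<forall>p<2 * m. \<exists>p'<2 * m. p' \<noteq> p \<and> edge m w p' = edge m w p)"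

lemma next_pos_less: "p < 2 * m \<Longrightarrow> next_pos m p < 2 * m"
  by (auto simp: next_pos_def)

lemma next_pos_le: "m \<ge> 1 \<Longrightarrow> next_pos m p \<le> Suc p"
  by (auto simp: next_pos_def)

lemma card_fibers_sum:
  assumes "finite P"
  shows "(\<Sum>e\<in>f ` P. card {p \<in> P. f p = e}) = card P"
  using sum.image_gen[OF assms, of "\<lambda>_. 1::nat" f] by simp

lemma doubled_fiber_ge_2:
  assumes "doubled m w" "e \<in> edge m w ` {..<2 * m}"
  shows "card {p \<in> {..<2 * m}. edge m w p = e} \<ge> 2"
proof -
  obtain p where p: "p < 2 * m" "e = edge m w p" using assms(2) by auto
  then obtain p' where p': "p' < 2 * m" "p' \<noteq> p" "edge m w p' = edge m w p"
    using assms(1) by (auto simp: doubled_def)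
  have "card {p, p'} \<le> card {p \<in> {..<2 * m}. edge m w p = e}"
    using p p' by (intro card_mono) auto
  then show ?thesis using p' by simp
qed

lemma card_edges_le:
  assumes "doubled m w"
  shows "card (edge m w ` {..<2 * m}) \<le> m"
proof -
  have "2 * card (edge m w ` {..<2 * m}) \<le> (\<Sum>e\<in>edge m w ` {..<2 * m}. card {p \<in> {..<2 * m}. edge m w p = e})"
    using doubled_fiber_ge_2[OF assms] sum_mono[of "edge m w ` {..<2 * m}" "\<lambda>_. 2"
      "\<lambda>e. card {p \<in> {..<2 * m}. edge m w p = e}"] by simp
  also have "\<dots> = 2 * m" by (subst card_fibers_sum) auto
  finally show ?thesis by simp
qed

lemma fst_edges: "fst ` (edge m w ` P) = w ` P"
  by (auto simp: edge_def image_image)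

text \<open>Every vertex is the start of an edge, and at most \<open>m\<close> different edges
  occur.\<close>

lemma card_vertices_le:
  assumes "doubled m w"
  shows "card (w ` {..<2 * m}) \<le> m"
  using card_image_le[of "edge m w ` {..<2 * m}" fst] card_edges_le[OF assms] by (simp add: fst_edges)

text \<open>With \<open>m\<close> vertices there are exactly \<open>m\<close> edges, so sending an
  edge to its start is injective and every vertex has only one outgoing edge.\<close>

lemma extremal_successor:
  assumes d: "doubled m w" and c: "card (w ` {..<2 * m}) = m"
    and "p < 2 * m" "p' < 2 * m" "w p = w p'"
  shows "w (next_pos m p) = w (next_pos m p')"
proof -
  have "card (edge m w ` {..<2 * m}) = m"
    using card_image_le[of "edge m w ` {..<2 * m}" fst] card_edges_le[OF d] c by (simp add: fst_edges)
  then have "card (fst ` edge m w ` {..<2 * m}) = card (edge m w ` {..<2 * m})"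
    using c by (simp only: fst_edges)
  then have inj: "inj_on fst (edge m w ` {..<2 * m})"
    by (intro eq_card_imp_inj_on) simp_all
  have "edge m w p = edge m w p'"
    by (rule inj_onD[OF inj _ imageI imageI]) (use assms(3-5) in \<open>simp_all only: edge_def fst_conv lessThan_iff\<close>)
  then show ?thesis by (simp add: edge_def)
qed

text \<open>An edge used more than twice would push the number of positions above
  \<open>2 * m\<close>. Extremal pairs thus involve second moments only, and the truncation level
  stays out of the leading term.\<close>

lemma extremal_fiber:
  assumes d: "doubled m w" and c: "card (w ` {..<2 * m}) = m" and e: "e \<in> edge m w ` {..<2 * m}"
  shows "card {p \<in> {..<2 * m}. edge m w p = e} = 2"
proof (rule ccontr)
  let ?E = "edge m w ` {..<2 * m}" and ?c = "\<lambda>e. card {p \<in> {..<2 * m}. edge m w p = e}"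
  assume "?c e \<noteq> 2"
  then have gt: "2 < ?c e" using doubled_fiber_ge_2[OF d e] by simp
  have cE: "card ?E = m"
    using card_image_le[of ?E fst] card_edges_le[OF d] c by (simp add: fst_edges)
  have "(\<Sum>e\<in>?E. 2) < (\<Sum>e\<in>?E. ?c e)"
    using doubled_fiber_ge_2[OF d] gt e by (intro sum_strict_mono_ex1) auto
  also have "\<dots> = 2 * m" by (subst card_fibers_sum) auto
  finally show False using cE by simp
qed

text \<open>The property of extremal pairs on which their count rests: the current vertex determines
  the next one.\<close>

definition deterministic :: "nat \<Rightarrow> (nat \<Rightarrow> nat) \<Rightarrow> bool" where
  "deterministic m w \<longleftrightarrow> card (w ` {..<2 * m}) = m \<and>
    (\<forall>p<2 * m. \<forall>p'<2 * m. w p = w p' \<longrightarrow> w (next_pos m p) = w (next_pos m p'))"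

definition first_occ :: "nat \<Rightarrow> (nat \<Rightarrow> nat) \<Rightarrow> nat set" where
  "first_occ m w = {p. p < 2 * m \<and> (\<forall>p'<p. w p' \<noteq> w p)}"

lemma card_first_occ: "card (first_occ m w) = card (w ` {..<2 * m})"
proof -
  have inj: "inj_on w (first_occ m w)"
  proof (rule inj_onI)
    fix p q assume A: "p \<in> first_occ m w" "q \<in> first_occ m w" "w p = w q"
    have "\<not> p < q" using A(2,3) unfolding first_occ_def by blast
    moreover have "\<not> q < p" using A(1) A(3)[symmetric] unfolding first_occ_def by blast
    ultimately show "p = q" by simp
  qed
  have "w ` first_occ m w = w ` {..<2 * m}"
  proof (rule Set.equalityI)
    show "w ` first_occ m w \<subseteq> w ` {..<2 * m}"
      by (rule image_mono) (simp add: first_occ_def subset_eq)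
    show "w ` {..<2 * m} \<subseteq> w ` first_occ m w"
    proof
      fix y assume "y \<in> w ` {..<2 * m}"
      then obtain p where p: "p < 2 * m" "w p = y" by blast
      define q where "q = (LEAST q. w q = y)"
      have q: "w q = y" unfolding q_def by (rule LeastI[of _ p]) (rule p)
      have qp: "q \<le> p" unfolding q_def by (rule Least_le) (rule p)
      have "w p' \<noteq> w q" if "p' < q" for p'
      proof -
        have "w p' \<noteq> y" by (rule not_less_Least) (use that in \<open>simp only: q_def\<close>)
        then show ?thesis unfolding q .
      qed
      moreover have "q < 2 * m" using qp p(1) by simp
      ultimately have "q \<in> first_occ m w" unfolding first_occ_def by blast
      from imageI[OF this, of w] show "y \<in> w ` first_occ m w" by (simp only: q)
    qed
  qed
  then show ?thesis using card_image[OF inj] by (simp only:)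
qed

text \<open>After a repetition the walk retraces the step taken at the earlier visit, and
  \<open>next_pos\<close> never advances by more than one, so the vertex reached is an old one. The
  condition \<open>next_pos m q = Suc q\<close> excludes the last positions of the two
  cycles.\<close>

lemma first_occ_step:
  assumes det: "deterministic m w" and m: "m \<ge> 1" and q: "q < 2 * m" "next_pos m q = Suc q" "q \<notin> first_occ m w"
  shows "Suc q \<notin> first_occ m w"
proof -
  obtain p where p: "p < q" "w p = w q" using q by (auto simp: first_occ_def)
  have "w (next_pos m p) = w (Suc q)" using det p q by (auto simp: deterministic_def)
  moreover have "next_pos m p < Suc q" using next_pos_le[OF m, of p] p by simp
  ultimately show ?thesis by (auto simp: first_occ_def)
qed

text \<open>For \<open>l \<le> m\<close>, initial segments of the two cycles, of lengths
  \<open>l\<close> and \<open>m - l\<close>.\<close>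

definition free_pos :: "nat \<Rightarrow> nat \<Rightarrow> nat set" where
  "free_pos m l = {..<l} \<union> {m..<2 * m - l}"

lemma downset_eq_interval:
  fixes A :: "nat set"
  assumes "A \<subseteq> {a..<b}" and "\<And>q. q \<ge> a \<Longrightarrow> Suc q < b \<Longrightarrow> q \<notin> A \<Longrightarrow> Suc q \<notin> A"
  shows "A = {a..<a + card A}"
proof -
  have up: "q + i \<notin> A" if "a \<le> q" "q \<notin> A" for q i
  proof (induction i)
    case (Suc i)
    then show ?case using assms(2)[of "q + i"] assms(1) that(1) by (cases "Suc (q + i) < b") auto
  qed (use that in simp)
  have dn: "q \<in> A" if "p \<in> A" "a \<le> q" "q \<le> p" for p q
    using up[of q "p - q"] that by auto
  show ?thesis
  proof (cases "A = {}")
    case False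
    have fin: "finite A" using assms(1) finite_subset by blast
    define M where "M = Max A"
    have M: "M \<in> A" "\<And>p. p \<in> A \<Longrightarrow> p \<le> M" using fin False by (auto simp: M_def)
    have "A = {a..M}"
    proof (intro Set.equalityI subsetI)
      fix q assume "q \<in> A"
      then show "q \<in> {a..M}" using M(2) assms(1) by force
    next
      fix q assume "q \<in> {a..M}"
      then show "q \<in> A" using dn[OF M(1)] by simp
    qed
    moreover from this have "a \<le> M" using False by auto
    ultimately show ?thesis by (simp add: atLeastLessThanSuc_atLeastAtMost[symmetric])
  qed simp
qed

text \<open>Within each cycle new vertices stop at the first repetition, so their positions form an
  initial segment; the two lengths add up to the number \<open>m\<close> of vertices.\<close>

lemma first_occ_eq_free_pos:
  assumes det: "deterministic m w" and m: "m \<ge> 1"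
  defines "l \<equiv> card (first_occ m w \<inter> {..<m})"
  shows "first_occ m w = free_pos m l" "l \<le> m"
proof -
  let ?A = "first_occ m w \<inter> {..<m}" and ?B = "first_occ m w \<inter> {m..<2 * m}"
  have "?A = {0..<0 + card ?A}"
  proof (rule downset_eq_interval)
    fix q assume "Suc q < m" "q \<notin> ?A"
    then show "Suc q \<notin> ?A" using first_occ_step[OF det m, of q] by (auto simp: next_pos_def)
  qed auto
  then have A: "?A = {..<l}" by (simp add: l_def atLeast0LessThan)
  have B: "?B = {m..<m + card ?B}"
  proof (rule downset_eq_interval)
    fix q assume "m \<le> q" "Suc q < 2 * m" "q \<notin> ?B"
    then show "Suc q \<notin> ?B" using first_occ_step[OF det m, of q] by (auto simp: next_pos_def)
  qed auto
  have U: "first_occ m w = ?A \<union> ?B" by (auto simp: first_occ_def)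
  have fin: "finite (first_occ m w)" by (simp add: first_occ_def)
  have "card (first_occ m w) = card ?A + card ?B"
    by (subst U, subst card_Un_disjoint) (use fin in auto)
  moreover have "card (first_occ m w) = m" using det by (simp add: card_first_occ deterministic_def)
  ultimately have c: "l + card ?B = m" by (simp add: l_def)
  then show "l \<le> m" by simp
  have "m + card ?B = 2 * m - l" using c by simp
  then show "first_occ m w = free_pos m l" using A B U by (simp add: free_pos_def)
qed

lemma card_free_pos: "l \<le> m \<Longrightarrow> card (free_pos m l) = m"
  unfolding free_pos_def by (subst card_Un_disjoint) auto

text \<open>Apart from its values at first occurrences, a deterministic pair of closed walks is determined
  by the places where its two first repetitions point to.\<close>

lemma deterministic_determined:
  assumes dw: "deterministic m w" and dw': "deterministic m w'" and m: "m \<ge> 1"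
    and F: "first_occ m w = free_pos m l" "first_occ m w' = free_pos m l"
    and eq: "\<And>p. p \<in> free_pos m l \<Longrightarrow> w p = w' p"
    and a: "l < m \<Longrightarrow> a < l \<and> w a = w l \<and> w' a = w' l"
    and b: "0 < l \<Longrightarrow> b < 2 * m - l \<and> w b = w (2 * m - l) \<and> w' b = w' (2 * m - l)"
    and l: "l \<le> m"
  shows "p < 2 * m \<Longrightarrow> w p = w' p"
proof (induction p rule: less_induct)
  case (less p)
  \<comment> \<open>The positions \<open>l\<close> and \<open>2 * m - l\<close> are the first
    repetitions in the two cycles, for which \<open>a\<close> and \<open>b\<close> record an earlier
    visit; every later position has a repeated predecessor.\<close>
  consider "p \<in> free_pos m l" | "p = l" "l < m" | "p = 2 * m - l" "0 < l"
    | "l < p" "p < m" | "2 * m - l < p" "m < p"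
    using less.prems l unfolding free_pos_def by (simp only: Un_iff lessThan_iff atLeastLessThan_iff) linarith
  \<comment> \<open>The vertex at the predecessor \<open>q\<close> was already met at
    \<open>q'\<close>, and the step from \<open>q'\<close> dictates the step from \<open>q\<close>
    in both walks. The induction hypothesis applies because \<open>next_pos m q'\<close> lies below
    \<open>p\<close>.\<close>
  moreover have rep: "w p = w' p" if q: "p = Suc q" and nq: "q \<notin> free_pos m l" "next_pos m q = Suc q" "q < 2 * m" for q
  proof -
    obtain q' where q': "q' < q" "w q' = w q" using nq F(1) by (auto simp: first_occ_def)
    have "w' q' = w' q" using less.IH[of q'] less.IH[of q] q' q less.prems by simp
    then have "w' (next_pos m q') = w' p"
      using dw'[unfolded deterministic_def, THEN conjunct2, rule_format, of q' q] nq q' q by simp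
    moreover have "w (next_pos m q') = w p"
      using dw[unfolded deterministic_def, THEN conjunct2, rule_format, of q' q] nq q' q by simp
    moreover have "next_pos m q' < p" using next_pos_le[OF m, of q'] q' q by simp
    ultimately show ?thesis using less.IH[of "next_pos m q'"] less.prems by simp
  qed
  ultimately show ?case
  proof cases
    case 1
    then show ?thesis by (rule eq)
  next
    case 2
    then show ?thesis using a less.IH[of a] less.prems by simp
  next
    case 3
    then show ?thesis using b less.IH[of b] less.prems by simp
  next
    case 4
    then obtain q where q: "p = Suc q" by (cases p) auto
    have nq: "q \<notin> free_pos m l" "next_pos m q = Suc q" "q < 2 * m"
      using 4 q by (auto simp: free_pos_def next_pos_def)
    show ?thesis by (rule rep[OF q nq])
  next
    case 5
    then obtain q where q: "p = Suc q" by (cases p) auto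
    have nq: "q \<notin> free_pos m l" "next_pos m q = Suc q" "q < 2 * m"
      using 5 q less.prems l by (auto simp: free_pos_def next_pos_def)
    show ?thesis by (rule rep[OF q nq])
  qed
qed

text \<open>A pair is encoded by the length \<open>l\<close>, two pointers among
  \<open>2 * m\<close> positions, and the vertices at the \<open>m\<close> free positions. The
  factor in front of \<open>n ^ m\<close> is polynomial in \<open>m\<close>, which a sum against
  \<open>R ^ m\<close> with \<open>R < 1\<close> tolerates.\<close>

lemma card_deterministic_le:
  assumes m: "m \<ge> 1"
  shows "card {w \<in> {..<2 * m} \<rightarrow>\<^sub>E {..<n}. deterministic m w} \<le> (m + 1) * (2 * m * (2 * m) * n ^ m)"
proof -
  let ?D = "{w \<in> {..<2 * m} \<rightarrow>\<^sub>E {..<n}. deterministic m w}"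
  define L where "L = (\<lambda>w. card (first_occ m w \<inter> {..<m}))"
  \<comment> \<open>For \<open>L w = m\<close> the first cycle contains no repetition and the
    pointer gets the default value 0; likewise for \<open>B\<close> when
    \<open>L w = 0\<close>.\<close>
  define A where "A = (\<lambda>w. if L w < m then SOME a. a < L w \<and> w a = w (L w) else 0)"
  define B where "B = (\<lambda>w. if 0 < L w then SOME b. b < 2 * m - L w \<and> w b = w (2 * m - L w) else 0)"
  define \<Phi> where "\<Phi> = (\<lambda>w. (L w, A w, B w, restrict w (free_pos m (L w))))"
  have F: "first_occ m w = free_pos m (L w)" "L w \<le> m" if "w \<in> ?D" for w
    using first_occ_eq_free_pos[of m w] that m by (simp_all add: L_def)
  have A: "A w < L w \<and> w (A w) = w (L w)" if w: "w \<in> ?D" and l: "L w < m" for w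
  proof -
    have "L w \<notin> first_occ m w" using F[OF w] l by (simp add: free_pos_def)
    moreover have "L w < 2 * m" using l by simp
    ultimately have "\<exists>a. a < L w \<and> w a = w (L w)" unfolding first_occ_def by blast
    from someI_ex[OF this] show ?thesis using l by (simp add: A_def)
  qed
  have B: "B w < 2 * m - L w \<and> w (B w) = w (2 * m - L w)" if w: "w \<in> ?D" and l: "0 < L w" for w
  proof -
    have "2 * m - L w \<notin> first_occ m w" using F[OF w] l by (simp add: free_pos_def)
    moreover have "2 * m - L w < 2 * m" using l m by simp
    ultimately have "\<exists>b. b < 2 * m - L w \<and> w b = w (2 * m - L w)" unfolding first_occ_def by blast
    from someI_ex[OF this] show ?thesis using l by (simp add: B_def)
  qed
  let ?T = "SIGMA l:{..m}. {..<2 * m} \<times> {..<2 * m} \<times> (free_pos m l \<rightarrow>\<^sub>E {..<n})"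
  have finF: "finite (free_pos m l)" for l by (simp add: free_pos_def)
  have finT: "finite ?T"
    by (intro finite_SigmaI finite_cartesian_product finite_PiE) (use finF in auto)
  have "card ?D \<le> card ?T"
  proof (rule card_inj_on_le[of \<Phi>])
    show "inj_on \<Phi> ?D"
    proof (rule inj_onI)
      fix w w' assume w: "w \<in> ?D" and w': "w' \<in> ?D" and eq: "\<Phi> w = \<Phi> w'"
      have e: "L w = L w'" "A w = A w'" "B w = B w'"
        using eq unfolding \<Phi>_def prod.inject by blast+
      have e4: "restrict w (free_pos m (L w)) = restrict w' (free_pos m (L w))"
        using eq unfolding \<Phi>_def prod.inject e(1) by blast
      have "w p = w' p" if "p < 2 * m" for p
      proof (rule deterministic_determined[of m w w' "L w" "A w" "B w"])
        show "deterministic m w" "deterministic m w'" using w w' by blast+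
        show "first_occ m w = free_pos m (L w)" "first_occ m w' = free_pos m (L w)"
          using F(1)[OF w] F(1)[OF w'] by (simp_all only: e)
        show "w p = w' p" if "p \<in> free_pos m (L w)" for p
          using fun_cong[OF e4, of p] that by simp
        show "A w < L w \<and> w (A w) = w (L w) \<and> w' (A w) = w' (L w)" if "L w < m"
          using A[OF w that] A[OF w'] that by (simp only: e)
        show "B w < 2 * m - L w \<and> w (B w) = w (2 * m - L w) \<and> w' (B w) = w' (2 * m - L w)" if "0 < L w"
          using B[OF w that] B[OF w'] that by (simp only: e)
        show "L w \<le> m" by (rule F(2)[OF w])
      qed (rule m, rule that)
      moreover have "w \<in> {..<2 * m} \<rightarrow>\<^sub>E {..<n}" "w' \<in> {..<2 * m} \<rightarrow>\<^sub>E {..<n}" using w w' by blast+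
      ultimately show "w = w'" by (intro PiE_ext) auto
    qed
    show "\<Phi> ` ?D \<subseteq> ?T"
    proof
      fix y assume "y \<in> \<Phi> ` ?D"
      then obtain w where w: "w \<in> ?D" and y: "y = \<Phi> w" by blast
      have "A w < 2 * m"
      proof (cases "L w < m")
        case True
        then show ?thesis using conjunct1[OF A[OF w True]] by linarith
      qed (use m in \<open>simp add: A_def\<close>)
      moreover have "B w < 2 * m"
      proof (cases "0 < L w")
        case True
        then show ?thesis using conjunct1[OF B[OF w True]] by linarith
      qed (use m in \<open>simp add: B_def\<close>)
      moreover have "restrict w (free_pos m (L w)) \<in> free_pos m (L w) \<rightarrow>\<^sub>E {..<n}"
      proof (rule restrict_PiE_iff[THEN iffD2], rule ballI)
        fix i assume "i \<in> free_pos m (L w)"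
        then have "i < 2 * m" using F(2)[OF w] by (auto simp: free_pos_def)
        then show "w i \<in> {..<n}" using w by (auto simp: PiE_iff)
      qed
      ultimately show "y \<in> ?T" using F(2)[OF w] by (simp add: y \<Phi>_def)
    qed
  qed (rule finT)
  also have "card ?T = (\<Sum>l\<le>m. 2 * m * (2 * m * n ^ m))"
  proof (subst card_SigmaI)
    show "\<forall>l\<in>{..m}. finite ({..<2 * m} \<times> {..<2 * m} \<times> (free_pos m l \<rightarrow>\<^sub>E {..<n}))"
      using finF by (intro ballI finite_cartesian_product finite_PiE) auto
    show "(\<Sum>l\<le>m. card ({..<2 * m} \<times> {..<2 * m} \<times> (free_pos m l \<rightarrow>\<^sub>E {..<n}))) =
      (\<Sum>l\<le>m. 2 * m * (2 * m * n ^ m))"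
      by (intro sum.cong refl) (simp add: card_cartesian_product card_PiE finF card_free_pos)
  qed simp
  finally show ?thesis by (simp add: algebra_simps)
qed

text \<open>Fewer than \<open>m\<close> vertices fit into a set of exactly \<open>m - 1\<close>.
  This saves a factor \<open>n\<close> against the leading term, which will absorb the crude bounds
  by powers of \<beta>.\<close>

lemma card_few_vertices_le:
  assumes m: "m \<ge> 1" and n: "n \<ge> m"
  shows "card {w \<in> {..<2 * m} \<rightarrow>\<^sub>E {..<n}. card (w ` {..<2 * m}) < m} \<le> n ^ (m - 1) * m ^ (2 * m)"
proof -
  let ?V = "{V. V \<subseteq> {..<n} \<and> card V = m - 1}"
  have fin: "finite ?V" by (rule finite_subset[of _ "Pow {..<n}"]) auto
  have sub: "{w \<in> {..<2 * m} \<rightarrow>\<^sub>E {..<n}. card (w ` {..<2 * m}) < m} \<subseteq> (\<Union>V\<in>?V. {..<2 * m} \<rightarrow>\<^sub>E V)"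
  proof
    fix w assume w: "w \<in> {w \<in> {..<2 * m} \<rightarrow>\<^sub>E {..<n}. card (w ` {..<2 * m}) < m}"
    then have wP: "w \<in> {..<2 * m} \<rightarrow>\<^sub>E {..<n}" and c: "card (w ` {..<2 * m}) < m" by blast+
    have 1: "w ` {..<2 * m} \<subseteq> {..<n}" using wP unfolding PiE_iff by blast
    have 2: "card (w ` {..<2 * m}) \<le> m - 1" using c by linarith
    have 3: "m - 1 \<le> card {..<n}" using n by simp
    obtain V where V: "w ` {..<2 * m} \<subseteq> V" "V \<subseteq> {..<n}" "card V = m - 1"
      using exists_subset_between[OF 2 3 1 finite_lessThan] by blast
    have "w \<in> {..<2 * m} \<rightarrow>\<^sub>E V" using wP V(1) unfolding PiE_iff by blast
    then show "w \<in> (\<Union>V\<in>?V. {..<2 * m} \<rightarrow>\<^sub>E V)" using V by blast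
  qed
  have finV: "finite V" if "V \<in> ?V" for V using that finite_subset[OF _ finite_lessThan[of n]] by blast
  have finU: "finite (\<Union>V\<in>?V. {..<2 * m} \<rightarrow>\<^sub>E V)"
  proof (rule finite_UN_I[OF fin])
    fix V assume "V \<in> ?V"
    from finV[OF this] show "finite ({..<2 * m} \<rightarrow>\<^sub>E V)" by (intro finite_PiE finite_lessThan)
  qed
  have "card {w \<in> {..<2 * m} \<rightarrow>\<^sub>E {..<n}. card (w ` {..<2 * m}) < m} \<le> card (\<Union>V\<in>?V. {..<2 * m} \<rightarrow>\<^sub>E V)"
    by (rule card_mono[OF finU sub])
  also have "\<dots> \<le> (\<Sum>V\<in>?V. card ({..<2 * m} \<rightarrow>\<^sub>E V))" by (rule card_UN_le[OF fin])
  also have "\<dots> = (\<Sum>V\<in>?V. (m - 1) ^ (2 * m))"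
    by (intro sum.cong refl) (simp add: card_PiE)
  also have "\<dots> = (n choose (m - 1)) * (m - 1) ^ (2 * m)"
    using n_subsets[of "{..<n}" "m - 1"] by simp
  also have "\<dots> \<le> n ^ (m - 1) * m ^ (2 * m)"
  proof (intro mult_mono power_mono)
    have "n choose (m - 1) \<le> (n choose (m - 1)) * fact (m - 1)" by simp
    also have "\<dots> \<le> n ^ (m - 1)" by (rule binomial_fact_pow)
    finally show "n choose (m - 1) \<le> n ^ (m - 1)" .
  qed auto
  finally show ?thesis .
qed

text \<open>A bound for the modulus of the expectation belonging to one pair of walks: 0 if some
  edge occurs once, 1 if only second moments occur, and otherwise the sup bound \<beta> at each of
  the \<open>2 * m\<close> positions.\<close>

definition walk_weight :: "nat \<Rightarrow> real \<Rightarrow> (nat \<Rightarrow> nat) \<Rightarrow> real" where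
  "walk_weight m \<beta> w = (if doubled m w then if card (w ` {..<2 * m}) = m then 1 else \<beta> ^ (2 * m) else 0)"

text \<open>Extremal pairs give the leading order \<open>n ^ m\<close> without \<beta>; the powers
  of \<beta> come only with \<open>n ^ (m - 1)\<close>.\<close>

lemma sum_walk_weight_le:
  assumes m: "m \<ge> 1" and n: "n \<ge> m" and \<beta>: "\<beta> \<ge> 1"
  shows "(\<Sum>w\<in>{..<2 * m} \<rightarrow>\<^sub>E {..<n}. walk_weight m \<beta> w) \<le>
     real ((m + 1) * (2 * m * (2 * m))) * real n ^ m + real n ^ (m - 1) * (real m * \<beta>) ^ (2 * m)"
proof -
  let ?W = "{..<2 * m} \<rightarrow>\<^sub>E {..<n}"
  have fin: "finite ?W" by (intro finite_PiE) auto
  have "walk_weight m \<beta> w \<le> (if deterministic m w then 1 else 0) +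
      (if card (w ` {..<2 * m}) < m then \<beta> ^ (2 * m) else 0)" for w
  proof (cases "doubled m w")
    case True
    show ?thesis
    proof (cases "card (w ` {..<2 * m}) = m")
      case c: True
      have "deterministic m w" unfolding deterministic_def using c extremal_successor[OF True c] by blast
      then show ?thesis using c by (simp add: walk_weight_def)
    next
      case False
      then have "card (w ` {..<2 * m}) < m" using card_vertices_le[OF True] by simp
      then show ?thesis using True by (simp add: walk_weight_def)
    qed
  qed (use \<beta> in \<open>simp add: walk_weight_def\<close>)
  then have "(\<Sum>w\<in>?W. walk_weight m \<beta> w) \<le> (\<Sum>w\<in>?W. (if deterministic m w then 1 else 0) +
      (if card (w ` {..<2 * m}) < m then \<beta> ^ (2 * m) else 0))"
    by (rule sum_mono)
  also have "\<dots> = real (card {w \<in> ?W. deterministic m w}) +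
      real (card {w \<in> ?W. card (w ` {..<2 * m}) < m}) * \<beta> ^ (2 * m)"
    using fin by (simp add: sum.distrib sum.inter_filter[symmetric])
  also have "\<dots> \<le> real ((m + 1) * (2 * m * (2 * m) * n ^ m)) + real (n ^ (m - 1) * m ^ (2 * m)) * \<beta> ^ (2 * m)"
    using card_deterministic_le[OF m, of n] card_few_vertices_le[OF m n] \<beta>
    by (intro add_mono mult_right_mono) (simp_all only: of_nat_le_iff, simp)
  finally show ?thesis by (simp add: power_mult_distrib algebra_simps)
qed

text \<open>For \<open>m \<ge> 1\<close> this is the trace of the \<open>m\<close>-th power of the
  matrix with entries \<open>x\<close>, shown in \<open>trace_pow_mat\<close>.\<close>

definition walk_sum :: "nat \<Rightarrow> nat \<Rightarrow> (nat \<times> nat \<Rightarrow> complex) \<Rightarrow> complex" where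
  "walk_sum n m x = (\<Sum>w\<in>{..<m} \<rightarrow>\<^sub>E {..<n}. \<Prod>t<m. x (w t, w (if Suc t = m then 0 else Suc t)))"

text \<open>The two walks in succession; \<open>restrict\<close> makes the result extensional, so
  that it belongs to the function space over which \<open>walk_weight\<close> is summed.\<close>

definition join :: "nat \<Rightarrow> (nat \<Rightarrow> nat) \<Rightarrow> (nat \<Rightarrow> nat) \<Rightarrow> nat \<Rightarrow> nat" where
  "join m \<phi> \<psi> = restrict (\<lambda>p. if p < m then \<phi> p else \<psi> (p - m)) {..<2 * m}"

abbreviation conj_after :: "nat \<Rightarrow> nat \<Rightarrow> complex \<Rightarrow> complex" where
  "conj_after m p y \<equiv> (if p < m then y else cnj y)"

lemma prod_lessThan_add:
  fixes h :: "nat \<Rightarrow> complex"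
  shows "(\<Prod>p<m + k. h p) = (\<Prod>p<m. h p) * (\<Prod>t<k. h (m + t))"
  by (induction k) (simp_all add: mult_ac)

lemma norm_square_walk_sum:
  assumes m: "m \<ge> 1"
  shows "complex_of_real ((cmod (walk_sum n m x))\<^sup>2) = (\<Sum>(\<phi>, \<psi>)\<in>({..<m} \<rightarrow>\<^sub>E {..<n}) \<times> ({..<m} \<rightarrow>\<^sub>E {..<n}).
     \<Prod>p<2 * m. conj_after m p (x (edge m (join m \<phi> \<psi>) p)))"
proof -
  let ?W = "{..<m} \<rightarrow>\<^sub>E {..<n}" and ?s = "\<lambda>t. if Suc t = m then 0 else Suc t"
  have eq: "(\<Prod>t<m. x (\<phi> t, \<phi> (?s t))) * cnj (\<Prod>t<m. x (\<psi> t, \<psi> (?s t))) =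
     (\<Prod>p<2 * m. conj_after m p (x (edge m (join m \<phi> \<psi>) p)))" for \<phi> \<psi>
  proof -
    have 1: "edge m (join m \<phi> \<psi>) p = (\<phi> p, \<phi> (?s p))" if "p < m" for p
      using that by (auto simp: edge_def join_def next_pos_def)
    have 2: "edge m (join m \<phi> \<psi>) (m + t) = (\<psi> t, \<psi> (?s t))" if "t < m" for t
      using that by (auto simp: edge_def join_def next_pos_def)
    have "(\<Prod>p<2 * m. conj_after m p (x (edge m (join m \<phi> \<psi>) p))) =
       (\<Prod>p<m. conj_after m p (x (edge m (join m \<phi> \<psi>) p))) *
       (\<Prod>t<m. conj_after m (m + t) (x (edge m (join m \<phi> \<psi>) (m + t))))"
      unfolding mult_2 by (rule prod_lessThan_add)
    also have "(\<Prod>p<m. conj_after m p (x (edge m (join m \<phi> \<psi>) p))) = (\<Prod>t<m. x (\<phi> t, \<phi> (?s t)))"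
      by (rule prod.cong[OF refl]) (use 1 in simp)
    also have "(\<Prod>t<m. conj_after m (m + t) (x (edge m (join m \<phi> \<psi>) (m + t)))) = cnj (\<Prod>t<m. x (\<psi> t, \<psi> (?s t)))"
      unfolding cnj_prod by (rule prod.cong[OF refl]) (use 2 in simp)
    finally show ?thesis by (rule sym)
  qed
  have "complex_of_real ((cmod (walk_sum n m x))\<^sup>2) = walk_sum n m x * cnj (walk_sum n m x)"
    by (rule complex_norm_square)
  also have "\<dots> = (\<Sum>\<phi>\<in>?W. \<Sum>\<psi>\<in>?W. (\<Prod>t<m. x (\<phi> t, \<phi> (?s t))) * cnj (\<Prod>t<m. x (\<psi> t, \<psi> (?s t))))"
    unfolding walk_sum_def cnj_sum by (rule sum_product)
  also have "\<dots> = (\<Sum>\<phi>\<in>?W. \<Sum>\<psi>\<in>?W. \<Prod>p<2 * m. conj_after m p (x (edge m (join m \<phi> \<psi>) p)))"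
    by (simp only: eq)
  also have "\<dots> = (\<Sum>(\<phi>, \<psi>)\<in>?W \<times> ?W. \<Prod>p<2 * m. conj_after m p (x (edge m (join m \<phi> \<psi>) p)))"
    by (rule sum.cartesian_product)
  finally show ?thesis .
qed

lemma join_in_PiE:
  assumes "\<phi> \<in> {..<m} \<rightarrow>\<^sub>E {..<n}" "\<psi> \<in> {..<m} \<rightarrow>\<^sub>E {..<n}"
  shows "join m \<phi> \<psi> \<in> {..<2 * m} \<rightarrow>\<^sub>E {..<n}"
proof (rule PiE_I)
  fix p assume p: "p \<in> {..<2 * m}"
  show "join m \<phi> \<psi> p \<in> {..<n}"
  proof (cases "p < m")
    case True
    then have "\<phi> p \<in> {..<n}" by (intro PiE_mem[OF assms(1)]) simp
    then show ?thesis using True p by (simp add: join_def)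
  next
    case False
    then have "\<psi> (p - m) \<in> {..<n}" using p by (intro PiE_mem[OF assms(2)]) auto
    then show ?thesis using False p by (simp add: join_def)
  qed
qed (simp add: join_def)

lemma inj_on_join:
  "inj_on (\<lambda>(\<phi>, \<psi>). join m \<phi> \<psi>) (({..<m} \<rightarrow>\<^sub>E {..<n}) \<times> ({..<m} \<rightarrow>\<^sub>E {..<n}))"
proof (rule inj_onI)
  fix s t assume s: "s \<in> ({..<m} \<rightarrow>\<^sub>E {..<n}) \<times> ({..<m} \<rightarrow>\<^sub>E {..<n})"
    and t: "t \<in> ({..<m} \<rightarrow>\<^sub>E {..<n}) \<times> ({..<m} \<rightarrow>\<^sub>E {..<n})"
    and e: "(case s of (\<phi>, \<psi>) \<Rightarrow> join m \<phi> \<psi>) = (case t of (\<phi>, \<psi>) \<Rightarrow> join m \<phi> \<psi>)"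
  obtain \<phi> \<psi> \<phi>' \<psi>' where st: "s = (\<phi>, \<psi>)" "t = (\<phi>', \<psi>')" by (metis surj_pair)
  have e: "join m \<phi> \<psi> p = join m \<phi>' \<psi>' p" for p using e by (simp add: st)
  have P: "\<phi> \<in> {..<m} \<rightarrow>\<^sub>E {..<n}" "\<psi> \<in> {..<m} \<rightarrow>\<^sub>E {..<n}" "\<phi>' \<in> {..<m} \<rightarrow>\<^sub>E {..<n}" "\<psi>' \<in> {..<m} \<rightarrow>\<^sub>E {..<n}"
    using s t by (simp_all add: st)
  have "\<phi> = \<phi>'"
  proof (rule PiE_ext[OF P(1,3)])
    fix p assume "p \<in> {..<m}"
    then show "\<phi> p = \<phi>' p" using e[of p] by (simp add: join_def)
  qed
  moreover have "\<psi> = \<psi>'"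
  proof (rule PiE_ext[OF P(2,4)])
    fix p assume "p \<in> {..<m}"
    then show "\<psi> p = \<psi>' p" using e[of "m + p"] by (simp add: join_def)
  qed
  ultimately show "s = t" by (simp add: st)
qed

lemma walk_sum_scale: "walk_sum n m (\<lambda>e. a * x e) = a ^ m * walk_sum n m x"
  by (simp add: walk_sum_def prod.distrib sum_distrib_left)

context iid_array
begin

text \<open>Independence factors the expectation over the different edges. In the extremal case each
  factor is bounded by the mean of the squared modulus, whichever of the two occurrences is
  conjugated.\<close>

lemma expectation_walk:
  assumes f: "f \<in> borel_measurable borel" "\<And>z. cmod (f z) \<le> \<beta>" "(LINT z|\<mu>. f z) = 0"
    "(LINT z|\<mu>. (cmod (f z))\<^sup>2) \<le> 1" and \<beta>: "\<beta> \<ge> 1" and w: "w \<in> {..<2 * m} \<rightarrow>\<^sub>E {..<n}"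
  shows "integrable M (\<lambda>\<omega>. \<Prod>p<2 * m. conj_after m p (f (Y (edge m w p) \<omega>)))" (is ?I)
    and "cmod (expectation (\<lambda>\<omega>. \<Prod>p<2 * m. conj_after m p (f (Y (edge m w p) \<omega>)))) \<le> walk_weight m \<beta> w" (is ?N)
proof -
  interpret mu: prob_space \<mu> by (rule prob_mu)
  let ?P = "{..<2 * m}" and ?e = "edge m w"
  let ?A = "?e ` ?P"
  \<comment> \<open>\<open>h a\<close> gathers all occurrences of the edge \<open>a\<close>,
    conjugated or not, as a function of the one matrix entry at \<open>a\<close>.\<close>
  define h where "h = (\<lambda>a y. \<Prod>p\<in>{p \<in> ?P. ?e p = a}. conj_after m p (f y))"
  have eq: "(\<Prod>p<2 * m. conj_after m p (f (Y (?e p) \<omega>))) = (\<Prod>a\<in>?A. h a (Y a \<omega>))" for \<omega>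
    unfolding h_def by (subst prod.image_gen[of _ _ ?e]) (auto intro!: prod.cong)
  have AE: "?A \<subseteq> E"
  proof
    fix a assume "a \<in> ?A"
    then obtain p where p: "p < 2 * m" "a = ?e p" by auto
    have "w p \<in> {..<n}" "w (next_pos m p) \<in> {..<n}"
      by (rule PiE_mem[OF w], use p next_pos_less in simp)+
    then show "a \<in> E" by (simp add: p edge_def)
  qed
  have norm_h: "cmod (h a y) = cmod (f y) ^ card {p \<in> ?P. ?e p = a}" for a y
  proof -
    have "cmod (h a y) = (\<Prod>p\<in>{p \<in> ?P. ?e p = a}. cmod (f y))"
      unfolding h_def prod_norm[symmetric] by (intro prod.cong) auto
    then show ?thesis by simp
  qed
  have fm: "f \<in> borel_measurable \<mu>" using f(1) by (simp add: measurable_mu_iff)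
  have "cnj \<in> borel_measurable borel"
    by (intro borel_measurable_continuous_onI continuous_intros)
  from measurable_compose[OF fm this] have cfm: "(\<lambda>y. cnj (f y)) \<in> borel_measurable \<mu>" .
  have hm: "h a \<in> borel_measurable \<mu>" for a
    unfolding h_def by (intro borel_measurable_prod) (use fm cfm in auto)
  have hb: "cmod (h a y) \<le> \<beta> ^ card {p \<in> ?P. ?e p = a}" for a y
    unfolding norm_h by (intro power_mono f(2)) auto
  have hi: "integrable \<mu> (h a)" for a
    by (rule mu.integrable_const_bound[OF AE_I2[OF hb] hm])
  show ?I unfolding eq by (rule expectation_prod(1)[OF AE hi])
  have "expectation (\<lambda>\<omega>. \<Prod>p<2 * m. conj_after m p (f (Y (?e p) \<omega>))) = (\<Prod>a\<in>?A. LINT y|\<mu>. h a y)"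
    unfolding eq by (rule expectation_prod(2)[OF AE hi])
  then have N: "cmod (expectation (\<lambda>\<omega>. \<Prod>p<2 * m. conj_after m p (f (Y (?e p) \<omega>)))) =
     (\<Prod>a\<in>?A. cmod (LINT y|\<mu>. h a y))" by (simp add: prod_norm)
  have le: "cmod (LINT y|\<mu>. h a y) \<le> (LINT y|\<mu>. cmod (h a y))" for a
    by (rule integral_norm_bound)
  consider (single) "\<not> doubled m w" | (extremal) "doubled m w" "card (w ` ?P) = m"
    | (few) "doubled m w" "card (w ` ?P) \<noteq> m" by blast
  then show ?N
  proof cases
    case single
    then obtain p where p: "p < 2 * m" "\<And>p'. p' < 2 * m \<Longrightarrow> p' \<noteq> p \<Longrightarrow> ?e p' \<noteq> ?e p"
      unfolding doubled_def by blast
    have "{p' \<in> ?P. ?e p' = ?e p} = {p}" using p by auto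
    then have "h (?e p) = (\<lambda>y. conj_after m p (f y))" by (simp add: h_def fun_eq_iff)
    then have "(LINT y|\<mu>. h (?e p) y) = 0" using f(3) by (cases "p < m") auto
    then have "cmod (LINT y|\<mu>. h (?e p) y) = 0" by (simp only: norm_zero)
    moreover have "?e p \<in> ?A" using p(1) by simp
    ultimately have z: "(\<Prod>a\<in>?A. cmod (LINT y|\<mu>. h a y)) = 0" by (intro prod_zero bexI[of _ "?e p"]) simp_all
    show ?thesis unfolding N z using single by (simp add: walk_weight_def)
  next
    case extremal
    have "(\<Prod>a\<in>?A. cmod (LINT y|\<mu>. h a y)) \<le> (\<Prod>a\<in>?A. 1)"
    proof (rule prod_mono, rule conjI)
      fix a assume "a \<in> ?A"
      then have "card {p \<in> ?P. ?e p = a} = 2" by (rule extremal_fiber[OF extremal])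
      then have "(LINT y|\<mu>. cmod (h a y)) = (LINT z|\<mu>. (cmod (f z))\<^sup>2)" by (simp add: norm_h)
      then show "cmod (LINT y|\<mu>. h a y) \<le> 1" using le[of a] f(4) by simp
    qed simp
    then show ?thesis unfolding N using extremal by (simp add: walk_weight_def)
  next
    case few
    have "(\<Prod>a\<in>?A. cmod (LINT y|\<mu>. h a y)) \<le> (\<Prod>a\<in>?A. \<beta> ^ card {p \<in> ?P. ?e p = a})"
    proof (rule prod_mono, rule conjI)
      fix a
      have "(LINT y|\<mu>. cmod (h a y)) \<le> (LINT y|\<mu>. \<beta> ^ card {p \<in> ?P. ?e p = a})"
        by (rule integral_mono) (use hi hb in auto)
      also have "\<dots> = \<beta> ^ card {p \<in> ?P. ?e p = a}" by (simp add: mu.prob_space)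
      finally show "cmod (LINT y|\<mu>. h a y) \<le> \<beta> ^ card {p \<in> ?P. ?e p = a}"
        by (rule order_trans[OF le])
    qed simp
    also have "\<dots> = \<beta> ^ (2 * m)"
      by (subst power_sum[symmetric], subst card_fibers_sum) auto
    finally show ?thesis unfolding N using few by (simp add: walk_weight_def)
  qed
qed

lemma second_moment_walk_sum_unscaled:
  assumes f: "f \<in> borel_measurable borel" "\<And>z. cmod (f z) \<le> \<beta>" "(LINT z|\<mu>. f z) = 0"
    "(LINT z|\<mu>. (cmod (f z))\<^sup>2) \<le> 1" and \<beta>: "\<beta> \<ge> 1" and m: "m \<ge> 1"
    and n_large: "n \<ge> m" "real n \<ge> (real m * \<beta>) ^ (2 * m)"
  shows "integrable M (\<lambda>\<omega>. (cmod (walk_sum n m (\<lambda>e. f (Y e \<omega>))))\<^sup>2)"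
    and "expectation (\<lambda>\<omega>. (cmod (walk_sum n m (\<lambda>e. f (Y e \<omega>))))\<^sup>2) \<le> (3 * (real m)\<^sup>2)\<^sup>2 * real n ^ m"
proof -
  let ?W = "({..<m} \<rightarrow>\<^sub>E {..<n}) \<times> ({..<m} \<rightarrow>\<^sub>E {..<n})"
  let ?h = "\<lambda>w \<omega>. \<Prod>p<2 * m. conj_after m p (f (Y (edge m w p) \<omega>))"
  let ?S = "\<lambda>\<omega>. walk_sum n m (\<lambda>e. f (Y e \<omega>))"
  have finW: "finite ?W" by (intro finite_cartesian_product finite_PiE) auto
  have jW: "join m (fst t) (snd t) \<in> {..<2 * m} \<rightarrow>\<^sub>E {..<n}" if "t \<in> ?W" for t
    using that unfolding mem_Times_iff by (intro join_in_PiE) (rule conjunct1, assumption, rule conjunct2, assumption)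
  have I1: "integrable M (?h (join m (fst t) (snd t)))" if "t \<in> ?W" for t
    by (rule expectation_walk(1)[OF f \<beta> jW[OF that]])
  have eq: "complex_of_real ((cmod (?S \<omega>))\<^sup>2) = (\<Sum>t\<in>?W. ?h (join m (fst t) (snd t)) \<omega>)" for \<omega>
    unfolding norm_square_walk_sum[OF m] by (simp only: case_prod_unfold)
  have "integrable M (\<lambda>\<omega>. complex_of_real ((cmod (?S \<omega>))\<^sup>2))"
    unfolding eq by (rule Bochner_Integration.integrable_sum[OF I1])
  from integrable_Re[OF this] have I2: "integrable M (\<lambda>\<omega>. (cmod (?S \<omega>))\<^sup>2)"
    by (simp only: Re_complex_of_real)
  have "expectation (\<lambda>\<omega>. complex_of_real ((cmod (?S \<omega>))\<^sup>2)) = (\<Sum>t\<in>?W. expectation (?h (join m (fst t) (snd t))))"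
    unfolding eq
    by (rule Bochner_Integration.integral_sum[OF I1])
  then have r: "complex_of_real (expectation (\<lambda>\<omega>. (cmod (?S \<omega>))\<^sup>2)) = (\<Sum>t\<in>?W. expectation (?h (join m (fst t) (snd t))))"
    unfolding Bochner_Integration.integral_complex_of_real .
  have i1: "expectation (\<lambda>\<omega>. (cmod (?S \<omega>))\<^sup>2) \<le> cmod (\<Sum>t\<in>?W. expectation (?h (join m (fst t) (snd t))))"
    unfolding r[symmetric] norm_of_real by (rule abs_ge_self)
  have i2: "cmod (\<Sum>t\<in>?W. expectation (?h (join m (fst t) (snd t)))) \<le>
      (\<Sum>t\<in>?W. cmod (expectation (?h (join m (fst t) (snd t)))))"
    by (rule norm_sum)
  have i3: "(\<Sum>t\<in>?W. cmod (expectation (?h (join m (fst t) (snd t))))) \<le>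
      (\<Sum>t\<in>?W. walk_weight m \<beta> (join m (fst t) (snd t)))"
    by (rule sum_mono) (rule expectation_walk(2)[OF f \<beta> jW])
  have i4: "(\<Sum>t\<in>?W. walk_weight m \<beta> (join m (fst t) (snd t))) =
      (\<Sum>w\<in>(\<lambda>(\<phi>, \<psi>). join m \<phi> \<psi>) ` ?W. walk_weight m \<beta> w)"
    unfolding sum.reindex[OF inj_on_join] by (simp only: case_prod_unfold o_def)
  have i5: "(\<Sum>w\<in>(\<lambda>(\<phi>, \<psi>). join m \<phi> \<psi>) ` ?W. walk_weight m \<beta> w) \<le>
      (\<Sum>w\<in>{..<2 * m} \<rightarrow>\<^sub>E {..<n}. walk_weight m \<beta> w)"
  proof (rule sum_mono2)
    show "finite ({..<2 * m} \<rightarrow>\<^sub>E {..<n})" by (intro finite_PiE finite_lessThan)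
    show "(\<lambda>(\<phi>, \<psi>). join m \<phi> \<psi>) ` ?W \<subseteq> {..<2 * m} \<rightarrow>\<^sub>E {..<n}"
      by (rule image_subsetI) (simp only: case_prod_unfold jW)
    show "0 \<le> walk_weight m \<beta> w" for w using \<beta> by (simp add: walk_weight_def)
  qed
  have i6: "(\<Sum>w\<in>{..<2 * m} \<rightarrow>\<^sub>E {..<n}. walk_weight m \<beta> w) \<le>
      real ((m + 1) * (2 * m * (2 * m))) * real n ^ m + real n ^ (m - 1) * (real m * \<beta>) ^ (2 * m)"
    by (rule sum_walk_weight_le[OF m n_large(1) \<beta>])
  \<comment> \<open>The size condition on \<open>n\<close> trades all powers of \<beta> for a single
    factor \<open>n\<close>, which brings the remainder to the order of the leading term.\<close>
  have i7: "\<dots> \<le> real ((m + 1) * (2 * m * (2 * m))) * real n ^ m + real n ^ (m - 1) * real n"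
    using n_large(2) by (intro add_left_mono mult_left_mono) simp_all
  have i8: "real ((m + 1) * (2 * m * (2 * m))) * real n ^ m + real n ^ (m - 1) * real n =
      (4 * (real m) ^ 3 + 4 * (real m)\<^sup>2 + 1) * real n ^ m"
  proof -
    obtain k where k: "m = Suc k" using m by (cases m) simp_all
    have "real n ^ (m - 1) * real n = real n ^ m" by (simp add: k)
    then show ?thesis by (simp add: distrib_right power2_eq_square power3_eq_cube)
  qed
  \<comment> \<open>Since \<open>m \<ge> 1\<close>, the coefficients \<open>4 + 4 + 1 = 9\<close>
    multiply at most \<open>m ^ 4\<close>. The square form is chosen because its root bounds the
    mean modulus.\<close>
  have i9: "(4 * (real m) ^ 3 + 4 * (real m)\<^sup>2 + 1) * real n ^ m \<le> (3 * (real m)\<^sup>2)\<^sup>2 * real n ^ m"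
  proof (rule mult_right_mono)
    have m1: "real m \<ge> 1" using m by simp
    have "real m ^ 3 \<le> real m ^ 4" "real m ^ 2 \<le> real m ^ 4" "1 \<le> real m ^ 4"
      using m1 by (intro power_increasing one_le_power; simp)+
    then show "4 * (real m) ^ 3 + 4 * (real m)\<^sup>2 + 1 \<le> (3 * (real m)\<^sup>2)\<^sup>2"
      by (simp add: power_mult_distrib)
  qed simp
  show "expectation (\<lambda>\<omega>. (cmod (?S \<omega>))\<^sup>2) \<le> (3 * (real m)\<^sup>2)\<^sup>2 * real n ^ m"
    by (rule order_trans[OF i1 order_trans[OF i2 order_trans[OF i3
      order_trans[OF eq_refl[OF i4] order_trans[OF i5 order_trans[OF i6
      order_trans[OF i7 order_trans[OF eq_refl[OF i8] i9]]]]]]]])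
  show "integrable M (\<lambda>\<omega>. (cmod (?S \<omega>))\<^sup>2)" by (rule I2)
qed

text \<open>Only \<open>m\<close> is left in the bound: \<beta> has moved into the condition on
  \<open>n\<close>. This allows the truncation level to be fixed after the bounds for the power
  sums.\<close>

lemma second_moment_walk_sum:
  assumes f: "f \<in> borel_measurable borel" "\<And>z. cmod (f z) \<le> \<beta>" "(LINT z|\<mu>. f z) = 0"
    "(LINT z|\<mu>. (cmod (f z))\<^sup>2) \<le> 1" and \<beta>: "\<beta> \<ge> 1" and m: "m \<ge> 1"
    and n_large: "n \<ge> m" "real n \<ge> (real m * \<beta>) ^ (2 * m)"
  defines "x \<equiv> \<lambda>\<omega> e. f (Y e \<omega>) / sqrt (real n)"
  shows "integrable M (\<lambda>\<omega>. (cmod (walk_sum n m (x \<omega>)))\<^sup>2)"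
    and "expectation (\<lambda>\<omega>. (cmod (walk_sum n m (x \<omega>)))\<^sup>2) \<le> (3 * (real m)\<^sup>2)\<^sup>2"
proof -
  let ?S = "\<lambda>\<omega>. walk_sum n m (\<lambda>e. f (Y e \<omega>))"
  have pos: "0 < real n ^ m" using n by simp
  note U = second_moment_walk_sum_unscaled[OF f \<beta> m n_large]
  have sc: "(cmod (walk_sum n m (x \<omega>)))\<^sup>2 = (cmod (?S \<omega>))\<^sup>2 / real n ^ m" for \<omega>
  proof -
    have "x \<omega> = (\<lambda>e. complex_of_real (1 / sqrt (real n)) * f (Y e \<omega>))" by (simp add: x_def)
    then have "walk_sum n m (x \<omega>) = complex_of_real (1 / sqrt (real n)) ^ m * ?S \<omega>"
      by (simp only: walk_sum_scale)
    then have c1: "cmod (walk_sum n m (x \<omega>)) = (1 / sqrt (real n)) ^ m * cmod (?S \<omega>)"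
      by (simp add: norm_mult norm_power norm_divide)
    have "(cmod (walk_sum n m (x \<omega>)))\<^sup>2 = ((1 / sqrt (real n))\<^sup>2) ^ m * (cmod (?S \<omega>))\<^sup>2"
      unfolding c1 power_mult_distrib power_mult[symmetric] mult.commute[of m 2] by (rule refl)
    then show ?thesis by (simp add: power_divide)
  qed
  show "integrable M (\<lambda>\<omega>. (cmod (walk_sum n m (x \<omega>)))\<^sup>2)" unfolding sc by (intro integrable_divide U(1))
  show "expectation (\<lambda>\<omega>. (cmod (walk_sum n m (x \<omega>)))\<^sup>2) \<le> (3 * (real m)\<^sup>2)\<^sup>2"
    unfolding sc integral_divide_zero by (rule iffD2[OF pos_divide_le_eq[OF pos] U(2)])
qed

end

section \<open>Determinants, eigenvalues and perturbations of finite rank\<close>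

lemma det_one_minus_smult:
  assumes A: "A \<in> carrier_mat n n"
  shows "Determinant.det (1\<^sub>m n - z \<cdot>\<^sub>m A) = (\<Sum>k\<le>n. (-z) ^ k * minor_sum n k (\<lambda>e. A $$ e))"
proof -
  have c: "1\<^sub>m n - z \<cdot>\<^sub>m A \<in> carrier_mat n n" by (intro minus_carrier_mat smult_carrier_mat A)
  have ent: "(1\<^sub>m n - z \<cdot>\<^sub>m A) $$ (i, \<sigma> i) = (if \<sigma> i = i then 1 else 0) - z * A $$ (i, \<sigma> i)"
    if "\<sigma> permutes {..<n}" "i < n" for \<sigma> i
  proof -
    have "\<sigma> i < n" using permutes_in_image[OF that(1), of i] that(2) by simp
    then show ?thesis using A that(2) by simp
  qed
  show ?thesis
    unfolding det_def'[OF c] atLeast0LessThan det_expand[symmetric]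
  proof (rule sum.cong[OF refl])
    fix \<sigma> assume "\<sigma> \<in> {\<sigma>. \<sigma> permutes {..<n}}"
    then have "(\<Prod>i<n. (1\<^sub>m n - z \<cdot>\<^sub>m A) $$ (i, \<sigma> i)) = (\<Prod>i<n. (if \<sigma> i = i then 1 else 0) - z * A $$ (i, \<sigma> i))"
      by (intro prod.cong refl ent) simp_all
    then show "perm_sign \<sigma> * (\<Prod>i<n. (1\<^sub>m n - z \<cdot>\<^sub>m A) $$ (i, \<sigma> i)) =
      perm_sign \<sigma> * (\<Prod>i<n. (if \<sigma> i = i then 1 else 0) - z * A $$ (i, \<sigma> i))" by (simp only:)
  qed
qed

text \<open>Cramer's rule for the solution \<open>y\<close> of the resolvent equation.
  Multiplication by the determinant replaces the rational resolvent by polynomials in the entries,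
  for which second moments are available.\<close>

lemma bilinear_resolvent:
  assumes A: "A \<in> carrier_mat n n" and y: "y \<in> carrier_vec n"
    and yu: "(1\<^sub>m n - z \<cdot>\<^sub>m A) *\<^sub>v y = vec n u"
  shows "((\<Sum>a<n. v a * vec_index y a) - (\<Sum>b<n. u b * v b)) * Determinant.det (1\<^sub>m n - z \<cdot>\<^sub>m A) =
    (\<Sum>k\<le>n. (-z) ^ k * (open_coeff n k u v (\<lambda>e. A $$ e) - closed_coeff n k u v (\<lambda>e. A $$ e)))"
proof -
  let ?R = "1\<^sub>m n - z \<cdot>\<^sub>m A"
  have R: "?R \<in> carrier_mat n n" by (intro minus_carrier_mat smult_carrier_mat A)
  have 1: "vec_index y a * Determinant.det ?R = (\<Sum>\<sigma> | \<sigma> permutes {..<n}. perm_sign \<sigma> *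
     (\<Prod>i<n. if \<sigma> i = a then u i else (if \<sigma> i = i then 1 else 0) - z * A $$ (i, \<sigma> i)))" if a: "a < n" for a
  proof -
    have c: "replace_col ?R (vec n u) a \<in> carrier_mat n n" using A by (intro carrier_matI) (auto simp: replace_col_def)
    have "vec_index y a * Determinant.det ?R = Determinant.det (replace_col ?R (vec n u) a)"
      using cramer_lemma_mat[OF R y a] by (simp only: yu)
    also have "\<dots> = (\<Sum>\<sigma> | \<sigma> permutes {..<n}. perm_sign \<sigma> *
       (\<Prod>i<n. if \<sigma> i = a then u i else (if \<sigma> i = i then 1 else 0) - z * A $$ (i, \<sigma> i)))"
      unfolding det_def'[OF c] atLeast0LessThan
    proof (rule sum.cong[OF refl])
      fix \<sigma> assume "\<sigma> \<in> {\<sigma>. \<sigma> permutes {..<n}}"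
      then have p: "\<sigma> permutes {..<n}" by simp
      have "(\<Prod>i<n. replace_col ?R (vec n u) a $$ (i, \<sigma> i)) =
        (\<Prod>i<n. if \<sigma> i = a then u i else (if \<sigma> i = i then 1 else 0) - z * A $$ (i, \<sigma> i))"
      proof (rule prod.cong[OF refl])
        fix i assume "i \<in> {..<n}"
        then have i: "i < n" "\<sigma> i < n" using permutes_in_image[OF p, of i] by simp_all
        then show "replace_col ?R (vec n u) a $$ (i, \<sigma> i) =
          (if \<sigma> i = a then u i else (if \<sigma> i = i then 1 else 0) - z * A $$ (i, \<sigma> i))"
          using A by (simp add: replace_col_def)
      qed
      then show "perm_sign \<sigma> * (\<Prod>i<n. replace_col ?R (vec n u) a $$ (i, \<sigma> i)) = perm_sign \<sigma> *
        (\<Prod>i<n. if \<sigma> i = a then u i else (if \<sigma> i = i then 1 else 0) - z * A $$ (i, \<sigma> i))" by (simp only:)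
    qed
    finally show ?thesis .
  qed
  have "(\<Sum>a<n. v a * vec_index y a) * Determinant.det ?R = (\<Sum>a<n. v a * (vec_index y a * Determinant.det ?R))"
    by (simp only: sum_distrib_right mult.assoc)
  also have "\<dots> = (\<Sum>a<n. v a * (\<Sum>\<sigma> | \<sigma> permutes {..<n}. perm_sign \<sigma> *
     (\<Prod>i<n. if \<sigma> i = a then u i else (if \<sigma> i = i then 1 else 0) - z * A $$ (i, \<sigma> i))))"
    by (rule sum.cong[OF refl]) (simp only: 1 lessThan_iff)
  finally have 2: "(\<Sum>a<n. v a * vec_index y a) * Determinant.det ?R = \<dots>" .
  show ?thesis
    unfolding left_diff_distrib 2 unfolding cramer_expand[symmetric] det_one_minus_smult[OF A] by (rule refl)
qed

text \<open>The block matrix with identity blocks on the diagonal and \<open>B\<close>,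
  \<open>W\<close> beside them is multiplied by one unipotent block matrix from the right and from
  the left; the two products are block triangular and have the same determinant.\<close>

lemma det_one_minus_mult_commute:
  fixes B W :: "complex mat"
  assumes B: "B \<in> carrier_mat n k" and W: "W \<in> carrier_mat k n"
  shows "Determinant.det (1\<^sub>m n - B * W) = Determinant.det (1\<^sub>m k - W * B)"
proof -
  let ?M = "four_block_mat (1\<^sub>m n) B W (1\<^sub>m k)"
  let ?L = "four_block_mat (1\<^sub>m n) (0\<^sub>m n k) (-W) (1\<^sub>m k)"
  have c: "?M \<in> carrier_mat (n + k) (n + k)" "?L \<in> carrier_mat (n + k) (n + k)" using B W by auto
  have BW: "B * W \<in> carrier_mat n n" "W * B \<in> carrier_mat k k" using B W by auto
  have "?M * ?L = four_block_mat (1\<^sub>m n * 1\<^sub>m n + B * (-W)) (1\<^sub>m n * 0\<^sub>m n k + B * 1\<^sub>m k)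
     (W * 1\<^sub>m n + 1\<^sub>m k * (-W)) (W * 0\<^sub>m n k + 1\<^sub>m k * 1\<^sub>m k)"
    by (rule mult_four_block_mat) (use B W in auto)
  also have "1\<^sub>m n * 1\<^sub>m n + B * (-W) = 1\<^sub>m n - B * W" using B W BW by (auto simp: minus_add_uminus_mat)
  also have "1\<^sub>m n * 0\<^sub>m n k + B * 1\<^sub>m k = B" using B by auto
  also have "W * 1\<^sub>m n + 1\<^sub>m k * (-W) = 0\<^sub>m k n" using W by (intro eq_matI) auto
  also have "W * 0\<^sub>m n k + 1\<^sub>m k * 1\<^sub>m k = 1\<^sub>m k" using W by auto
  finally have prod1: "?M * ?L = four_block_mat (1\<^sub>m n - B * W) B (0\<^sub>m k n) (1\<^sub>m k)" .
  have "?L * ?M = four_block_mat (1\<^sub>m n * 1\<^sub>m n + 0\<^sub>m n k * W) (1\<^sub>m n * B + 0\<^sub>m n k * 1\<^sub>m k)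
     ((-W) * 1\<^sub>m n + 1\<^sub>m k * W) ((-W) * B + 1\<^sub>m k * 1\<^sub>m k)"
    by (rule mult_four_block_mat) (use B W in auto)
  also have "1\<^sub>m n * 1\<^sub>m n + 0\<^sub>m n k * W = 1\<^sub>m n" using W by auto
  also have "1\<^sub>m n * B + 0\<^sub>m n k * 1\<^sub>m k = B" using B by auto
  also have "(-W) * 1\<^sub>m n + 1\<^sub>m k * W = 0\<^sub>m k n" using W by (intro eq_matI) auto
  also have "(-W) * B + 1\<^sub>m k * 1\<^sub>m k = 1\<^sub>m k - W * B"
    using B W BW by (auto intro!: eq_matI)
  finally have prod2: "?L * ?M = four_block_mat (1\<^sub>m n) B (0\<^sub>m k n) (1\<^sub>m k - W * B)" .
  have "Determinant.det (?M * ?L) = Determinant.det (?L * ?M)"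
    unfolding det_mult[OF c] det_mult[OF c(2,1)] by (rule mult.commute)
  moreover have "Determinant.det (?M * ?L) = Determinant.det (1\<^sub>m n - B * W) * Determinant.det (1\<^sub>m k :: complex mat)"
    unfolding prod1 by (rule det_four_block_mat_lower_left_zero[OF minus_carrier_mat[OF BW(1)] B refl one_carrier_mat])
  moreover have "Determinant.det (?L * ?M) = Determinant.det (1\<^sub>m n :: complex mat) * Determinant.det (1\<^sub>m k - W * B)"
    unfolding prod2 by (rule det_four_block_mat_lower_left_zero[OF one_carrier_mat B refl minus_carrier_mat[OF BW(2)]])
  ultimately show ?thesis by simp
qed

text \<open>Sylvester's identity reduces the perturbed determinant to a determinant of fixed size \<open>k\<close>.\<close>

lemma det_low_rank_perturbation:
  assumes A: "A \<in> carrier_mat n n" and U: "U \<in> carrier_mat n k" and W: "W \<in> carrier_mat k n"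
    and nz: "Determinant.det (1\<^sub>m n - z \<cdot>\<^sub>m A) \<noteq> 0"
  shows "\<exists>G \<in> carrier_mat k k.
    Determinant.det (1\<^sub>m n - z \<cdot>\<^sub>m (A + U * W)) = Determinant.det (1\<^sub>m n - z \<cdot>\<^sub>m A) * Determinant.det (1\<^sub>m k - z \<cdot>\<^sub>m G) \<and>
    (\<forall>i<k. \<forall>j<k. (G $$ (i, j) - (W * U) $$ (i, j)) * Determinant.det (1\<^sub>m n - z \<cdot>\<^sub>m A) =
       (\<Sum>l\<le>n. (-z) ^ l * (open_coeff n l (\<lambda>a. U $$ (a, j)) (\<lambda>a. W $$ (i, a)) (\<lambda>e. A $$ e) -
          closed_coeff n l (\<lambda>a. U $$ (a, j)) (\<lambda>a. W $$ (i, a)) (\<lambda>e. A $$ e))))"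
proof -
  let ?R = "1\<^sub>m n - z \<cdot>\<^sub>m A"
  have R: "?R \<in> carrier_mat n n" by (intro minus_carrier_mat smult_carrier_mat A)
  \<comment> \<open>The inverse of \<open>1 - z A\<close>, written with the adjugate matrix.\<close>
  define N where "N = (1 / Determinant.det ?R) \<cdot>\<^sub>m adj_mat ?R"
  have N: "N \<in> carrier_mat n n" using adj_mat(1)[OF R] by (simp add: N_def)
  have RN: "?R * N = 1\<^sub>m n"
  proof -
    have "?R * N = (1 / Determinant.det ?R) \<cdot>\<^sub>m (?R * adj_mat ?R)"
      unfolding N_def by (rule mult_smult_distrib[OF R adj_mat(1)[OF R]])
    also have "\<dots> = 1\<^sub>m n" unfolding adj_mat(2)[OF R] using nz by (intro eq_matI) auto
    finally show ?thesis .
  qed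
  define B where "B = N * U"
  have B: "B \<in> carrier_mat n k" using N U by (simp add: B_def)
  have RB: "?R * B = U" unfolding B_def using assoc_mult_mat[OF R N U] RN U by simp
  have UW: "U * W \<in> carrier_mat n n" using U W by simp
  have BW: "B * W \<in> carrier_mat n n" using B W by simp
  have zBW: "(z \<cdot>\<^sub>m B) * W = z \<cdot>\<^sub>m (B * W)" by (rule mult_smult_assoc_mat[OF B W])
  have "1\<^sub>m n - z \<cdot>\<^sub>m (A + U * W) = ?R * (1\<^sub>m n - (z \<cdot>\<^sub>m B) * W)"
  proof -
    have "?R * (1\<^sub>m n - (z \<cdot>\<^sub>m B) * W) = ?R * 1\<^sub>m n - ?R * ((z \<cdot>\<^sub>m B) * W)"
      by (rule mult_minus_distrib_mat[OF R]) (use B W in auto)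
    also have "?R * ((z \<cdot>\<^sub>m B) * W) = z \<cdot>\<^sub>m (?R * (B * W))"
      unfolding zBW by (rule mult_smult_distrib[OF R BW])
    also have "?R * (B * W) = U * W" using assoc_mult_mat[OF R B W] RB by simp
    finally show ?thesis using A U W by (auto intro!: eq_matI simp: algebra_simps)
  qed
  then have "Determinant.det (1\<^sub>m n - z \<cdot>\<^sub>m (A + U * W)) = Determinant.det ?R * Determinant.det (1\<^sub>m n - (z \<cdot>\<^sub>m B) * W)"
    using det_mult[OF R minus_carrier_mat[of "(z \<cdot>\<^sub>m B) * W" n n "1\<^sub>m n"]] BW unfolding zBW
    by (metis smult_carrier_mat)
  also have "Determinant.det (1\<^sub>m n - (z \<cdot>\<^sub>m B) * W) = Determinant.det (1\<^sub>m k - W * (z \<cdot>\<^sub>m B))"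
    by (rule det_one_minus_mult_commute[OF smult_carrier_mat[OF B] W])
  also have "W * (z \<cdot>\<^sub>m B) = z \<cdot>\<^sub>m (W * B)" by (rule mult_smult_distrib[OF W B])
  finally have d: "Determinant.det (1\<^sub>m n - z \<cdot>\<^sub>m (A + U * W)) = Determinant.det ?R * Determinant.det (1\<^sub>m k - z \<cdot>\<^sub>m (W * B))" .
  show ?thesis
  \<comment> \<open>\<open>B\<close> is the resolvent applied to \<open>U\<close>, so the entries of
    \<open>W * B\<close> are bilinear forms of the resolvent in a row of \<open>W\<close> and a
    column of \<open>U\<close>.\<close>
  proof (intro bexI[of _ "W * B"] conjI allI impI)
    fix i j assume i: "i < k" and j: "j < k"
    have cB: "Matrix.col B j \<in> carrier_vec n" using B j by auto
    have "?R *\<^sub>v Matrix.col B j = Matrix.col (?R * B) j" by (rule col_mult2[OF R B j, symmetric])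
    also have "\<dots> = vec n (\<lambda>a. U $$ (a, j))" unfolding RB using U j by (intro eq_vecI) auto
    finally have y: "?R *\<^sub>v Matrix.col B j = vec n (\<lambda>a. U $$ (a, j))" .
    have e1: "(W * B) $$ (i, j) = (\<Sum>a<n. W $$ (i, a) * vec_index (Matrix.col B j) a)"
      using W B i j by (simp add: scalar_prod_def atLeast0LessThan)
    have e2: "(W * U) $$ (i, j) = (\<Sum>b<n. U $$ (b, j) * W $$ (i, b))"
      using W U i j by (simp add: scalar_prod_def atLeast0LessThan mult.commute)
    show "((W * B) $$ (i, j) - (W * U) $$ (i, j)) * Determinant.det ?R =
       (\<Sum>l\<le>n. (-z) ^ l * (open_coeff n l (\<lambda>a. U $$ (a, j)) (\<lambda>a. W $$ (i, a)) (\<lambda>e. A $$ e) -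
          closed_coeff n l (\<lambda>a. U $$ (a, j)) (\<lambda>a. W $$ (i, a)) (\<lambda>e. A $$ e)))"
      unfolding e1 e2 by (rule bilinear_resolvent[OF A cB y])
  qed (use d W B in auto)
qed

section \<open>Eigenvalues, traces of powers and Newton's recursion\<close>

lemma char_poly_eigenvalues:
  assumes A: "A \<in> carrier_mat n n"
  shows "char_poly A = (\<Prod>x\<in>#eigenvalue_mset A. [:- x, 1:])" "size (eigenvalue_mset A) = n"
proof -
  have d: "degree (char_poly A) = n" "coeff (char_poly A) n = 1" using degree_monic_char_poly[OF A] by auto
  show "char_poly A = (\<Prod>x\<in>#eigenvalue_mset A. [:- x, 1:])"
    using complex_poly_decompose_multiset[of "char_poly A"] d by (simp add: eigenvalue_mset_def)
  show "size (eigenvalue_mset A) = n" using size_proots_complex[of "char_poly A"] d by (simp add: eigenvalue_mset_def)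
qed

text \<open>Away from \<open>z = 0\<close> the determinant is the reversed characteristic polynomial
  \<open>z ^ n * poly (char_poly A) (1 / z)\<close>.\<close>

lemma det_one_minus_eigenvalues:
  assumes A: "A \<in> carrier_mat n n"
  shows "Determinant.det (1\<^sub>m n - z \<cdot>\<^sub>m A) = (\<Prod>x\<in>#eigenvalue_mset A. 1 - z * x)"
proof (cases "z = 0")
  case True
  then have "1\<^sub>m n - z \<cdot>\<^sub>m A = 1\<^sub>m n" using A by (intro eq_matI) auto
  then show ?thesis using True by simp
next
  case False
  have "z \<cdot>\<^sub>m (- (char_matrix A (1 / z))) = 1\<^sub>m n - z \<cdot>\<^sub>m A"
    using A False by (intro eq_matI) (auto simp: char_matrix_def algebra_simps)
  then have "Determinant.det (1\<^sub>m n - z \<cdot>\<^sub>m A) = z ^ n * poly (char_poly A) (1 / z)"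
    using Determinant.det_smult[of z "- (char_matrix A (1 / z))"] char_poly_matrix[OF A, of "1 / z"] A
    by (simp add: char_matrix_def)
  also have "poly (char_poly A) (1 / z) = (\<Prod>x\<in>#eigenvalue_mset A. 1 / z - x)"
    unfolding char_poly_eigenvalues(1)[OF A] by (simp add: poly_prod_mset image_mset.compositionality o_def)
  also have "z ^ n * \<dots> = (\<Prod>x\<in>#eigenvalue_mset A. z * (1 / z - x))"
    using char_poly_eigenvalues(2)[OF A] by (simp add: prod_mset.distrib)
  also have "(\<lambda>x. z * (1 / z - x)) = (\<lambda>x. 1 - z * x)" using False by (auto simp: field_simps)
  finally show ?thesis .
qed

lemma sum_PiE_Suc:
  fixes h :: "(nat \<Rightarrow> nat) \<Rightarrow> complex"
  shows "(\<Sum>w\<in>{..<Suc k} \<rightarrow>\<^sub>E {..<n}. h w) = (\<Sum>l<n. \<Sum>w\<in>{..<k} \<rightarrow>\<^sub>E {..<n}. h (w(k := l)))"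
proof -
  have "inj_on (\<lambda>(y, g). g(k := y)) ({..<n} \<times> ({..<k} \<rightarrow>\<^sub>E {..<n}))"
    by (rule inj_combinator) simp
  then have "(\<Sum>w\<in>{..<Suc k} \<rightarrow>\<^sub>E {..<n}. h w) = (\<Sum>t\<in>{..<n} \<times> ({..<k} \<rightarrow>\<^sub>E {..<n}). h ((snd t)(k := fst t)))"
    unfolding lessThan_Suc PiE_insert_eq by (simp only: sum.reindex o_def case_prod_unfold)
  also have "\<dots> = (\<Sum>l<n. \<Sum>w\<in>{..<k} \<rightarrow>\<^sub>E {..<n}. h (w(k := l)))"
    unfolding sum.cartesian_product by (simp only: case_prod_unfold)
  finally show ?thesis .
qed

text \<open>\<open>w\<close> lists the \<open>k\<close> intermediate vertices of a walk from
  \<open>i\<close> to \<open>j\<close>.\<close>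

lemma pow_mat_entry:
  fixes A :: "complex mat"
  assumes A: "A \<in> carrier_mat n n" and i: "i < n" and j: "j < n"
  shows "(A ^\<^sub>m Suc k) $$ (i, j) = (\<Sum>w\<in>{..<k} \<rightarrow>\<^sub>E {..<n}.
     \<Prod>t<Suc k. A $$ (if t = 0 then i else w (t - 1), if t = k then j else w t))"
  using j
proof (induction k arbitrary: j)
  case 0
  have "A ^\<^sub>m Suc 0 = A" using A by simp
  then show ?case by simp
next
  case (Suc k)
  have P: "A ^\<^sub>m Suc k \<in> carrier_mat n n" by (rule pow_carrier_mat[OF A])
  have "(A ^\<^sub>m Suc (Suc k)) $$ (i, j) = (\<Sum>l<n. (A ^\<^sub>m Suc k) $$ (i, l) * A $$ (l, j))"
    unfolding pow_mat.simps(2)[of A "Suc k"] using P A i Suc.prems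
    by (simp add: scalar_prod_def atLeast0LessThan del: pow_mat.simps)
  also have "\<dots> = (\<Sum>l<n. (\<Sum>w\<in>{..<k} \<rightarrow>\<^sub>E {..<n}.
     \<Prod>t<Suc k. A $$ (if t = 0 then i else w (t - 1), if t = k then l else w t)) * A $$ (l, j))"
    by (rule sum.cong[OF refl]) (simp only: Suc.IH lessThan_iff)
  also have "\<dots> = (\<Sum>l<n. \<Sum>w\<in>{..<k} \<rightarrow>\<^sub>E {..<n}. \<Prod>t<Suc (Suc k).
     A $$ (if t = 0 then i else (w(k := l)) (t - 1), if t = Suc k then j else (w(k := l)) t))"
    unfolding sum_distrib_right
  proof (rule sum.cong[OF refl], rule sum.cong[OF refl])
    fix l w
    have "(\<Prod>t<Suc k. A $$ (if t = 0 then i else w (t - 1), if t = k then l else w t)) =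
       (\<Prod>t<Suc k. A $$ (if t = 0 then i else (w(k := l)) (t - 1), if t = Suc k then j else (w(k := l)) t))"
      by (rule prod.cong[OF refl]) auto
    then show "(\<Prod>t<Suc k. A $$ (if t = 0 then i else w (t - 1), if t = k then l else w t)) * A $$ (l, j) =
       (\<Prod>t<Suc (Suc k). A $$ (if t = 0 then i else (w(k := l)) (t - 1), if t = Suc k then j else (w(k := l)) t))"
      unfolding prod.lessThan_Suc[of _ "Suc k"] by simp
  qed
  also have "\<dots> = (\<Sum>w\<in>{..<Suc k} \<rightarrow>\<^sub>E {..<n}. \<Prod>t<Suc (Suc k).
     A $$ (if t = 0 then i else w (t - 1), if t = Suc k then j else w t))"
    by (rule sum_PiE_Suc[symmetric])
  finally show ?case .
qed

lemma trace_pow_mat: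
  fixes A :: "complex mat"
  assumes A: "A \<in> carrier_mat n n" and m: "m \<ge> 1"
  shows "(\<Sum>j<n. (A ^\<^sub>m m) $$ (j, j)) = walk_sum n m (\<lambda>e. A $$ e)"
proof -
  obtain k where k: "m = Suc k" using m by (cases m) auto
  have "(\<Sum>j<n. (A ^\<^sub>m m) $$ (j, j)) = (\<Sum>j<n. \<Sum>w\<in>{..<k} \<rightarrow>\<^sub>E {..<n}.
     \<Prod>t<Suc k. A $$ (if t = 0 then j else w (t - 1), if t = k then j else w t))"
    unfolding k by (rule sum.cong[OF refl]) (simp only: pow_mat_entry[OF A] lessThan_iff)
  \<comment> \<open>The common start and end \<open>j\<close> is stored at position
    \<open>k\<close>, so the closed walk is the same cyclic sequence read with a shift by one
    place.\<close>
  also have "\<dots> = (\<Sum>j<n. \<Sum>w\<in>{..<k} \<rightarrow>\<^sub>E {..<n}.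
     \<Prod>t<Suc k. A $$ ((w(k := j)) t, (w(k := j)) (if Suc t = Suc k then 0 else Suc t)))"
  proof (rule sum.cong[OF refl], rule sum.cong[OF refl])
    fix j w
    have "(\<Prod>t<Suc k. A $$ (if t = 0 then j else w (t - 1), if t = k then j else w t)) =
       (\<Prod>t<Suc k. A $$ ((w(k := j)) (if t = 0 then k else t - 1), (w(k := j)) t))"
      by (rule prod.cong[OF refl]) auto
    also have "\<dots> = (\<Prod>t<Suc k. A $$ ((w(k := j)) t, (w(k := j)) (if Suc t = Suc k then 0 else Suc t)))"
      by (rule prod.reindex_bij_witness[of _ "\<lambda>t. if Suc t = Suc k then 0 else Suc t" "\<lambda>t. if t = 0 then k else t - 1"])
        (auto split: if_splits)
    finally show "(\<Prod>t<Suc k. A $$ (if t = 0 then j else w (t - 1), if t = k then j else w t)) =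
      (\<Prod>t<Suc k. A $$ ((w(k := j)) t, (w(k := j)) (if Suc t = Suc k then 0 else Suc t)))" .
  qed
  also have "\<dots> = walk_sum n m (\<lambda>e. A $$ e)"
    unfolding walk_sum_def k by (rule sum_PiE_Suc[symmetric])
  finally show ?thesis .
qed

lemma upper_triangular_pow:
  fixes B :: "complex mat"
  assumes B: "B \<in> carrier_mat n n" and ut: "upper_triangular B"
  shows "(\<forall>i<n. \<forall>j<i. (B ^\<^sub>m m) $$ (i, j) = 0) \<and> (\<forall>i<n. (B ^\<^sub>m m) $$ (i, i) = (B $$ (i, i)) ^ m)"
proof (induction m)
  case 0
  show ?case using B by auto
next
  case (Suc m)
  have P: "B ^\<^sub>m m \<in> carrier_mat n n" by (rule pow_carrier_mat[OF B])
  have Bz: "B $$ (i, j) = 0" if "j < i" "i < n" for i j using ut B that by auto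
  have e: "(B ^\<^sub>m Suc m) $$ (i, j) = (\<Sum>l<n. (B ^\<^sub>m m) $$ (i, l) * B $$ (l, j))" if "i < n" "j < n" for i j
    using P B that by (simp add: scalar_prod_def atLeast0LessThan)
  have z: "(B ^\<^sub>m m) $$ (i, l) * B $$ (l, j) = 0" if "i < n" "l < n" "j \<le> i" "l \<noteq> i \<or> j < i" for i j l
  proof (cases "l < i")
    case True
    then show ?thesis using Suc.IH that by simp
  next
    case False
    then show ?thesis using Bz[of j l] that by (cases "j < l") auto
  qed
  show ?case
  proof (intro conjI allI impI)
    fix i j assume "i < n" "j < i"
    then show "(B ^\<^sub>m Suc m) $$ (i, j) = 0" using z[of i _ j] by (subst e) (auto intro!: sum.neutral)
  next
    fix i assume i: "i < n"
    have "(\<Sum>l\<in>{..<n} - {i}. (B ^\<^sub>m m) $$ (i, l) * B $$ (l, i)) = 0"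
    proof (rule sum.neutral, rule ballI)
      fix l assume "l \<in> {..<n} - {i}"
      then show "(B ^\<^sub>m m) $$ (i, l) * B $$ (l, i) = 0" by (intro z i) auto
    qed
    then have "(\<Sum>l<n. (B ^\<^sub>m m) $$ (i, l) * B $$ (l, i)) = (B ^\<^sub>m m) $$ (i, i) * B $$ (i, i)"
      using i by (subst sum.remove[of _ i]) simp_all
    then show "(B ^\<^sub>m Suc m) $$ (i, i) = (B $$ (i, i)) ^ Suc m" using e[OF i i] Suc.IH i by simp
  qed
qed

lemma proots_linear_factors: "proots (\<Prod>a\<leftarrow>as. [:- a, 1:] :: complex poly) = mset as"
proof (induction as)
  case (Cons a as)
  have "(\<Prod>a\<leftarrow>as. [:- a, 1:] :: complex poly) \<noteq> 0" by (auto simp: prod_list_zero_iff)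
  then show ?case
    unfolding list.map prod_list.Cons by (subst proots_mult) (simp_all add: Cons.IH)
qed simp

text \<open>Triangularisation: the powers of a triangular matrix carry the powers of the eigenvalues
  on the diagonal, and the trace is invariant under similarity.\<close>

lemma power_sum_eigenvalues:
  assumes A: "A \<in> carrier_mat n n" and m: "m \<ge> 1"
  shows "(\<Sum>x\<in>#eigenvalue_mset A. x ^ m) = walk_sum n m (\<lambda>e. A $$ e)"
proof -
  obtain es where es: "char_poly A = (\<Prod>a\<leftarrow>es. [:- a, 1:])" using char_poly_factorized[OF A] by blast
  obtain B where B: "B \<in> carrier_mat n n" "upper_triangular B" "similar_mat A B"
    using schur_decomposition_exists[OF A es] by blast
  have "eigenvalue_mset A = eigenvalue_mset B" using char_poly_similar[OF B(3)] by (simp add: eigenvalue_mset_def)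
  also have "\<dots> = mset (diag_mat B)"
    unfolding eigenvalue_mset_def char_poly_upper_triangular[OF B(1,2)]
    by (rule proots_linear_factors)
  finally have eig: "(\<Sum>x\<in>#eigenvalue_mset A. x ^ m) = (\<Sum>j<n. (B $$ (j, j)) ^ m)"
    using B(1) by (simp add: diag_mat_def sum_mset_sum_list interv_sum_list_conv_sum_set_nat atLeast0LessThan o_def
        del: mset_map flip: mset_map)
  obtain P Q where w: "similar_mat_wit A B P Q" using B(3) unfolding similar_mat_def by blast
  from similar_mat_witD2[OF A w] have PQ: "P \<in> carrier_mat n n" "Q \<in> carrier_mat n n" "Q * P = 1\<^sub>m n" by auto
  have Bm: "B ^\<^sub>m m \<in> carrier_mat n n" by (rule pow_carrier_mat[OF B(1)])
  define K where "K = P * B ^\<^sub>m m"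
  have PB: "K \<in> carrier_mat n n" using PQ Bm by (simp add: K_def)
  have "(\<Sum>j<n. (A ^\<^sub>m m) $$ (j, j)) = (\<Sum>j<n. \<Sum>l<n. K $$ (j, l) * Q $$ (l, j))"
    unfolding similar_mat_wit_pow_id[OF w] K_def[symmetric] using PB PQ by (simp add: scalar_prod_def atLeast0LessThan)
  also have "\<dots> = (\<Sum>l<n. \<Sum>j<n. Q $$ (l, j) * K $$ (j, l))"
    by (subst sum.swap) (simp only: mult.commute)
  also have "\<dots> = (\<Sum>l<n. (Q * K) $$ (l, l))"
    using PB PQ by (simp add: scalar_prod_def atLeast0LessThan)
  also have "Q * K = B ^\<^sub>m m"
    unfolding K_def assoc_mult_mat[OF PQ(2,1) Bm, symmetric] PQ(3) by (rule left_mult_one_mat[OF Bm])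
  also have "(\<Sum>l<n. (B ^\<^sub>m m) $$ (l, l)) = (\<Sum>j<n. (B $$ (j, j)) ^ m)"
    by (rule sum.cong[OF refl]) (use upper_triangular_pow[OF B(1,2), of m] in simp)
  finally show ?thesis unfolding eig trace_pow_mat[OF A m, symmetric] by (rule sym)
qed

text \<open>The coefficients \<open>h\<close> of the reciprocal of \<open>det (1 - z A)\<close> and Newton's recursion for them.\<close>

lemma reciprocal_det_coeffs:
  assumes A: "A \<in> carrier_mat n n"
  shows "\<exists>h :: nat \<Rightarrow> complex. h 0 = 1 \<and>
     (\<forall>k\<ge>1. of_nat k * h k = (\<Sum>m=1..k. walk_sum n m (\<lambda>e. A $$ e) * h (k - m))) \<and>
     (\<forall>k\<ge>1. (\<Sum>i\<le>k. (-1) ^ i * minor_sum n i (\<lambda>e. A $$ e) * h (k - i)) = 0)"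
proof -
  let ?S = "eigenvalue_mset A"
  \<comment> \<open>The formal power series of \<open>1 / (1 - x z)\<close>. Working with formal
    series spares all questions of convergence.\<close>
  define geo where "geo = (\<lambda>x :: complex. Abs_fps (\<lambda>k. x ^ k))"
  define H where "H = (\<Prod>x\<in>#?S. geo x)"
  have geo_inv: "(1 - fps_const x * fps_X) * geo x = 1" for x
    by (rule fps_ext) (auto simp: geo_def left_diff_distrib mult.assoc fps_X_mult_nth power_eq_if)
  have geo_deriv: "fps_deriv (geo x) = fps_const x * geo x * geo x" for x
  proof -
    have "fps_deriv ((1 - fps_const x * fps_X) * geo x) = 0" unfolding geo_inv by simp
    then have "(1 - fps_const x * fps_X) * fps_deriv (geo x) = fps_const x * geo x"
      by (simp add: algebra_simps)
    note 1 = this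
    have "fps_deriv (geo x) = ((1 - fps_const x * fps_X) * geo x) * fps_deriv (geo x)" unfolding geo_inv by simp
    also have "\<dots> = geo x * ((1 - fps_const x * fps_X) * fps_deriv (geo x))" by (simp only: mult_ac)
    also have "\<dots> = fps_const x * geo x * geo x" unfolding 1 by (simp only: mult_ac)
    finally show ?thesis .
  qed
  \<comment> \<open>The logarithmic derivative of the product, cleared of denominators. The
    coefficients of its last factor are power sums, which gives Newton's recursion.\<close>
  have H_deriv: "fps_deriv (\<Prod>x\<in>#X. geo x) = (\<Prod>x\<in>#X. geo x) * (\<Sum>x\<in>#X. fps_const x * geo x)" for X
  proof (induction X)
    case (add x X)
    show ?case
      unfolding image_mset_add_mset prod_mset.add_mset sum_mset.add_mset fps_deriv_mult add.IH geo_deriv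
      by (simp only: distrib_left mult_ac add_ac)
  qed simp
  have sum_nth: "fps_nth (\<Sum>x\<in>#X. fps_const x * geo x) j = (\<Sum>x\<in>#X. x ^ Suc j)" for X j
    by (induction X) (auto simp: geo_def)
  define P where "P = (\<Prod>x\<in>#?S. [:1, - x:])"
  have PH: "fps_of_poly P * H = 1"
  proof -
    have "fps_of_poly (\<Prod>x\<in>#X. [:1, - x:]) * (\<Prod>x\<in>#X. geo x) = 1" for X
    proof (induction X)
      case (add x X)
      have "fps_of_poly [:1, - x:] = 1 - fps_const x * fps_X"
        by (simp add: fps_of_poly_pCons)
      then have "fps_of_poly (\<Prod>x\<in>#add_mset x X. [:1, - x:]) * (\<Prod>x\<in>#add_mset x X. geo x) =
         ((1 - fps_const x * fps_X) * geo x) * (fps_of_poly (\<Prod>x\<in>#X. [:1, - x:]) * (\<Prod>x\<in>#X. geo x))"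
        by (simp add: fps_of_poly_mult mult_ac)
      then show ?case using add geo_inv by simp
    qed simp
    then show ?thesis by (simp add: P_def H_def)
  qed
  \<comment> \<open>Equality of values at every complex \<open>z\<close> identifies the coefficients
    of the reversed characteristic polynomial with the signed minor sums.\<close>
  define P' where "P' = (\<Sum>k\<le>n. monom ((-1) ^ k * minor_sum n k (\<lambda>e. A $$ e)) k)"
  have "poly P z = poly P' z" for z
  proof -
    have "poly P z = (\<Prod>x\<in>#?S. 1 - z * x)"
      unfolding P_def by (simp add: poly_prod_mset image_mset.compositionality o_def)
    also have "\<dots> = (\<Sum>k\<le>n. (-z) ^ k * minor_sum n k (\<lambda>e. A $$ e))"
      unfolding det_one_minus_eigenvalues[OF A, symmetric] by (rule det_one_minus_smult[OF A])
    also have "\<dots> = poly P' z"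
      unfolding P'_def poly_sum poly_monom
      by (rule sum.cong[OF refl]) (simp add: power_minus[of z] mult_ac)
    finally show ?thesis .
  qed
  then have "poly P = poly P'" by (rule ext)
  then have "P = P'" by (simp only: poly_eq_poly_eq_iff)
  moreover have "minor_sum n i x = 0" if "i > n" for i x
  proof -
    have "card I \<noteq> i" if "I \<subseteq> {..<n}" for I
      using card_mono[OF finite_lessThan that] \<open>i > n\<close> by simp
    then have "minor_idx n i = {}" unfolding minor_idx_def by blast
    then show ?thesis by (simp add: minor_sum_def)
  qed
  ultimately have cP: "coeff P i = (-1) ^ i * minor_sum n i (\<lambda>e. A $$ e)" for i
    by (cases "i \<le> n") (auto simp: P'_def coeff_sum)
  show ?thesis
  proof (intro exI[of _ "fps_nth H"] conjI allI impI)
    have "fps_nth (\<Prod>x\<in>#X. geo x) 0 = 1" for X by (induction X) (auto simp: geo_def)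
    then show "fps_nth H 0 = 1" by (simp add: H_def)
  next
    fix k :: nat assume k: "k \<ge> 1"
    then obtain l where l: "k = Suc l" by (cases k) auto
    have "of_nat k * fps_nth H k = fps_nth (fps_deriv H) l" by (simp add: l)
    also have "\<dots> = fps_nth ((\<Sum>x\<in>#?S. fps_const x * geo x) * H) l"
      unfolding H_def H_deriv by (simp only: mult.commute)
    also have "\<dots> = (\<Sum>j=0..l. (\<Sum>x\<in>#?S. x ^ Suc j) * fps_nth H (l - j))"
      unfolding fps_mult_nth sum_nth by (rule refl)
    also have "\<dots> = (\<Sum>j=0..l. walk_sum n (Suc j) (\<lambda>e. A $$ e) * fps_nth H (k - Suc j))"
      by (rule sum.cong[OF refl]) (simp only: power_sum_eigenvalues[OF A] l diff_Suc_Suc le_add1 One_nat_def Suc_le_mono le0)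
    also have "\<dots> = (\<Sum>m=1..k. walk_sum n m (\<lambda>e. A $$ e) * fps_nth H (k - m))"
      unfolding l One_nat_def sum.atLeast_Suc_atMost_Suc_shift o_def by (rule refl)
    finally show "of_nat k * fps_nth H k = \<dots>" .
  next
    fix k :: nat assume k: "k \<ge> 1"
    have "(\<Sum>i\<le>k. (-1) ^ i * minor_sum n i (\<lambda>e. A $$ e) * fps_nth H (k - i)) = fps_nth (fps_of_poly P * H) k"
      unfolding fps_mult_nth by (simp add: cP atLeast0AtMost)
    also have "\<dots> = 0" unfolding PH using k by simp
    finally show "(\<Sum>i\<le>k. (-1) ^ i * minor_sum n i (\<lambda>e. A $$ e) * fps_nth H (k - i)) = 0" .
  qed
qed

section \<open>Norms, and the factorization of a matrix of bounded rank\<close>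

lemma vec_l2_norm_nonneg [simp]: "vec_l2_norm v \<ge> 0"
  by (simp add: vec_l2_norm_def sum_nonneg)

lemma vec_l2_norm_square: "(vec_l2_norm v)\<^sup>2 = (\<Sum>i<dim_vec v. (cmod (vec_index v i))\<^sup>2)"
  by (simp add: vec_l2_norm_def sum_nonneg)

lemma vec_l2_norm_smult: "vec_l2_norm (a \<cdot>\<^sub>v v) = cmod a * vec_l2_norm v"
  by (simp add: vec_l2_norm_def norm_mult power_mult_distrib sum_distrib_left[symmetric] real_sqrt_mult)

lemma vec_l2_norm_eq_0:
  assumes "v \<in> carrier_vec n" "vec_l2_norm v = 0"
  shows "v = 0\<^sub>v n"
proof -
  have "(\<Sum>i<dim_vec v. (cmod (vec_index v i))\<^sup>2) = 0"
    using assms(2) by (simp add: vec_l2_norm_def)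
  then have "\<forall>i\<in>{..<dim_vec v}. (cmod (vec_index v i))\<^sup>2 = 0"
    by (subst (asm) sum_nonneg_eq_0_iff) auto
  then show ?thesis using assms(1) by (intro eq_vecI) auto
qed

text \<open>A crude entrywise bound. It makes the supremum in \<open>mat_op_norm\<close> a genuine
  least upper bound, so that a bound on it says something about single vectors.\<close>

lemma mat_op_norm_bdd:
  assumes A: "A \<in> carrier_mat n m"
  shows "bdd_above ((\<lambda>v. vec_l2_norm (A *\<^sub>v v)) ` {v \<in> carrier_vec (dim_col A). vec_l2_norm v \<le> 1})"
proof (rule bdd_aboveI2)
  fix v assume v: "v \<in> {v \<in> carrier_vec (dim_col A). vec_l2_norm v \<le> 1}"
  have vc: "v \<in> carrier_vec m" using v A by simp
  have vi: "cmod (vec_index v j) \<le> 1" if "j < m" for j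
  proof -
    have "(cmod (vec_index v j))\<^sup>2 \<le> (\<Sum>i<dim_vec v. (cmod (vec_index v i))\<^sup>2)"
      using that v A by (intro member_le_sum) auto
    also have "\<dots> = (vec_l2_norm v)\<^sup>2" by (rule vec_l2_norm_square[symmetric])
    also have "\<dots> \<le> 1\<^sup>2" using v by (intro power_mono) auto
    finally show ?thesis by (rule power2_le_imp_le) simp
  qed
  show "vec_l2_norm (A *\<^sub>v v) \<le> sqrt (\<Sum>i<n. (\<Sum>j<m. cmod (A $$ (i, j)))\<^sup>2)"
  proof -
    have "cmod (vec_index (A *\<^sub>v v) i) \<le> (\<Sum>j<m. cmod (A $$ (i, j)))" if "i < n" for i
    proof -
      have "vec_index (A *\<^sub>v v) i = (\<Sum>j<m. A $$ (i, j) * vec_index v j)"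
        using A carrier_vecD[OF vc] that by (simp add: scalar_prod_def atLeast0LessThan)
      also have "cmod \<dots> \<le> (\<Sum>j<m. cmod (A $$ (i, j) * vec_index v j))" by (rule norm_sum)
      also have "\<dots> \<le> (\<Sum>j<m. cmod (A $$ (i, j)) * 1)"
        unfolding norm_mult by (intro sum_mono mult_left_mono vi) auto
      finally show ?thesis by simp
    qed
    then show ?thesis
      unfolding vec_l2_norm_def using A by (intro real_sqrt_le_mono) (auto intro!: sum_mono power_mono)
  qed
qed

lemma mat_op_norm_bound:
  assumes A: "A \<in> carrier_mat n m" and v: "v \<in> carrier_vec m" and s: "mat_op_norm A \<le> s"
  shows "vec_l2_norm (A *\<^sub>v v) \<le> s * vec_l2_norm v"
proof (cases "vec_l2_norm v = 0")
  case True
  then have "A *\<^sub>v v = 0\<^sub>v n" using vec_l2_norm_eq_0[OF v] A by auto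
  then show ?thesis using True by (simp add: vec_l2_norm_def)
next
  case False
  let ?a = "vec_l2_norm v"
  have a: "?a > 0" using False vec_l2_norm_nonneg[of v] by linarith
  define w where "w = complex_of_real (1 / ?a) \<cdot>\<^sub>v v"
  have w: "w \<in> carrier_vec m" "vec_l2_norm w = 1" using v a by (simp_all add: w_def vec_l2_norm_smult norm_divide)
  have "vec_l2_norm (A *\<^sub>v w) \<le> mat_op_norm A"
    unfolding mat_op_norm_def by (rule cSUP_upper[OF _ mat_op_norm_bdd[OF A]]) (use w A in auto)
  moreover have "A *\<^sub>v w = complex_of_real (1 / ?a) \<cdot>\<^sub>v (A *\<^sub>v v)"
    unfolding w_def by (rule mult_mat_vec[OF A v])
  ultimately have "vec_l2_norm (A *\<^sub>v v) / ?a \<le> s"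
    using s a by (simp add: vec_l2_norm_smult norm_divide)
  then show ?thesis using a by (simp add: field_simps)
qed

text \<open>Keeps the outliers of \<open>C\<close> in a disc whose radius does not depend on
  \<open>n\<close>, as the matching of zeros requires.\<close>

lemma eigenvalue_norm_le:
  assumes A: "A \<in> carrier_mat n n" and s: "mat_op_norm A \<le> s" and x: "x \<in># eigenvalue_mset A"
  shows "cmod x \<le> s"
proof -
  have "char_poly A \<noteq> 0" using degree_monic_char_poly[OF A] by auto
  then have "poly (char_poly A) x = 0" using x by (simp add: eigenvalue_mset_def set_count_proots)
  then have "eigenvalue A x" using eigenvalue_root_char_poly[OF A] by simp
  then obtain v where v: "v \<in> carrier_vec n" "v \<noteq> 0\<^sub>v n" "A *\<^sub>v v = x \<cdot>\<^sub>v v"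
    using A by (auto simp: eigenvalue_def eigenvector_def)
  have "vec_l2_norm v \<noteq> 0" using vec_l2_norm_eq_0[OF v(1)] v(2) by auto
  then have "vec_l2_norm v > 0" using vec_l2_norm_nonneg[of v] by linarith
  moreover have "cmod x * vec_l2_norm v \<le> s * vec_l2_norm v"
    using mat_op_norm_bound[OF A v(1) s] v(3) by (simp add: vec_l2_norm_smult)
  ultimately show ?thesis by simp
qed

text \<open>An orthonormal basis of the column space gives a factorization through dimension \<open>k\<close>
  whose factors are bounded independently of \<open>n\<close>.\<close>

lemma rank_factorization:
  fixes C :: "complex mat"
  assumes C: "C \<in> carrier_mat n n" and rk: "vec_space.rank n C = k" and s: "mat_op_norm C \<le> s"
  shows "\<exists>U \<in> carrier_mat n k. \<exists>W \<in> carrier_mat k n. C = U * W \<and>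
    (\<forall>j<k. (\<Sum>a<n. (cmod (U $$ (a, j)))\<^sup>2) = 1) \<and> (\<forall>i<k. (\<Sum>a<n. (cmod (W $$ (i, a)))\<^sup>2) \<le> s\<^sup>2)"
proof -
  interpret cof_vec_space n "TYPE(complex)" .
  have colsC: "set (cols C) \<subseteq> carrier_vec n" using C cols_dim[of C] by auto
  have "lin_indpt {}" by (auto simp: lin_dep_def)
  then have "{} \<subseteq> set (cols C) \<and> lin_indpt {}" by blast
  \<comment> \<open>A maximal independent set of columns has as many members as the rank.
    Gram-Schmidt makes it an orthogonal basis of the column space, which is normalised below by
    \<open>nu\<close>.\<close>
  from maximal_exists_superset[of "set (cols C)" "\<lambda>T. T \<subseteq> set (cols C) \<and> lin_indpt T", OF finite_set _ this]
  obtain S where S: "maximal S (\<lambda>T. T \<subseteq> set (cols C) \<and> lin_indpt T)" by blast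
  have Sk: "card S = k" using rank_card_indpt[OF C S] rk by simp
  have Sc: "S \<subseteq> set (cols C)" "lin_indpt S" using S by (auto simp: maximal_def)
  have finS: "finite S" using Sc(1) finite_subset by blast
  have Scarr: "S \<subseteq> carrier_vec n" using Sc(1) colsC by blast
  obtain ws where ws: "set ws = S" "distinct ws" using finite_distinct_list[OF finS] by blast
  have lw: "length ws = k" using ws Sk distinct_card by metis
  define us where "us = gram_schmidt n ws"
  have gs: "span S = span (set us)" "corthogonal us" "set us \<subseteq> carrier_vec n" "length us = k"
    using gram_schmidt_result[OF _ ws(2) _ us_def] ws(1) Scarr Sc(2) lw by auto
  have us_c: "us ! j \<in> carrier_vec n" if "j < k" for j using gs(3,4) that nth_mem by blast
  have in_span: "c \<in> span (set us)" if "c \<in> set (cols C)" for c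
  proof -
    have "c \<in> span S"
    proof (rule ccontr)
      assume c: "c \<notin> span S"
      have cc: "c \<in> carrier_vec n" using that colsC by blast
      have cS: "c \<notin> S"
      proof
        assume "c \<in> S"
        from span_mem[OF Scarr this] show False using c by contradiction
      qed
      have "lin_indpt (S \<union> {c})"
        using c unfolding lin_dep_iff_in_span[OF Scarr Sc(2) cc cS] .
      moreover have "S \<union> {c} \<subseteq> set (cols C)" using that Sc(1) by simp
      moreover have mx: "\<forall>B. S \<subseteq> B \<and> B \<subseteq> set (cols C) \<and> lin_indpt B \<longrightarrow> B = S"
        using S unfolding maximal_def by (rule conjunct2)
      ultimately have "S \<union> {c} = S" using mx[rule_format, of "S \<union> {c}"] Un_upper1[of S "{c}"] by (intro mx[rule_format] conjI)
      then show False using cS by blast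
    qed
    then show ?thesis using gs(1) by simp
  qed
  define nu where "nu = (\<lambda>j. vec_l2_norm (us ! j))"
  have inner: "us ! j \<bullet>c us ! j = complex_of_real ((nu j)\<^sup>2)" if "j < k" for j
    using us_c[OF that] unfolding nu_def vec_l2_norm_square
    by (simp add: scalar_prod_def complex_norm_square atLeast0LessThan del: of_real_power)
  have nu: "nu j > 0" if "j < k" for j
  proof -
    have "us ! j \<bullet>c us ! j \<noteq> 0" using corthogonalD[OF gs(2), of j j] gs(4) that by simp
    then have "nu j \<noteq> 0" using inner[OF that] by auto
    then show ?thesis using vec_l2_norm_nonneg[of "us ! j"] unfolding nu_def by linarith
  qed
  define U where "U = Matrix.mat n k (\<lambda>(a, j). vec_index (us ! j) a / complex_of_real (nu j))"
  have U: "U \<in> carrier_mat n k" by (simp add: U_def)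
  have orth: "(\<Sum>a<n. cnj (U $$ (a, i)) * U $$ (a, j)) = (if i = j then 1 else 0)" if ij: "i < k" "j < k" for i j
  proof -
    have "(\<Sum>a<n. cnj (U $$ (a, i)) * U $$ (a, j)) =
        (us ! j \<bullet>c us ! i) / (complex_of_real (nu i) * complex_of_real (nu j))"
      using ij us_c[OF ij(1)] us_c[OF ij(2)]
      by (simp add: U_def scalar_prod_def atLeast0LessThan sum_divide_distrib mult.commute)
    also have "\<dots> = (if i = j then 1 else 0)"
    proof (cases "i = j")
      case True
      then show ?thesis using inner[OF ij(2)] nu[OF ij(2)] by (simp add: power2_eq_square)
    next
      case False
      then show ?thesis using corthogonalD[OF gs(2), of j i] gs(4) ij by simp
    qed
    finally show ?thesis .
  qed
  \<comment> \<open>\<open>W\<close> is the adjoint of \<open>U\<close> times \<open>C\<close>; as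
    the columns of \<open>U\<close> are an orthonormal basis of the column space of
    \<open>C\<close>, the product \<open>U * W\<close> returns \<open>C\<close>.\<close>
  define W where "W = Matrix.mat k n (\<lambda>(i, b). \<Sum>a<n. cnj (U $$ (a, i)) * C $$ (a, b))"
  have W: "W \<in> carrier_mat k n" by (simp add: W_def)
  have CUW: "C = U * W"
  proof (rule eq_matI)
    fix a b assume "a < dim_row (U * W)" "b < dim_col (U * W)"
    then have ab: "a < n" "b < n" using U W by auto
    have "Matrix.col C b \<in> set (cols C)" using ab C by (auto simp: cols_def)
    then have "Matrix.col C b \<in> col_space (mat_of_cols n us)"
      unfolding col_space_def using in_span gs(3) by simp
    then obtain x where x: "x \<in> carrier_vec k" "mat_of_cols n us *\<^sub>v x = Matrix.col C b"
      using col_space_eq[of "mat_of_cols n us" k] gs(4) by auto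
    have Cx: "C $$ (a, b) = (\<Sum>j<k. U $$ (a, j) * (complex_of_real (nu j) * vec_index x j))" if "a < n" for a
    proof -
      have "C $$ (a, b) = vec_index (Matrix.col C b) a" using ab that C by simp
      also have "\<dots> = (\<Sum>j<k. vec_index (us ! j) a * vec_index x j)"
        unfolding x(2)[symmetric] using that x(1) gs(4)
        by (simp add: scalar_prod_def atLeast0LessThan mat_of_cols_index)
      also have "\<dots> = (\<Sum>j<k. U $$ (a, j) * (complex_of_real (nu j) * vec_index x j))"
        by (rule sum.cong[OF refl]) (use nu that in \<open>force simp: U_def\<close>)
      finally show ?thesis .
    qed
    have Wx: "W $$ (i, b) = complex_of_real (nu i) * vec_index x i" if i: "i < k" for i
    proof -
      have "W $$ (i, b) = (\<Sum>a<n. cnj (U $$ (a, i)) * (\<Sum>j<k. U $$ (a, j) * (complex_of_real (nu j) * vec_index x j)))"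
        using i ab by (simp add: W_def Cx)
      also have "\<dots> = (\<Sum>j<k. (\<Sum>a<n. cnj (U $$ (a, i)) * U $$ (a, j)) * (complex_of_real (nu j) * vec_index x j))"
        unfolding sum_distrib_left sum_distrib_right by (subst sum.swap) (simp only: mult.assoc)
      also have "\<dots> = (\<Sum>j<k. if j = i then complex_of_real (nu j) * vec_index x j else 0)"
        by (rule sum.cong[OF refl]) (use orth i in auto)
      finally show ?thesis using i by simp
    qed
    have "(U * W) $$ (a, b) = (\<Sum>j<k. U $$ (a, j) * W $$ (j, b))"
      using ab U W by (simp add: scalar_prod_def atLeast0LessThan)
    also have "\<dots> = C $$ (a, b)" unfolding Cx[OF ab(1)] by (rule sum.cong[OF refl]) (simp add: Wx)
    finally show "C $$ (a, b) = (U * W) $$ (a, b)" by (rule sym)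
  qed (use C U W in auto)
  have Unorm: "(\<Sum>a<n. (cmod (U $$ (a, j)))\<^sup>2) = 1" if "j < k" for j
  proof -
    have "complex_of_real (\<Sum>a<n. (cmod (U $$ (a, j)))\<^sup>2) = (\<Sum>a<n. cnj (U $$ (a, j)) * U $$ (a, j))"
      unfolding of_real_sum by (rule sum.cong[OF refl]) (simp only: complex_norm_square mult.commute)
    also have "\<dots> = complex_of_real 1" using orth[OF that that] by simp
    finally show ?thesis by (simp only: of_real_eq_iff)
  qed
  \<comment> \<open>With \<open>y\<close> the conjugate of row \<open>i\<close> of \<open>W\<close>,
    the squared length of \<open>y\<close> is the inner product of \<open>C y\<close> with the unit
    vector in column \<open>i\<close> of \<open>U\<close>. By Cauchy-Schwarz and the operator norm
    it is at most \<open>s\<close> times the length of \<open>y\<close>.\<close>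
  have Wnorm: "(\<Sum>a<n. (cmod (W $$ (i, a)))\<^sup>2) \<le> s\<^sup>2" if i: "i < k" for i
  proof -
    define y where "y = vec n (\<lambda>b. cnj (W $$ (i, b)))"
    have y: "y \<in> carrier_vec n" by (simp add: y_def)
    have yn: "(vec_l2_norm y)\<^sup>2 = (\<Sum>a<n. (cmod (W $$ (i, a)))\<^sup>2)"
      by (simp add: vec_l2_norm_square y_def)
    have Cy: "vec_index (C *\<^sub>v y) a = (\<Sum>b<n. C $$ (a, b) * cnj (W $$ (i, b)))" if "a < n" for a
      using C that by (simp add: y_def scalar_prod_def atLeast0LessThan)
    have "complex_of_real ((vec_l2_norm y)\<^sup>2) = (\<Sum>b<n. W $$ (i, b) * cnj (W $$ (i, b)))"
      unfolding yn of_real_sum by (rule sum.cong[OF refl]) (simp only: complex_norm_square)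
    also have "\<dots> = (\<Sum>b<n. \<Sum>a<n. cnj (U $$ (a, i)) * (C $$ (a, b) * cnj (W $$ (i, b))))"
      by (rule sum.cong[OF refl]) (use i in \<open>simp add: W_def sum_distrib_right mult.assoc\<close>)
    also have "\<dots> = (\<Sum>a<n. \<Sum>b<n. cnj (U $$ (a, i)) * (C $$ (a, b) * cnj (W $$ (i, b))))"
      by (rule sum.swap)
    also have "\<dots> = (\<Sum>a<n. cnj (U $$ (a, i)) * vec_index (C *\<^sub>v y) a)"
      by (rule sum.cong[OF refl]) (simp only: Cy lessThan_iff sum_distrib_left)
    finally have e: "complex_of_real ((vec_l2_norm y)\<^sup>2) = (\<Sum>a<n. cnj (U $$ (a, i)) * vec_index (C *\<^sub>v y) a)" .
    have "(vec_l2_norm y)\<^sup>2 = cmod (\<Sum>a<n. cnj (U $$ (a, i)) * vec_index (C *\<^sub>v y) a)"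
      unfolding e[symmetric] norm_of_real by (rule abs_power2[symmetric])
    also have "\<dots> \<le> (\<Sum>a<n. cmod (U $$ (a, i)) * cmod (vec_index (C *\<^sub>v y) a))"
      using norm_sum[of "\<lambda>a. cnj (U $$ (a, i)) * vec_index (C *\<^sub>v y) a" "{..<n}"] by (simp add: norm_mult)
    also have "\<dots> \<le> sqrt ((\<Sum>a<n. (cmod (U $$ (a, i)))\<^sup>2) * (\<Sum>a<n. (cmod (vec_index (C *\<^sub>v y) a))\<^sup>2))"
      by (rule real_le_rsqrt[OF Cauchy_Schwarz_ineq_sum])
    also have "\<dots> = vec_l2_norm (C *\<^sub>v y)" unfolding Unorm[OF i] using C by (simp add: vec_l2_norm_def)
    also have "\<dots> \<le> s * vec_l2_norm y" by (rule mat_op_norm_bound[OF C y s])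
    finally have le: "vec_l2_norm y * vec_l2_norm y \<le> s * vec_l2_norm y" by (simp add: power2_eq_square)
    have s0: "0 \<le> s"
    proof -
      have "vec_l2_norm (C *\<^sub>v 0\<^sub>v n) \<le> mat_op_norm C"
        unfolding mat_op_norm_def
        by (rule cSUP_upper[OF _ mat_op_norm_bdd[OF C]]) (use C in \<open>auto simp: vec_l2_norm_def\<close>)
      then show ?thesis using s vec_l2_norm_nonneg[of "C *\<^sub>v 0\<^sub>v n"] by linarith
    qed
    have "vec_l2_norm y \<le> s"
      using le s0 vec_l2_norm_nonneg[of y] by (cases "vec_l2_norm y = 0") auto
    then have "(vec_l2_norm y)\<^sup>2 \<le> s\<^sup>2" by (intro power_mono) auto
    then show ?thesis unfolding yn .
  qed
  show ?thesis using U W CUW Unorm Wnorm by blast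
qed

text \<open>By Sylvester's identity the reversed characteristic polynomial of \<open>U * W\<close>
  has degree at most \<open>k\<close>, and this degree counts the nonzero eigenvalues. It bounds the
  number of small eigenvalues in the matching of zeros independently of \<open>n\<close>.\<close>

lemma card_nonzero_eigenvalues_le:
  assumes U: "U \<in> carrier_mat n k" and W: "W \<in> carrier_mat k n"
  shows "size {# x \<in># eigenvalue_mset (U * W). x \<noteq> 0 #} \<le> k"
proof -
  let ?S = "eigenvalue_mset (U * W)" and ?T = "{# x \<in># eigenvalue_mset (U * W). x \<noteq> 0 #}"
  have C: "U * W \<in> carrier_mat n n" and G: "W * U \<in> carrier_mat k k" using U W by auto
  define P where "P = (\<Prod>x\<in>#?T. [:1, - x:])"
  define P' where "P' = (\<Sum>l\<le>k. monom ((-1) ^ l * minor_sum k l (\<lambda>e. (W * U) $$ e)) l)"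
  have "poly P z = poly P' z" for z
  proof -
    have zU: "(z \<cdot>\<^sub>m U) * W = z \<cdot>\<^sub>m (U * W)" "W * (z \<cdot>\<^sub>m U) = z \<cdot>\<^sub>m (W * U)"
      by (rule mult_smult_assoc_mat[OF U W], rule mult_smult_distrib[OF W U])
    have "poly P z = (\<Prod>x\<in>#?T. 1 - z * x)"
      unfolding P_def by (simp add: poly_prod_mset image_mset.compositionality o_def)
    also have "\<dots> = (\<Prod>x\<in>#?S. 1 - z * x)"
    proof -
      have "(\<Prod>x\<in>#{# x \<in># X. x \<noteq> 0 #}. 1 - z * x) = (\<Prod>x\<in>#X. 1 - z * x)" for X
        by (induction X) auto
      then show ?thesis .
    qed
    also have "\<dots> = Determinant.det (1\<^sub>m n - z \<cdot>\<^sub>m (U * W))" by (rule det_one_minus_eigenvalues[OF C, symmetric])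
    also have "\<dots> = Determinant.det (1\<^sub>m k - z \<cdot>\<^sub>m (W * U))"
      using det_one_minus_mult_commute[of "z \<cdot>\<^sub>m U" n k W] U W by (simp add: zU)
    also have "\<dots> = (\<Sum>l\<le>k. (-z) ^ l * minor_sum k l (\<lambda>e. (W * U) $$ e))" by (rule det_one_minus_smult[OF G])
    also have "\<dots> = poly P' z"
      unfolding P'_def poly_sum poly_monom
      by (rule sum.cong[OF refl]) (simp add: power_minus[of z] mult_ac)
    finally show ?thesis .
  qed
  then have "poly P = poly P'" by (rule ext)
  then have "P = P'" by (simp only: poly_eq_poly_eq_iff)
  moreover have "degree P' \<le> k"
    unfolding P'_def by (rule degree_sum_le) (auto intro: order_trans[OF degree_monom_le])
  moreover have "degree P = size ?T"
  proof -
    have "0 \<notin># X \<Longrightarrow> degree (\<Prod>x\<in>#X. [:1, - x:]) = size X \<and> (\<Prod>x\<in>#X. [:1, - x:]) \<noteq> 0" for X :: "complex multiset"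
    proof (induction X)
      case (add x X)
      then have n0: "[:1, - x:] \<noteq> 0" and d1: "degree [:1, - x:] = 1" by auto
      have "0 \<notin># X" using add.prems by simp
      from add.IH[OF this] have IH: "degree (\<Prod>x\<in>#X. [:1, - x:]) = size X" "(\<Prod>x\<in>#X. [:1, - x:]) \<noteq> 0"
        by blast+
      show ?case
        unfolding image_mset_add_mset prod_mset.add_mset degree_mult_eq[OF n0 IH(2)] d1 IH(1)
        using n0 IH(2) by (simp only: mult_eq_0_iff size_add_mset) simp
    qed simp
    from this[of ?T] show ?thesis unfolding P_def by simp
  qed
  ultimately show ?thesis by simp
qed

text \<open>Division by \<open>K\<close> brings the entries into the unit disc, where the difference
  of two products is at most the sum of the differences of their factors.\<close>

lemma det_diff_le:
  fixes A B :: "complex mat"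
  assumes A: "A \<in> carrier_mat k k" and B: "B \<in> carrier_mat k k" and K: "K \<ge> 1"
    and bA: "\<And>i j. i < k \<Longrightarrow> j < k \<Longrightarrow> cmod (A $$ (i, j)) \<le> K"
    and bB: "\<And>i j. i < k \<Longrightarrow> j < k \<Longrightarrow> cmod (B $$ (i, j)) \<le> K"
    and d: "\<And>i j. i < k \<Longrightarrow> j < k \<Longrightarrow> cmod (A $$ (i, j) - B $$ (i, j)) \<le> \<epsilon>"
  shows "cmod (Determinant.det A - Determinant.det B) \<le> fact k * (K ^ k * (real k * \<epsilon>))"
proof -
  let ?P = "{\<sigma>. \<sigma> permutes {..<k}}"
  have one: "cmod ((\<Prod>i<k. A $$ (i, \<sigma> i)) - (\<Prod>i<k. B $$ (i, \<sigma> i))) \<le> K ^ k * (real k * \<epsilon>)" if "\<sigma> \<in> ?P" for \<sigma>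
  proof -
    have \<sigma>: "\<sigma> i < k" if "i < k" for i using permutes_in_image[of \<sigma> "{..<k}" i] \<open>\<sigma> \<in> ?P\<close> that by simp
    have s: "(\<Prod>i<k. X $$ (i, \<sigma> i)) = complex_of_real (K ^ k) * (\<Prod>i<k. X $$ (i, \<sigma> i) / complex_of_real K)" for X :: "complex mat"
      using K by (simp add: prod_dividef)
    have "cmod ((\<Prod>i<k. A $$ (i, \<sigma> i) / complex_of_real K) - (\<Prod>i<k. B $$ (i, \<sigma> i) / complex_of_real K))
       \<le> (\<Sum>i<k. cmod (A $$ (i, \<sigma> i) / complex_of_real K - B $$ (i, \<sigma> i) / complex_of_real K))"
      using bA bB \<sigma> K by (intro norm_prod_diff) (auto simp: norm_divide divide_le_eq)
    also have "\<dots> \<le> (\<Sum>i<k. \<epsilon>)"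
    proof (rule sum_mono)
      fix i assume "i \<in> {..<k}"
      then have i: "i < k" by simp
      have "cmod (A $$ (i, \<sigma> i) / complex_of_real K - B $$ (i, \<sigma> i) / complex_of_real K) = cmod (A $$ (i, \<sigma> i) - B $$ (i, \<sigma> i)) / K"
        using K by (simp add: norm_divide flip: diff_divide_distrib)
      also have "\<dots> \<le> cmod (A $$ (i, \<sigma> i) - B $$ (i, \<sigma> i)) / 1" using K by (intro divide_left_mono) auto
      finally show "cmod (A $$ (i, \<sigma> i) / complex_of_real K - B $$ (i, \<sigma> i) / complex_of_real K) \<le> \<epsilon>"
        using d[OF i \<sigma>[OF i]] by simp
    qed
    finally have "cmod ((\<Prod>i<k. A $$ (i, \<sigma> i) / complex_of_real K) - (\<Prod>i<k. B $$ (i, \<sigma> i) / complex_of_real K)) \<le> real k * \<epsilon>"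
      by simp
    then show ?thesis
      unfolding s[of A] s[of B] right_diff_distrib[symmetric] norm_mult norm_of_real
      using K by (simp add: mult_left_mono)
  qed
  have eq: "Determinant.det A - Determinant.det B = (\<Sum>\<sigma>\<in>?P. perm_sign \<sigma> * ((\<Prod>i<k. A $$ (i, \<sigma> i)) - (\<Prod>i<k. B $$ (i, \<sigma> i))))"
    unfolding det_def'[OF A] det_def'[OF B] atLeast0LessThan by (simp add: sum_subtractf right_diff_distrib)
  have "cmod (Determinant.det A - Determinant.det B) \<le> (\<Sum>\<sigma>\<in>?P. cmod (perm_sign \<sigma> * ((\<Prod>i<k. A $$ (i, \<sigma> i)) - (\<Prod>i<k. B $$ (i, \<sigma> i)))))"
    unfolding eq by (rule norm_sum)
  also have "\<dots> \<le> (\<Sum>\<sigma>\<in>?P. K ^ k * (real k * \<epsilon>))"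
    by (intro sum_mono) (use one in \<open>simp add: norm_mult sign_def\<close>)
  also have "\<dots> = fact k * (K ^ k * (real k * \<epsilon>))"
    using card_permutations[of "{..<k}" k] by simp
  finally show ?thesis .
qed

section \<open>A lower bound for the reversed characteristic polynomial\<close>

lemma minor_sum_cong:
  assumes "\<And>e. e \<in> {..<n} \<times> {..<n} \<Longrightarrow> x e = y e"
  shows "minor_sum n k x = minor_sum n k y"
  unfolding minor_sum_double
proof (rule sum.cong[OF refl], rule sum.cong[OF refl])
  fix I \<sigma> assume I: "I \<in> {I. I \<subseteq> {..<n} \<and> card I = k}" and s: "\<sigma> \<in> {\<sigma>. \<sigma> permutes I}"
  have "(\<Prod>i\<in>I. x (i, \<sigma> i)) = (\<Prod>i\<in>I. y (i, \<sigma> i))"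
  proof (rule prod.cong[OF refl])
    fix i assume i: "i \<in> I"
    have "\<sigma> i \<in> I" using permutes_in_image[of \<sigma> I i] s i by blast
    then show "x (i, \<sigma> i) = y (i, \<sigma> i)" using I i by (intro assms) blast
  qed
  then show "perm_sign \<sigma> * (\<Prod>i\<in>I. x (i, \<sigma> i)) = perm_sign \<sigma> * (\<Prod>i\<in>I. y (i, \<sigma> i))" by (simp only:)
qed

text \<open>By the recursion \<open>k * cmod (h k) * R ^ k\<close> is at most \<open>B\<close> times
  a bound for the earlier terms. For \<open>k \<le> N\<close> this costs a factor \<open>B\<close>;
  for larger \<open>k\<close> the division by \<open>k\<close> outweighs \<open>B\<close> and the
  bound stops growing. Hence \<open>B ^ N\<close> serves for all \<open>k\<close>, independently of
  \<open>K\<close>.\<close>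

lemma newton_coeff_bound:
  fixes h t :: "nat \<Rightarrow> complex" and R B :: real
  assumes h0: "h 0 = 1" and rec: "\<And>k. k \<ge> 1 \<Longrightarrow> of_nat k * h k = (\<Sum>m=1..k. t m * h (k - m))"
    and R: "R > 0" and B: "B \<ge> 1" "real N \<ge> B" and tB: "(\<Sum>m=1..K. cmod (t m) * R ^ m) \<le> B"
  shows "k \<le> K \<Longrightarrow> cmod (h k) * R ^ k \<le> B ^ min k N"
proof (induction k rule: less_induct)
  case (less k)
  show ?case
  proof (cases "k = 0")
    case True
    then show ?thesis using h0 by simp
  next
    case False
    then have k: "k \<ge> 1" by simp
    define Q where "Q = B ^ min (k - 1) N"
    have Q: "Q \<ge> 0" using B by (simp add: Q_def)
    have "real k * (cmod (h k) * R ^ k) = cmod (of_nat k * h k) * R ^ k" by (simp add: norm_mult)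
    also have "\<dots> \<le> (\<Sum>m=1..k. cmod (t m * h (k - m))) * R ^ k"
      unfolding rec[OF k] using R by (intro mult_right_mono norm_sum) auto
    also have "\<dots> = (\<Sum>m=1..k. (cmod (t m) * R ^ m) * (cmod (h (k - m)) * R ^ (k - m)))"
      unfolding sum_distrib_right
    proof (rule sum.cong[OF refl])
      fix m assume "m \<in> {1..k}"
      then have "R ^ k = R ^ m * R ^ (k - m)" by (simp flip: power_add)
      then show "cmod (t m * h (k - m)) * R ^ k = (cmod (t m) * R ^ m) * (cmod (h (k - m)) * R ^ (k - m))"
        by (simp add: norm_mult)
    qed
    also have "\<dots> \<le> (\<Sum>m=1..k. (cmod (t m) * R ^ m) * Q)"
    proof (rule sum_mono)
      fix m assume m: "m \<in> {1..k}"
      have "cmod (h (k - m)) * R ^ (k - m) \<le> B ^ min (k - m) N" using m less.prems by (intro less.IH) auto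
      also have "\<dots> \<le> Q" unfolding Q_def using B m by (intro power_increasing) auto
      finally show "(cmod (t m) * R ^ m) * (cmod (h (k - m)) * R ^ (k - m)) \<le> (cmod (t m) * R ^ m) * Q"
        using R by (intro mult_left_mono) auto
    qed
    also have "\<dots> = (\<Sum>m=1..k. cmod (t m) * R ^ m) * Q" by (rule sum_distrib_right[symmetric])
    also have "\<dots> \<le> (\<Sum>m=1..K. cmod (t m) * R ^ m) * Q"
      using Q R less.prems by (intro mult_right_mono sum_mono2) auto
    also have "\<dots> \<le> B * Q" using tB Q by (intro mult_right_mono)
    finally have le: "real k * (cmod (h k) * R ^ k) \<le> B * Q" .
    show ?thesis
    proof (cases "k \<le> N")
      case True
      obtain l where l: "k = Suc l" using k by (cases k) auto
      have "B * Q = B ^ min k N" using True by (simp add: Q_def l)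
      moreover have "1 * (cmod (h k) * R ^ k) \<le> real k * (cmod (h k) * R ^ k)"
        using k R by (intro mult_right_mono) auto
      ultimately show ?thesis using le by simp
    next
      case False
      then have "min (k - 1) N = N" "min k N = N" by auto
      then have "Q = B ^ min k N" by (simp only: Q_def)
      moreover have "B * Q \<le> real k * Q" using False B Q by (intro mult_right_mono) auto
      ultimately have "real k * (cmod (h k) * R ^ k) \<le> real k * B ^ min k N" using le by simp
      then show ?thesis using k by (simp only: mult_le_cancel_left_pos of_nat_0_less_iff less_eq_Suc_le One_nat_def)
    qed
  qed
qed

lemma sum_geometric_le:
  fixes q :: real
  assumes "0 \<le> q" "q < 1"
  shows "(\<Sum>j\<le>K. q ^ j) \<le> 1 / (1 - q)"
proof -
  have "(\<Sum>j\<in>{..K}. q ^ j) \<le> (\<Sum>j. q ^ j)"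
    by (rule sum_le_suminf) (use assms in \<open>auto intro: summable_geometric\<close>)
  also have "\<dots> = 1 / (1 - q)" using assms by (intro suminf_geometric) auto
  finally show ?thesis .
qed

text \<open>A truncation \<open>H\<close> of the reciprocal of the second determinant is an approximate reciprocal of
  the first one. A bound for \<open>H\<close> is a lower bound for the determinant.\<close>

lemma series_lower_bound:
  fixes a a' h :: "nat \<Rightarrow> complex" and r R S D \<epsilon> :: real
  assumes r: "0 < r" "r < R" "r \<le> 1" and nK: "K \<le> n"
    and h: "h 0 = 1" "a' 0 = 1" "\<And>k. k \<ge> 1 \<Longrightarrow> (\<Sum>i\<le>k. (-1) ^ i * a' i * h (k - i)) = 0"
    and hD: "\<And>k. k \<le> K \<Longrightarrow> cmod (h k) * R ^ k \<le> D"
    and aS: "(\<Sum>i\<le>n. cmod (a i) * R ^ i) \<le> S" and aS': "(\<Sum>i\<le>K. cmod (a' i) * R ^ i) \<le> S"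
    and aa: "(\<Sum>i\<le>K. cmod (a i - a' i)) \<le> \<epsilon>"
    and small: "(r / R) ^ K * S * (D * (real K + 1)) \<le> 1 / 8" "\<epsilon> * (D / (1 - r / R)) \<le> 1 / 8"
      "(r / R) ^ K * S * (D / (1 - r / R)) \<le> 1 / 8"
    and z: "cmod z \<le> r"
  shows "cmod (\<Sum>i\<le>n. (-z) ^ i * a i) \<ge> (1 - r / R) / (2 * D)"
proof -
  define q where "q = r / R"
  have q: "0 < q" "q < 1" "r = q * R" using r by (auto simp: q_def)
  have R: "R > 0" using r by simp
  have D: "D \<ge> 1" using hD[of 0] h(1) by simp
  have S: "S \<ge> 0" using aS R by (meson order_trans sum_nonneg mult_nonneg_nonneg norm_ge_zero zero_le_power less_imp_le)
  have zr: "cmod z ^ i \<le> q ^ i * R ^ i" for i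
  proof -
    have "cmod z ^ i \<le> r ^ i" using z by (intro power_mono) auto
    then show ?thesis by (simp add: q(3) power_mult_distrib)
  qed
  have z1: "cmod z ^ i \<le> 1" for i using z r by (intro power_le_one) auto
  define H where "H = (\<Sum>j\<le>K. h j * z ^ j)"
  define P where "P = (\<Sum>i\<le>K. (-z) ^ i * a' i)"
  have Hn: "cmod H \<le> D / (1 - q)"
  proof -
    have "cmod H \<le> (\<Sum>j\<le>K. cmod (h j) * cmod z ^ j)"
      unfolding H_def by (rule order_trans[OF norm_sum]) (simp add: norm_mult norm_power)
    also have "\<dots> \<le> (\<Sum>j\<le>K. D * q ^ j)"
    proof (rule sum_mono)
      fix j assume "j \<in> {..K}"
      then have "cmod (h j) * R ^ j \<le> D" by (intro hD) simp
      then have "(cmod (h j) * R ^ j) * q ^ j \<le> D * q ^ j" using q by (intro mult_right_mono) auto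
      moreover have "cmod (h j) * cmod z ^ j \<le> cmod (h j) * (q ^ j * R ^ j)"
        by (intro mult_left_mono zr) auto
      ultimately show "cmod (h j) * cmod z ^ j \<le> D * q ^ j" by (simp add: mult_ac)
    qed
    also have "\<dots> = D * (\<Sum>j\<le>K. q ^ j)" by (rule sum_distrib_left[symmetric])
    also have "\<dots> \<le> D * (1 / (1 - q))" using D q by (intro mult_left_mono sum_geometric_le) auto
    finally show ?thesis by simp
  qed
  \<comment> \<open>In the product of the truncated series the terms of degree up to
    \<open>K\<close> add up to 1 by the convolution identity; every other term has degree above
    \<open>K\<close> and gains the factor \<open>q ^ K\<close>.\<close>
  have PH: "cmod (P * H - 1) \<le> q ^ K * S * (D * (real K + 1))"
  proof -
    let ?g = "\<lambda>i j. (-1) ^ i * a' i * h j * z ^ (i + j)"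
    let ?Q = "{..K} \<times> {..K}" and ?L = "{(i, j). i + j \<le> K}"
    have PHs: "P * H = (\<Sum>(i, j)\<in>?Q. ?g i j)"
      unfolding P_def H_def sum_product sum.cartesian_product
      by (rule sum.cong[OF refl]) (auto simp: power_add power_minus[of z] mult_ac)
    have "(\<Sum>(i, j)\<in>?Q. ?g i j) = (\<Sum>(i, j)\<in>?Q \<inter> ?L. ?g i j) + (\<Sum>(i, j)\<in>?Q - ?L. ?g i j)"
      by (rule sum.Int_Diff) simp
    also have "(\<Sum>(i, j)\<in>?Q \<inter> ?L. ?g i j) = (\<Sum>(i, j)\<in>{(i, j). i + j \<le> K}. ?g i j)"
      by (rule sum.cong) auto
    also have "\<dots> = (\<Sum>k\<le>K. \<Sum>i\<le>k. ?g i (k - i))"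
      by (rule sum.triangle_reindex_eq)
    also have "\<dots> = (\<Sum>k\<le>K. z ^ k * (\<Sum>i\<le>k. (-1) ^ i * a' i * h (k - i)))"
      unfolding sum_distrib_left by (rule sum.cong[OF refl], rule sum.cong[OF refl]) (simp add: mult_ac)
    also have "\<dots> = (\<Sum>k\<le>K. if k = 0 then 1 else 0)"
    proof (rule sum.cong[OF refl])
      fix k :: nat
      show "z ^ k * (\<Sum>i\<le>k. (-1) ^ i * a' i * h (k - i)) = (if k = 0 then 1 else 0)"
        using h(3)[of k] h(1,2) by (cases "k = 0") simp_all
    qed
    also have "\<dots> = 1" by simp
    finally have e: "P * H - 1 = (\<Sum>(i, j)\<in>?Q - ?L. ?g i j)" unfolding PHs by simp
    have "cmod (P * H - 1) \<le> (\<Sum>(i, j)\<in>?Q - ?L. cmod (?g i j))"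
      unfolding e by (rule order_trans[OF norm_sum]) (simp add: case_prod_beta)
    also have "\<dots> \<le> (\<Sum>(i, j)\<in>?Q - ?L. q ^ K * ((cmod (a' i) * R ^ i) * D))"
    proof (rule sum_mono)
      fix t assume "t \<in> ?Q - ?L"
      then obtain i j where t: "t = (i, j)" and ij: "i \<in> {..K}" "j \<in> {..K}" "(i, j) \<notin> ?L" by blast
      have "cmod (?g i j) = cmod (a' i) * cmod (h j) * cmod z ^ (i + j)" by (simp add: norm_mult norm_power)
      also have "\<dots> \<le> cmod (a' i) * cmod (h j) * (q ^ (i + j) * R ^ (i + j))"
        by (intro mult_left_mono zr) auto
      also have "\<dots> = q ^ (i + j) * ((cmod (a' i) * R ^ i) * (cmod (h j) * R ^ j))"
        by (simp add: power_add mult_ac)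
      also have "\<dots> \<le> q ^ K * ((cmod (a' i) * R ^ i) * D)"
        using ij q R hD[of j] by (intro mult_mono power_decreasing mult_left_mono mult_nonneg_nonneg) auto
      finally show "(case t of (i, j) \<Rightarrow> cmod (?g i j)) \<le> (case t of (i, j) \<Rightarrow> q ^ K * ((cmod (a' i) * R ^ i) * D))"
        by (simp only: t case_prod_conv)
    qed
    also have "\<dots> \<le> (\<Sum>(i, j)\<in>?Q. q ^ K * ((cmod (a' i) * R ^ i) * D))"
      using q R D by (intro sum_mono2) (auto intro!: mult_nonneg_nonneg)
    also have "\<dots> = (\<Sum>i\<le>K. \<Sum>j\<le>K. q ^ K * ((cmod (a' i) * R ^ i) * D))"
      by (rule sum.cartesian_product[symmetric])
    also have "\<dots> = q ^ K * (\<Sum>i\<le>K. cmod (a' i) * R ^ i) * (D * (real K + 1))"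
      by (simp add: sum_distrib_left sum_distrib_right mult_ac add_ac)
    also have "\<dots> \<le> q ^ K * S * (D * (real K + 1))"
      using q D by (intro mult_right_mono mult_left_mono aS') auto
    finally show ?thesis .
  qed
  \<comment> \<open>The head is compared with \<open>a'\<close> coefficient by coefficient; the tail
    beyond \<open>K\<close> gains \<open>q ^ K\<close> because the sum of the \<open>a i\<close> is
    controlled against powers of the larger radius \<open>R\<close>.\<close>
  have dP: "cmod ((\<Sum>i\<le>n. (-z) ^ i * a i) - P) \<le> \<epsilon> + q ^ K * S"
  proof -
    have split: "{..n} = {..K} \<union> {K<..n}" using nK by auto
    have "(\<Sum>i\<le>n. (-z) ^ i * a i) = (\<Sum>i\<le>K. (-z) ^ i * a i) + (\<Sum>i\<in>{K<..n}. (-z) ^ i * a i)"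
      unfolding split by (rule sum.union_disjoint) auto
    then have "(\<Sum>i\<le>n. (-z) ^ i * a i) - P = (\<Sum>i\<le>K. (-z) ^ i * (a i - a' i)) + (\<Sum>i\<in>{K<..n}. (-z) ^ i * a i)"
      unfolding P_def by (simp add: right_diff_distrib sum_subtractf)
    then have "cmod ((\<Sum>i\<le>n. (-z) ^ i * a i) - P) \<le> cmod (\<Sum>i\<le>K. (-z) ^ i * (a i - a' i)) + cmod (\<Sum>i\<in>{K<..n}. (-z) ^ i * a i)"
      by (simp only: norm_triangle_ineq)
    also have "cmod (\<Sum>i\<le>K. (-z) ^ i * (a i - a' i)) \<le> (\<Sum>i\<le>K. cmod (a i - a' i))"
    proof (rule order_trans[OF norm_sum], rule sum_mono)
      fix i
      show "cmod ((-z) ^ i * (a i - a' i)) \<le> cmod (a i - a' i)"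
        using z1[of i] by (simp add: norm_mult norm_power mult_left_le_one_le)
    qed
    also have "cmod (\<Sum>i\<in>{K<..n}. (-z) ^ i * a i) \<le> (\<Sum>i\<in>{K<..n}. q ^ K * (cmod (a i) * R ^ i))"
    proof (rule order_trans[OF norm_sum], rule sum_mono)
      fix i assume i: "i \<in> {K<..n}"
      have "cmod ((-z) ^ i * a i) = cmod z ^ i * cmod (a i)" by (simp add: norm_mult norm_power)
      also have "\<dots> \<le> (q ^ i * R ^ i) * cmod (a i)" by (intro mult_right_mono zr) auto
      also have "\<dots> \<le> (q ^ K * R ^ i) * cmod (a i)"
        using i q R by (intro mult_right_mono power_decreasing) auto
      finally show "cmod ((-z) ^ i * a i) \<le> q ^ K * (cmod (a i) * R ^ i)" by (simp add: mult_ac)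
    qed
    also have "(\<Sum>i\<in>{K<..n}. q ^ K * (cmod (a i) * R ^ i)) \<le> (\<Sum>i\<le>n. q ^ K * (cmod (a i) * R ^ i))"
      using q R by (intro sum_mono2) auto
    also have "\<dots> = q ^ K * (\<Sum>i\<le>n. cmod (a i) * R ^ i)" by (rule sum_distrib_left[symmetric])
    also have "\<dots> \<le> q ^ K * S" using q by (intro mult_left_mono aS) auto
    finally show ?thesis using aa by simp
  qed
  let ?p = "\<Sum>i\<le>n. (-z) ^ i * a i"
  have "cmod (?p * H - 1) \<le> cmod (P * H - 1) + cmod (?p - P) * cmod H"
  proof -
    have "?p * H - 1 = (P * H - 1) + (?p - P) * H" by (simp add: algebra_simps)
    then show ?thesis by (metis norm_mult norm_triangle_ineq)
  qed
  also have "\<dots> \<le> q ^ K * S * (D * (real K + 1)) + (\<epsilon> + q ^ K * S) * (D / (1 - q))"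
    using dP Hn q S order_trans[OF norm_ge_zero dP] by (intro add_mono PH mult_mono) auto
  also have "\<dots> \<le> 1 / 2" using small unfolding q_def[symmetric] distrib_right by linarith
  finally have "cmod (?p * H - 1) \<le> 1 / 2" .
  then have "1 / 2 \<le> cmod (?p * H)"
    using norm_triangle_ineq2[of 1 "1 - ?p * H"] by (simp add: norm_minus_commute)
  also have "\<dots> \<le> cmod ?p * (D / (1 - q))" unfolding norm_mult using Hn by (intro mult_left_mono) auto
  finally show ?thesis using D q unfolding q_def[symmetric] by (simp add: field_simps)
qed

lemma walk_sum_cong:
  assumes "\<And>e. e \<in> {..<n} \<times> {..<n} \<Longrightarrow> x e = y e"
  shows "walk_sum n m x = walk_sum n m y"
  unfolding walk_sum_def
proof (rule sum.cong[OF refl], rule prod.cong[OF refl])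
  fix w t assume w: "w \<in> {..<m} \<rightarrow>\<^sub>E {..<n}" and t: "t \<in> {..<m}"
  have t': "(if Suc t = m then 0 else Suc t) \<in> {..<m}" using t by auto
  have "w t \<in> {..<n}" "w (if Suc t = m then 0 else Suc t) \<in> {..<n}"
    by (rule PiE_mem[OF w t], rule PiE_mem[OF w t'])
  then show "x (w t, w (if Suc t = m then 0 else Suc t)) = y (w t, w (if Suc t = m then 0 else Suc t))"
    by (intro assms) simp
qed

lemma minor_sum_0 [simp]: "minor_sum n 0 x = 1"
proof -
  have "{I. I \<subseteq> {..<n} \<and> card I = 0} = {{}}"
    by (auto dest: finite_subset[OF _ finite_lessThan])
  then show ?thesis unfolding minor_sum_double by simp
qed

lemma centered_L2_id: "standardized_law \<mu> \<Longrightarrow> centered_L2 \<mu> (\<lambda>z. z)"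
  by (simp add: standardized_law_def centered_L2_def)

text \<open>As the level grows, dominated convergence sends the second and third integral to 1, the
  value of the first, so the combination tends to \<open>1 - 2 + 1 = 0\<close>, simultaneously for
  the finitely many \<open>k \<le> K\<close>. The truncated variable is recentred but not rescaled,
  which keeps its second moment at most 1.\<close>

lemma truncation_exists:
  assumes \<mu>: "standardized_law \<mu>" and \<epsilon>: "\<epsilon> > 0"
  shows "\<exists>g \<beta>. \<beta> \<ge> 1 \<and> g \<in> borel_measurable borel \<and> (\<forall>z. cmod (g z) \<le> \<beta>) \<and> centered_L2 \<mu> g \<and>
    (LINT z|\<mu>. (cmod (g z))\<^sup>2) \<le> 1 \<and>
    (\<forall>k\<le>K. \<bar>(LINT z|\<mu>. (cmod z)\<^sup>2) ^ k - 2 * Re ((LINT z|\<mu>. z * cnj (g z)) ^ k) + (LINT z|\<mu>. (cmod (g z))\<^sup>2) ^ k\<bar> < \<epsilon>)"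
proof -
  interpret mu: prob_space \<mu> using \<mu> by (simp add: standardized_law_def)
  have sets: "sets \<mu> = sets borel" and i2: "integrable \<mu> (\<lambda>z. (cmod z)\<^sup>2)"
    and m0: "(LINT z|\<mu>. z) = 0" and v1: "(LINT z|\<mu>. (cmod z)\<^sup>2) = 1"
    using \<mu> by (auto simp: standardized_law_def)
  have meas: "f \<in> borel_measurable \<mu> \<longleftrightarrow> f \<in> borel_measurable borel" for f :: "complex \<Rightarrow> 'b::topological_space"
    using measurable_cong_sets[OF sets refl] by blast
  define \<tau> where "\<tau> = (\<lambda>(l::nat) z. if cmod z \<le> real l then z else 0)"
  define c where "c = (\<lambda>l. LINT z|\<mu>. \<tau> l z)"
  define g where "g = (\<lambda>l z. \<tau> l z - c l)"
  define s where "s = (\<lambda>l. LINT z|\<mu>. (cmod (\<tau> l z))\<^sup>2)"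
  have \<tau>m: "\<tau> l \<in> borel_measurable borel" for l unfolding \<tau>_def by measurable
  have \<tau>m': "\<tau> l \<in> borel_measurable \<mu>" for l using \<tau>m meas by blast
  have idm: "(\<lambda>z. z) \<in> borel_measurable \<mu>" unfolding meas by measurable
  have \<tau>b: "cmod (\<tau> l z) \<le> real l" for l z by (simp add: \<tau>_def)
  have \<tau>i: "integrable \<mu> (\<tau> l)" for l by (rule mu.integrable_const_bound[OF AE_I2[OF \<tau>b] \<tau>m'])
  have i1: "integrable \<mu> (\<lambda>z. cmod z)"
    by (rule mu.square_integrable_imp_integrable[OF _ i2]) (use idm in auto)
  have idi: "integrable \<mu> (\<lambda>z. z)" using i1 idm by (simp add: integrable_norm_iff)
  have \<tau>2i: "integrable \<mu> (\<lambda>z. (cmod (\<tau> l z))\<^sup>2)" for l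
    by (rule Bochner_Integration.integrable_bound[OF i2]) (use \<tau>m' in \<open>auto simp: \<tau>_def\<close>)
  have ev: "eventually (\<lambda>l. \<tau> l z = z) sequentially" for z
    unfolding \<tau>_def eventually_sequentially
    by (intro exI[of _ "nat \<lceil>cmod z\<rceil>"]) (auto simp: nat_le_iff ceiling_le_iff)
  have c_lim: "c \<longlonglongrightarrow> 0"
  proof -
    have "(\<lambda>l. LINT z|\<mu>. \<tau> l z) \<longlonglongrightarrow> (LINT z|\<mu>. z)"
    proof (rule integral_dominated_convergence[of _ _ _ "\<lambda>z. cmod z"])
      show "AE z in \<mu>. (\<lambda>l. \<tau> l z) \<longlonglongrightarrow> z" by (intro AE_I2 tendsto_eventually ev)
      show "AE z in \<mu>. norm (\<tau> l z) \<le> cmod z" for l by (intro AE_I2) (simp add: \<tau>_def)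
    qed (use i1 idm \<tau>m' in auto)
    then show ?thesis by (simp add: c_def m0)
  qed
  have s_lim: "s \<longlonglongrightarrow> 1"
  proof -
    have "(\<lambda>l. LINT z|\<mu>. (cmod (\<tau> l z))\<^sup>2) \<longlonglongrightarrow> (LINT z|\<mu>. (cmod z)\<^sup>2)"
    proof (rule integral_dominated_convergence[of _ _ _ "\<lambda>z. (cmod z)\<^sup>2"])
      show "AE z in \<mu>. (\<lambda>l. (cmod (\<tau> l z))\<^sup>2) \<longlonglongrightarrow> (cmod z)\<^sup>2"
      proof (intro AE_I2 tendsto_eventually)
        fix z
        show "\<forall>\<^sub>F l in sequentially. (cmod (\<tau> l z))\<^sup>2 = (cmod z)\<^sup>2"
          using ev[of z] by eventually_elim simp
      qed
      show "AE z in \<mu>. norm ((cmod (\<tau> l z))\<^sup>2) \<le> (cmod z)\<^sup>2" for l by (intro AE_I2) (simp add: \<tau>_def)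
    qed (use i2 idm \<tau>m' in auto)
    then show ?thesis by (simp add: s_def v1)
  qed
  have gm: "g l \<in> borel_measurable borel" for l unfolding g_def using \<tau>m[of l] by measurable
  have gb: "cmod (g l z) \<le> real l + cmod (c l)" for l z
    unfolding g_def using \<tau>b[of l z] norm_triangle_ineq4[of "\<tau> l z" "c l"] by linarith
  have g0: "(LINT z|\<mu>. g l z) = 0" for l
    unfolding g_def using \<tau>i[of l] by (simp add: c_def mu.prob_space)
  have cnjc: "cnj (complex_of_real x) = complex_of_real x" for x by simp
  have cnjm: "cnj \<in> borel_measurable borel"
    by (intro borel_measurable_continuous_onI continuous_intros)
  \<comment> \<open>The mean zero of \<open>z\<close> removes the recentring constant, and
    \<open>z\<close> times the conjugate of its truncation is the squared modulus of the
    truncation.\<close>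
  have bv: "(LINT z|\<mu>. z * cnj (g l z)) = complex_of_real (s l)" for l
  proof -
    have "z * cnj (g l z) = complex_of_real ((cmod (\<tau> l z))\<^sup>2) - cnj (c l) * z" for z
      by (simp add: g_def \<tau>_def complex_norm_square algebra_simps del: of_real_power)
    moreover have "integrable \<mu> (\<lambda>z. complex_of_real ((cmod (\<tau> l z))\<^sup>2))"
      using \<tau>2i[of l] by (simp del: of_real_power)
    ultimately have "(LINT z|\<mu>. z * cnj (g l z)) = (LINT z|\<mu>. complex_of_real ((cmod (\<tau> l z))\<^sup>2)) - (LINT z|\<mu>. cnj (c l) * z)"
      using idi by (simp del: of_real_power)
    also have "\<dots> = complex_of_real (s l)" using m0 by (simp add: s_def del: of_real_power)
    finally show ?thesis .
  qed
  have dv: "(LINT z|\<mu>. (cmod (g l z))\<^sup>2) = s l - (cmod (c l))\<^sup>2" for l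
  proof -
    have e: "complex_of_real ((cmod (g l z))\<^sup>2) = (complex_of_real ((cmod (\<tau> l z))\<^sup>2) - cnj (c l) * \<tau> l z) -
       (c l * cnj (\<tau> l z) - complex_of_real ((cmod (c l))\<^sup>2))" for z
      unfolding complex_norm_square g_def by (simp add: algebra_simps)
    have ci: "integrable \<mu> (\<lambda>z. cnj (\<tau> l z))" using \<tau>i[of l] by simp
    have ti: "integrable \<mu> (\<lambda>z. complex_of_real ((cmod (\<tau> l z))\<^sup>2))"
      using \<tau>2i[of l] by (simp del: of_real_power)
    have "complex_of_real (LINT z|\<mu>. (cmod (g l z))\<^sup>2) = (LINT z|\<mu>. complex_of_real ((cmod (g l z))\<^sup>2))"
      by (simp del: of_real_power)
    also have "\<dots> = (LINT z|\<mu>. (complex_of_real ((cmod (\<tau> l z))\<^sup>2) - cnj (c l) * \<tau> l z)) -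
       (LINT z|\<mu>. (c l * cnj (\<tau> l z) - complex_of_real ((cmod (c l))\<^sup>2)))"
      unfolding e using ti ci \<tau>i[of l]
      by (intro Bochner_Integration.integral_diff Bochner_Integration.integrable_diff integrable_mult_right) auto
    also have "(LINT z|\<mu>. (complex_of_real ((cmod (\<tau> l z))\<^sup>2) - cnj (c l) * \<tau> l z)) = complex_of_real (s l) - cnj (c l) * c l"
      using ti \<tau>i[of l] by (simp add: s_def c_def del: of_real_power)
    also have "(LINT z|\<mu>. (c l * cnj (\<tau> l z) - complex_of_real ((cmod (c l))\<^sup>2))) = c l * cnj (c l) - complex_of_real ((cmod (c l))\<^sup>2)"
      using ci by (simp add: c_def mu.prob_space del: of_real_power)
    also have "complex_of_real (s l) - cnj (c l) * c l - (c l * cnj (c l) - complex_of_real ((cmod (c l))\<^sup>2)) =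
        complex_of_real (s l - (cmod (c l))\<^sup>2)"
      unfolding of_real_diff complex_norm_square by simp
    finally show ?thesis by (simp only: of_real_eq_iff)
  qed
  have s1: "s l \<le> 1" for l
    unfolding s_def v1[symmetric] by (rule integral_mono[OF \<tau>2i i2]) (simp add: \<tau>_def)
  have "(\<lambda>l. \<bar>1 ^ k - 2 * s l ^ k + (s l - (cmod (c l))\<^sup>2) ^ k\<bar>) \<longlonglongrightarrow> \<bar>1 ^ k - 2 * 1 ^ k + (1 - (cmod (0::complex))\<^sup>2) ^ k\<bar>" for k
    by (intro tendsto_intros s_lim c_lim)
  then have "eventually (\<lambda>l. \<bar>1 ^ k - 2 * s l ^ k + (s l - (cmod (c l))\<^sup>2) ^ k\<bar> < \<epsilon>) sequentially" for k
    using \<epsilon> by (intro order_tendstoD(2)) auto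
  then have "eventually (\<lambda>l. \<forall>k\<in>{..K}. \<bar>1 ^ k - 2 * s l ^ k + (s l - (cmod (c l))\<^sup>2) ^ k\<bar> < \<epsilon>) sequentially"
    by (intro eventually_ball_finite) auto
  from eventually_happens'[OF sequentially_bot this]
  obtain l where l: "\<forall>k\<in>{..K}. \<bar>1 ^ k - 2 * s l ^ k + (s l - (cmod (c l))\<^sup>2) ^ k\<bar> < \<epsilon>"
    by (rule exE)
  show ?thesis
  proof (intro exI[of _ "g l"] exI[of _ "1 + real l + cmod (c l)"] conjI allI impI)
    show "centered_L2 \<mu> (g l)"
    proof -
      have "integrable \<mu> (\<lambda>z. (cmod (g l z))\<^sup>2)"
      proof (rule mu.integrable_const_bound[of _ "(real l + cmod (c l))\<^sup>2"])
        show "AE z in \<mu>. norm ((cmod (g l z))\<^sup>2) \<le> (real l + cmod (c l))\<^sup>2"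
          using gb[of l] by (intro AE_I2) (simp add: power_mono)
        show "(\<lambda>z. (cmod (g l z))\<^sup>2) \<in> borel_measurable \<mu>" using gm[of l] unfolding meas by measurable
      qed
      then show ?thesis using gm g0 by (simp add: centered_L2_def)
    qed
    show "cmod (g l z) \<le> 1 + real l + cmod (c l)" for z using gb[of l z] by simp
    show "(LINT z|\<mu>. (cmod (g l z))\<^sup>2) \<le> 1" unfolding dv using s1[of l] zero_le_power2[of "cmod (c l)"] by linarith
    show "\<bar>(LINT z|\<mu>. (cmod z)\<^sup>2) ^ k - 2 * Re ((LINT z|\<mu>. z * cnj (g l z)) ^ k) + (LINT z|\<mu>. (cmod (g l z))\<^sup>2) ^ k\<bar> < \<epsilon>"
      if "k \<le> K" for k
      using l that unfolding v1 bv dv by (simp flip: of_real_power)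
  qed (use gm in auto)
qed

section \<open>Markov's inequality for weighted sums of coefficients\<close>

context prob_space
begin

lemma markov_event:
  assumes "integrable M F" "\<And>\<omega>. 0 \<le> F \<omega>" "expectation F \<le> \<gamma> * t" "0 < t"
  shows "{\<omega> \<in> space M. F \<omega> \<le> t} \<in> events" "prob {\<omega> \<in> space M. F \<omega> \<le> t} \<ge> 1 - \<gamma>"
proof -
  have m [measurable]: "F \<in> borel_measurable M" using assms(1) by auto
  show ev: "{\<omega> \<in> space M. F \<omega> \<le> t} \<in> events" by measurable
  have "prob (space M - {\<omega> \<in> space M. F \<omega> \<le> t}) \<le> prob {\<omega> \<in> space M. F \<omega> \<ge> t}"
    by (rule finite_measure_mono) auto
  also have "\<dots> \<le> expectation F / t"
    by (rule integral_Markov_inequality_measure[where A = "{}"]) (use assms in auto)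
  also have "\<dots> \<le> \<gamma>" using assms(3,4) by (simp add: divide_le_eq)
  finally show "prob {\<omega> \<in> space M. F \<omega> \<le> t} \<ge> 1 - \<gamma>" using prob_compl[OF ev] by simp
qed

lemma prob_Int_ge:
  assumes "A \<in> events" "B \<in> events" "prob A \<ge> 1 - a" "prob B \<ge> 1 - b"
  shows "A \<inter> B \<in> events" "prob (A \<inter> B) \<ge> 1 - (a + b)"
proof -
  show "A \<inter> B \<in> events" using assms by auto
  have "prob (A \<union> B) = prob A + prob B - prob (A \<inter> B)"
    using finite_measure_Union'[of A B] finite_measure_Diff'[of B A] assms(1,2)
    by (simp add: Int_commute)
  then show "prob (A \<inter> B) \<ge> 1 - (a + b)" using assms(3,4) prob_le_1[of "A \<union> B"] by linarith
qed

end

context iid_array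
begin

lemma measurable_entry: "f \<in> borel_measurable borel \<Longrightarrow> e \<in> E \<Longrightarrow> (\<lambda>\<omega>. f (Y e \<omega>)) \<in> borel_measurable M"
  by (rule measurable_compose[OF Y_measurable])

lemma measurable_chaos:
  fixes a :: "'i \<Rightarrow> complex"
  assumes "f \<in> borel_measurable borel" and "\<And>t. t \<in> J \<Longrightarrow> S t \<subseteq> E"
  shows "(\<lambda>\<omega>. \<Sum>t\<in>J. a t * (\<Prod>e\<in>S t. f (Y e \<omega>))) \<in> borel_measurable M"
proof (intro borel_measurable_sum borel_measurable_times borel_measurable_const borel_measurable_prod
    measurable_entry[OF assms(1)])
  show "e \<in> E" if "t \<in> J" "e \<in> S t" for t e by (rule subsetD[OF assms(2)[OF that(1)] that(2)])
qed

lemma measurable_minor_sum: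
  assumes "f \<in> borel_measurable borel"
  shows "(\<lambda>\<omega>. minor_sum n k (\<lambda>e. f (Y e \<omega>))) \<in> borel_measurable M"
proof -
  have "minor_sum n k (\<lambda>e. f (Y e \<omega>)) = (\<Sum>t\<in>minor_idx n k. perm_sign (snd t) * (\<Prod>e\<in>(case t of (I, \<sigma>) \<Rightarrow> perm_graph I \<sigma>). f (Y e \<omega>)))" for \<omega>
    by (simp add: minor_sum_def case_prod_beta)
  moreover have "(\<lambda>\<omega>. \<Sum>t\<in>minor_idx n k. perm_sign (snd t) * (\<Prod>e\<in>(case t of (I, \<sigma>) \<Rightarrow> perm_graph I \<sigma>). f (Y e \<omega>))) \<in> borel_measurable M"
    by (rule measurable_chaos[OF assms minor_graph_subset])
  ultimately show ?thesis by (simp only:)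
qed

lemma measurable_walk_sum:
  assumes "f \<in> borel_measurable borel"
  shows "(\<lambda>\<omega>. walk_sum n m (\<lambda>e. f (Y e \<omega>))) \<in> borel_measurable M"
  unfolding walk_sum_def
proof (intro borel_measurable_sum borel_measurable_prod measurable_entry[OF assms])
  fix w t assume w: "w \<in> {..<m} \<rightarrow>\<^sub>E {..<n}" and t: "t \<in> {..<m}"
  have t': "(if Suc t = m then 0 else Suc t) \<in> {..<m}" using t by auto
  have "w t \<in> {..<n}" "w (if Suc t = m then 0 else Suc t) \<in> {..<n}"
    by (rule PiE_mem[OF w t], rule PiE_mem[OF w t'])
  then show "(w t, w (if Suc t = m then 0 else Suc t)) \<in> E" by simp
qed

lemma measurable_open_closed:
  assumes "f \<in> borel_measurable borel"
  shows "(\<lambda>\<omega>. open_coeff n k u v (\<lambda>e. f (Y e \<omega>)) - closed_coeff n k u v (\<lambda>e. f (Y e \<omega>))) \<in> borel_measurable M"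
proof -
  let ?a = "\<lambda>(I, \<sigma>). (\<Sum>b\<in>I. u b * v b) * perm_sign \<sigma>" and ?b = "\<lambda>(b, I, \<sigma>). u b * v (\<sigma> b) * perm_sign \<sigma>"
  have "closed_coeff n k u v (\<lambda>e. f (Y e \<omega>)) = (\<Sum>t\<in>minor_idx n k. ?a t * (\<Prod>e\<in>(case t of (I, \<sigma>) \<Rightarrow> perm_graph I \<sigma>). f (Y e \<omega>)))"
    and "open_coeff n k u v (\<lambda>e. f (Y e \<omega>)) = (\<Sum>t\<in>open_idx n k. ?b t * (\<Prod>e\<in>(case t of (b, I, \<sigma>) \<Rightarrow> perm_graph I \<sigma>). f (Y e \<omega>)))" for \<omega>
    by (simp_all add: closed_coeff_def open_coeff_def case_prod_beta)
  moreover have "(\<lambda>\<omega>. \<Sum>t\<in>minor_idx n k. ?a t * (\<Prod>e\<in>(case t of (I, \<sigma>) \<Rightarrow> perm_graph I \<sigma>). f (Y e \<omega>))) \<in> borel_measurable M"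
    by (rule measurable_chaos[OF assms minor_graph_subset])
  moreover have "(\<lambda>\<omega>. \<Sum>t\<in>open_idx n k. ?b t * (\<Prod>e\<in>(case t of (b, I, \<sigma>) \<Rightarrow> perm_graph I \<sigma>). f (Y e \<omega>))) \<in> borel_measurable M"
    by (rule measurable_chaos[OF assms open_graph_subset])
  ultimately show ?thesis by (simp only: borel_measurable_diff)
qed

text \<open>One weighted sum stands for a whole list of coefficients, so that a single use of
  Markov's inequality controls a number of them that may grow with \<open>n\<close>.\<close>

lemma expectation_weighted_sum_le:
  fixes Z :: "'i \<Rightarrow> 'w \<Rightarrow> complex"
  assumes "finite J" "\<And>i. i \<in> J \<Longrightarrow> Z i \<in> borel_measurable M"
    and "\<And>i. i \<in> J \<Longrightarrow> integrable M (\<lambda>\<omega>. (cmod (Z i \<omega>))\<^sup>2)"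
    and "\<And>i. i \<in> J \<Longrightarrow> expectation (\<lambda>\<omega>. (cmod (Z i \<omega>))\<^sup>2) \<le> (b i)\<^sup>2" "\<And>i. i \<in> J \<Longrightarrow> b i \<ge> 0"
    and "\<And>i. i \<in> J \<Longrightarrow> a i \<ge> 0"
  shows "integrable M (\<lambda>\<omega>. \<Sum>i\<in>J. cmod (Z i \<omega>) * a i)"
    and "expectation (\<lambda>\<omega>. \<Sum>i\<in>J. cmod (Z i \<omega>) * a i) \<le> (\<Sum>i\<in>J. b i * a i)"
proof -
  have I: "integrable M (\<lambda>\<omega>. cmod (Z i \<omega>) * a i)" if "i \<in> J" for i
    using expectation_norm_le(1)[OF assms(2,3)[OF that]] by simp
  show "integrable M (\<lambda>\<omega>. \<Sum>i\<in>J. cmod (Z i \<omega>) * a i)"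
    by (rule Bochner_Integration.integrable_sum[OF I])
  have "expectation (\<lambda>\<omega>. \<Sum>i\<in>J. cmod (Z i \<omega>) * a i) = (\<Sum>i\<in>J. expectation (\<lambda>\<omega>. cmod (Z i \<omega>)) * a i)"
    by (subst Bochner_Integration.integral_sum[OF I]) simp_all
  also have "\<dots> \<le> (\<Sum>i\<in>J. b i * a i)"
  proof (intro sum_mono mult_right_mono assms(6))
    fix i assume i: "i \<in> J"
    have "sqrt (expectation (\<lambda>\<omega>. (cmod (Z i \<omega>))\<^sup>2)) \<le> b i"
      using assms(4)[OF i] assms(5)[OF i] by (rule real_le_lsqrt[rotated])
    with expectation_norm_le(2)[OF assms(2,3)[OF i]]
    show "expectation (\<lambda>\<omega>. cmod (Z i \<omega>)) \<le> b i" by (rule order_trans)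
  qed
  finally show "expectation (\<lambda>\<omega>. \<Sum>i\<in>J. cmod (Z i \<omega>) * a i) \<le> (\<Sum>i\<in>J. b i * a i)" .
qed

end

text \<open>Comparison with the second derivative of the geometric series. The coefficients
  \<open>3 * m ^ 2\<close> are the bounds for the mean moduli of the power sums.\<close>

lemma summable_square_power:
  fixes R :: real
  assumes "0 < R" "R < 1"
  shows "\<exists>T\<ge>0. \<forall>K. (\<Sum>m=1..K. 3 * (real m)\<^sup>2 * R ^ m) \<le> T"
proof -
  have 1: "summable (\<lambda>n. (1::real) * x ^ n)" if "norm x < 1" for x :: real
    using that by (simp add: summable_geometric)
  have 2: "summable (\<lambda>n. diffs (\<lambda>_. 1) n * x ^ n)" if "norm x < 1" for x :: real
    by (rule termdiff_converges[OF that 1])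
  have 3: "summable (\<lambda>n. diffs (diffs (\<lambda>_. 1)) n * R ^ n)"
    by (rule termdiff_converges[of R 1]) (use assms 2 in auto)
  have 4: "3 * (real m)\<^sup>2 * R ^ m \<le> 3 * (diffs (diffs (\<lambda>_. 1)) m * R ^ m)" for m
  proof -
    have "(real m)\<^sup>2 \<le> real (Suc m) * real (Suc (Suc m))"
      unfolding power2_eq_square by (intro mult_mono) auto
    then have "(real m)\<^sup>2 * R ^ m \<le> (real (Suc m) * real (Suc (Suc m))) * R ^ m"
      using assms by (intro mult_right_mono) auto
    then show ?thesis by (simp only: diffs_def mult_1_right mult.assoc)
  qed
  have nn: "0 \<le> 3 * (diffs (diffs (\<lambda>_. 1)) m * R ^ m)" for m
    using assms by (simp add: diffs_def)
  let ?T = "\<Sum>m. 3 * (diffs (diffs (\<lambda>_. 1)) m * R ^ m)"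
  have s: "summable (\<lambda>m. 3 * (diffs (diffs (\<lambda>_. 1)) m * R ^ m))" by (rule summable_mult[OF 3])
  show ?thesis
  proof (intro exI[of _ ?T] conjI allI)
    show "0 \<le> ?T" by (rule suminf_nonneg[OF s nn])
    fix K
    have "(\<Sum>m=1..K. 3 * (real m)\<^sup>2 * R ^ m) \<le> (\<Sum>m=1..K. 3 * (diffs (diffs (\<lambda>_. 1)) m * R ^ m))"
      by (rule sum_mono[OF 4])
    also have "\<dots> \<le> ?T" by (rule sum_le_suminf[OF s]) (use nn in auto)
    finally show "(\<Sum>m=1..K. 3 * (real m)\<^sup>2 * R ^ m) \<le> ?T" .
  qed
qed

text \<open>The order of the choices matters: \<open>B\<close>, \<open>N\<close> and
  \<open>D\<close> rest on bounds free of the truncation, \<open>K\<close> makes the series tails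
  small, the truncation is fine enough for degrees up to \<open>K\<close>, and \<open>n0\<close> is
  large in terms of its level. The lower bound \<open>(1 - q) / (2 * D)\<close> therefore does not
  see the truncation.\<close>

lemma det_lower_bound:
  fixes \<mu> :: "complex measure" and r \<gamma> :: real
  assumes \<mu>: "standardized_law \<mu>" and r: "0 < r" "r < 1" and \<gamma>: "\<gamma> > 0"
  shows "\<exists>\<beta>>0. \<exists>n0. \<forall>n\<ge>n0. \<forall>(M :: 'w measure) Y. iid_array M Y n \<mu> \<longrightarrow>
    (\<exists>G\<in>sets M. measure M G \<ge> 1 - \<gamma> \<and> (\<forall>\<omega>\<in>G. \<forall>z. cmod z \<le> r \<longrightarrow>
      \<beta> \<le> cmod (\<Sum>k\<le>n. (-z) ^ k * minor_sum n k (\<lambda>e. Y e \<omega> / complex_of_real (sqrt (real n))))))"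
proof -
  \<comment> \<open>An intermediate radius: control of the coefficients against \<open>R ^ i\<close>
    becomes geometric decay with ratio \<open>r / R\<close> on the disc of radius
    \<open>r\<close>.\<close>
  define R where "R = (1 + r) / 2"
  have R: "0 < R" "R < 1" "r < R" using r by (auto simp: R_def)
  define q where "q = r / R"
  have q: "0 < q" "q < 1" using r R by (auto simp: q_def)
  \<comment> \<open>Four events are intersected, each failing with probability at most
    \<open>\<gamma> / 4\<close>.\<close>
  define c where "c = \<gamma> / 4"
  have c: "c > 0" using \<gamma> by (simp add: c_def)
  define S where "S = 1 / (1 - R) / c"
  have S: "S > 0" using R c by (simp add: S_def)
  obtain T0 where T0: "T0 \<ge> 0" "\<And>K. (\<Sum>m=1..K. 3 * (real m)\<^sup>2 * R ^ m) \<le> T0"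
    using summable_square_power[OF R(1,2)] by blast
  define B where "B = max 1 (T0 / c)"
  have B: "B \<ge> 1" "T0 \<le> c * B"
  proof -
    show "B \<ge> 1" by (simp add: B_def)
    have "T0 / c \<le> B" by (simp add: B_def)
    then show "T0 \<le> c * B" using c by (simp add: divide_le_eq mult.commute)
  qed
  define N where "N = nat \<lceil>B\<rceil>"
  have N: "real N \<ge> B" unfolding N_def by linarith
  define D where "D = B ^ N"
  have D: "D \<ge> 1" using B by (simp add: D_def one_le_power)
  have lim1: "(\<lambda>K. q ^ K * S * (D * (real K + 1))) \<longlonglongrightarrow> 0"
  proof -
    have "(\<lambda>K. S * D * (real K * q ^ K) + S * D * q ^ K) \<longlonglongrightarrow> S * D * 0 + S * D * 0"
      using q by (intro tendsto_intros powser_times_n_limit_0 LIMSEQ_power_zero) auto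
    then show ?thesis by (simp add: algebra_simps)
  qed
  have lim2: "(\<lambda>K. q ^ K * S * (D / (1 - q))) \<longlonglongrightarrow> 0"
  proof -
    have "(\<lambda>K. q ^ K * (S * (D / (1 - q)))) \<longlonglongrightarrow> 0 * (S * (D / (1 - q)))"
      using q by (intro tendsto_intros LIMSEQ_power_zero) auto
    then show ?thesis by (simp add: mult.assoc)
  qed
  have "eventually (\<lambda>K. q ^ K * S * (D * (real K + 1)) < 1 / 8 \<and> q ^ K * S * (D / (1 - q)) < 1 / 8) sequentially"
    by (intro eventually_conj order_tendstoD(2)[OF lim1] order_tendstoD(2)[OF lim2]) auto
  from eventually_happens'[OF sequentially_bot this]
  obtain K where K: "q ^ K * S * (D * (real K + 1)) < 1 / 8" "q ^ K * S * (D / (1 - q)) < 1 / 8" by blast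
  define \<epsilon> where "\<epsilon> = (1 - q) / (8 * D)"
  have \<epsilon>: "\<epsilon> > 0" "\<epsilon> * (D / (1 - q)) \<le> 1 / 8" using q D by (auto simp: \<epsilon>_def)
  \<comment> \<open>The root mean square error granted to each of the \<open>K + 1\<close> compared
    coefficients, so that the mean of the sum of the errors is at most
    \<open>c * \<epsilon>\<close>.\<close>
  define e1 where "e1 = \<epsilon> * c / (real K + 1)"
  have e1: "e1 > 0" using \<epsilon> c by (simp add: e1_def)
  obtain g \<beta> where g: "\<beta> \<ge> 1" "g \<in> borel_measurable borel" "\<And>z. cmod (g z) \<le> \<beta>" "centered_L2 \<mu> g"
    "(LINT z|\<mu>. (cmod (g z))\<^sup>2) \<le> 1" and
    gd: "\<And>k. k \<le> K \<Longrightarrow> \<bar>(LINT z|\<mu>. (cmod z)\<^sup>2) ^ k - 2 * Re ((LINT z|\<mu>. z * cnj (g z)) ^ k) + (LINT z|\<mu>. (cmod (g z))\<^sup>2) ^ k\<bar> < e1\<^sup>2"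
    using truncation_exists[OF \<mu>, of "e1\<^sup>2" K] e1 by auto
  \<comment> \<open>A sum of nonnegative terms bounds each of them, so one condition covers the size
    requirements of the walk count for all \<open>m \<le> K\<close>.\<close>
  define n0 where "n0 = max (K + 1) (nat \<lceil>\<Sum>m\<le>K. (real m * \<beta>) ^ (2 * m)\<rceil>)"
  show ?thesis
  proof (intro exI[of _ "(1 - q) / (2 * D)"] exI[of _ n0] conjI allI impI)
    show "(1 - q) / (2 * D) > 0" using q D by simp
    fix n and M :: "'w measure" and Y
    assume nn0: "n0 \<le> n" and "iid_array M Y n \<mu>"
    then interpret iid_array M Y n \<mu> by simp
    have nK: "K + 1 \<le> n" using nn0 by (simp add: n0_def)
    have nm: "(real m * \<beta>) ^ (2 * m) \<le> real n" if "m \<le> K" for m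
    proof -
      have "(real m * \<beta>) ^ (2 * m) \<le> (\<Sum>m\<le>K. (real m * \<beta>) ^ (2 * m))"
        using that g(1) by (intro member_le_sum) auto
      also have "\<dots> \<le> real (nat \<lceil>\<Sum>m\<le>K. (real m * \<beta>) ^ (2 * m)\<rceil>)" by (rule real_nat_ceiling_ge)
      also have "\<dots> \<le> real n" using nn0 by (simp add: n0_def)
      finally show ?thesis .
    qed
    let ?s = "complex_of_real (sqrt (real n))"
    define f where "f = (\<lambda>z. z / ?s)"
    define f' where "f' = (\<lambda>z. g z / ?s)"
    have scale: "centered_L2 \<mu> (\<lambda>z. k z / ?s)" "(LINT z|\<mu>. (cmod (k z / ?s))\<^sup>2) = (LINT z|\<mu>. (cmod (k z))\<^sup>2) / real n"
      if "centered_L2 \<mu> k" for k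
      using that by (auto simp: centered_L2_def norm_divide power_divide)
    have L: "centered_L2 \<mu> f" "centered_L2 \<mu> f'"
      unfolding f_def f'_def by (rule scale(1)[OF centered_L2_id[OF \<mu>]], rule scale(1)[OF g(4)])
    have Lm: "f \<in> borel_measurable borel" "f' \<in> borel_measurable borel" using L by (auto simp: centered_L2_def)
    have qf: "(LINT z|\<mu>. (cmod (f z))\<^sup>2) \<le> 1 / real n" "(LINT z|\<mu>. (cmod (f' z))\<^sup>2) \<le> 1 / real n"
      unfolding f_def f'_def scale(2)[OF centered_L2_id[OF \<mu>]] scale(2)[OF g(4)]
      using \<mu> g(5) by (auto simp: standardized_law_def intro!: divide_right_mono)
    define a where "a = (\<lambda>\<omega> i. minor_sum n i (\<lambda>e. f (Y e \<omega>)))"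
    define a' where "a' = (\<lambda>\<omega> i. minor_sum n i (\<lambda>e. f' (Y e \<omega>)))"
    define t where "t = (\<lambda>\<omega> m. walk_sum n m (\<lambda>e. f' (Y e \<omega>)))"
    have am: "(\<lambda>\<omega>. a \<omega> i) \<in> borel_measurable M" "(\<lambda>\<omega>. a' \<omega> i) \<in> borel_measurable M"
      "(\<lambda>\<omega>. t \<omega> i) \<in> borel_measurable M" for i
      unfolding a_def a'_def t_def
      by (rule measurable_minor_sum[OF Lm(1)], rule measurable_minor_sum[OF Lm(2)], rule measurable_walk_sum[OF Lm(2)])
    have geo: "(\<Sum>i\<le>k. 1 * R ^ i) \<le> c * S" for k
      using sum_geometric_le[of R k] R c by (simp add: S_def)
    define F1 where "F1 = (\<lambda>\<omega>. \<Sum>m\<in>{1..K}. cmod (t \<omega> m) * R ^ m)"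
    have t2: "integrable M (\<lambda>\<omega>. (cmod (t \<omega> m))\<^sup>2)" "expectation (\<lambda>\<omega>. (cmod (t \<omega> m))\<^sup>2) \<le> (3 * (real m)\<^sup>2)\<^sup>2"
      if m: "m \<in> {1..K}" for m
    proof -
      have mm: "1 \<le> m" "m \<le> n" "(real m * \<beta>) ^ (2 * m) \<le> real n" using m nK nm[of m] by auto
      have g0: "(LINT z|\<mu>. g z) = 0" using g(4) by (simp add: centered_L2_def)
      show "integrable M (\<lambda>\<omega>. (cmod (t \<omega> m))\<^sup>2)"
        unfolding t_def f'_def by (rule second_moment_walk_sum(1)[OF g(2,3) g0 g(5,1) mm])
      show "expectation (\<lambda>\<omega>. (cmod (t \<omega> m))\<^sup>2) \<le> (3 * (real m)\<^sup>2)\<^sup>2"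
        unfolding t_def f'_def by (rule second_moment_walk_sum(2)[OF g(2,3) g0 g(5,1) mm])
    qed
    have F1: "integrable M F1" "expectation F1 \<le> c * B"
    proof -
      show "integrable M F1" unfolding F1_def
        by (rule expectation_weighted_sum_le(1)[OF _ am(3) t2]) (use R in auto)
      have "expectation F1 \<le> (\<Sum>m\<in>{1..K}. 3 * (real m)\<^sup>2 * R ^ m)" unfolding F1_def
        by (rule expectation_weighted_sum_le(2)[OF _ am(3) t2]) (use R in auto)
      then show "expectation F1 \<le> c * B" using T0(2)[of K] B(2) by linarith
    qed
    define F2 where "F2 = (\<lambda>\<omega>. \<Sum>i\<in>{..n}. cmod (a \<omega> i) * R ^ i)"
    have a2: "integrable M (\<lambda>\<omega>. (cmod (a \<omega> i))\<^sup>2)" "expectation (\<lambda>\<omega>. (cmod (a \<omega> i))\<^sup>2) \<le> 1\<^sup>2" for i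
      unfolding a_def using second_moment_minor_sum[OF L(1) qf(1)] by simp_all
    have F2: "integrable M F2" "expectation F2 \<le> c * S"
    proof -
      show "integrable M F2" unfolding F2_def
        by (rule expectation_weighted_sum_le(1)[OF _ am(1) a2]) (use R in auto)
      have "expectation F2 \<le> (\<Sum>i\<in>{..n}. 1 * R ^ i)" unfolding F2_def
        by (rule expectation_weighted_sum_le(2)[OF _ am(1) a2]) (use R in auto)
      then show "expectation F2 \<le> c * S" using geo[of n] by linarith
    qed
    define F3 where "F3 = (\<lambda>\<omega>. \<Sum>i\<in>{..K}. cmod (a' \<omega> i) * R ^ i)"
    have a'2: "integrable M (\<lambda>\<omega>. (cmod (a' \<omega> i))\<^sup>2)" "expectation (\<lambda>\<omega>. (cmod (a' \<omega> i))\<^sup>2) \<le> 1\<^sup>2" for i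
      unfolding a'_def using second_moment_minor_sum[OF L(2) qf(2)] by simp_all
    have F3: "integrable M F3" "expectation F3 \<le> c * S"
    proof -
      show "integrable M F3" unfolding F3_def
        by (rule expectation_weighted_sum_le(1)[OF _ am(2) a'2]) (use R in auto)
      have "expectation F3 \<le> (\<Sum>i\<in>{..K}. 1 * R ^ i)" unfolding F3_def
        by (rule expectation_weighted_sum_le(2)[OF _ am(2) a'2]) (use R in auto)
      then show "expectation F3 \<le> c * S" using geo[of K] by linarith
    qed
    define F4 where "F4 = (\<lambda>\<omega>. \<Sum>i\<in>{..K}. cmod (a \<omega> i - a' \<omega> i) * 1)"
    have d2: "integrable M (\<lambda>\<omega>. (cmod (a \<omega> i - a' \<omega> i))\<^sup>2)"
      "expectation (\<lambda>\<omega>. (cmod (a \<omega> i - a' \<omega> i))\<^sup>2) \<le> e1\<^sup>2" if "i \<in> {..K}" for i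
    proof -
      note sd = second_moment_minor_sum_diff[OF centered_L2_id[OF \<mu>] g(4), of i]
      show "integrable M (\<lambda>\<omega>. (cmod (a \<omega> i - a' \<omega> i))\<^sup>2)" unfolding a_def a'_def f_def f'_def by (rule sd(1))
      show "expectation (\<lambda>\<omega>. (cmod (a \<omega> i - a' \<omega> i))\<^sup>2) \<le> e1\<^sup>2"
        unfolding a_def a'_def f_def f'_def using that
        by (intro order_trans[OF sd(2) less_imp_le[OF gd]]) simp
    qed
    have dm: "(\<lambda>\<omega>. a \<omega> i - a' \<omega> i) \<in> borel_measurable M" for i
      by (rule borel_measurable_diff[OF am(1,2)])
    have F4: "integrable M F4" "expectation F4 \<le> c * \<epsilon>"
    proof -
      show "integrable M F4" unfolding F4_def
        by (rule expectation_weighted_sum_le(1)[OF _ dm d2]) (use e1 in auto)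
      have "expectation F4 \<le> (\<Sum>i\<in>{..K}. e1 * 1)" unfolding F4_def
        by (rule expectation_weighted_sum_le(2)[OF _ dm d2]) (use e1 in auto)
      also have "\<dots> = c * \<epsilon>"
        by (simp add: e1_def) (simp add: field_simps)
      finally show "expectation F4 \<le> c * \<epsilon>" .
    qed
    have nn: "0 \<le> F1 \<omega>" "0 \<le> F2 \<omega>" "0 \<le> F3 \<omega>" "0 \<le> F4 \<omega>" for \<omega>
      unfolding F1_def F2_def F3_def F4_def using R by (auto intro!: sum_nonneg)
    have B0: "0 < B" using B by simp
    note E1 = markov_event[OF F1(1) nn(1) F1(2) B0]
    note E2 = markov_event[OF F2(1) nn(2) F2(2) S]
    note E3 = markov_event[OF F3(1) nn(3) F3(2) S]
    note E4 = markov_event[OF F4(1) nn(4) F4(2) \<epsilon>(1)]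
    note E12 = prob_Int_ge[OF E1(1) E2(1) E1(2) E2(2)]
    note E34 = prob_Int_ge[OF E3(1) E4(1) E3(2) E4(2)]
    note EE = prob_Int_ge[OF E12(1) E34(1) E12(2) E34(2)]
    let ?G = "({\<omega> \<in> space M. F1 \<omega> \<le> B} \<inter> {\<omega> \<in> space M. F2 \<omega> \<le> S}) \<inter> ({\<omega> \<in> space M. F3 \<omega> \<le> S} \<inter> {\<omega> \<in> space M. F4 \<omega> \<le> \<epsilon>})"
    show "\<exists>G\<in>sets M. measure M G \<ge> 1 - \<gamma> \<and> (\<forall>\<omega>\<in>G. \<forall>z. cmod z \<le> r \<longrightarrow>
      (1 - q) / (2 * D) \<le> cmod (\<Sum>k\<le>n. (-z) ^ k * minor_sum n k (\<lambda>e. Y e \<omega> / ?s)))"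
    proof (intro bexI[of _ ?G] conjI ballI allI impI)
      show "?G \<in> sets M" by (rule EE(1))
      show "measure M ?G \<ge> 1 - \<gamma>" using EE(2) by (simp add: c_def)
      fix \<omega> z assume "\<omega> \<in> ?G" and z: "cmod z \<le> r"
      then have G: "F1 \<omega> \<le> B" "F2 \<omega> \<le> S" "F3 \<omega> \<le> S" "F4 \<omega> \<le> \<epsilon>" by blast+
      \<comment> \<open>The truncated matrix: its power sums, bounded on the event, give the
        reciprocal series \<open>h\<close>.\<close>
      define A' where "A' = Matrix.mat n n (\<lambda>e. f' (Y e \<omega>))"
      have A': "A' \<in> carrier_mat n n" by (simp add: A'_def)
      have ent: "A' $$ e = f' (Y e \<omega>)" if "e \<in> {..<n} \<times> {..<n}" for e
        using that by (cases e) (simp add: A'_def)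
      have wA: "walk_sum n m (\<lambda>e. A' $$ e) = t \<omega> m" for m
        unfolding t_def by (rule walk_sum_cong[OF ent])
      have mA: "minor_sum n i (\<lambda>e. A' $$ e) = a' \<omega> i" for i
        unfolding a'_def by (rule minor_sum_cong[OF ent])
      obtain h where h: "h 0 = 1" "\<And>k. k \<ge> 1 \<Longrightarrow> of_nat k * h k = (\<Sum>m=1..k. t \<omega> m * h (k - m))"
        "\<And>k. k \<ge> 1 \<Longrightarrow> (\<Sum>i\<le>k. (-1) ^ i * a' \<omega> i * h (k - i)) = 0"
        using reciprocal_det_coeffs[OF A'] unfolding wA mA by blast
      have hD: "cmod (h k) * R ^ k \<le> D" if "k \<le> K" for k
      proof -
        have "cmod (h k) * R ^ k \<le> B ^ min k N"
          by (rule newton_coeff_bound[OF h(1,2) R(1) B(1) N _ that]) (use G(1) in \<open>simp_all add: F1_def\<close>)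
        also have "\<dots> \<le> D" unfolding D_def using B by (intro power_increasing) auto
        finally show ?thesis .
      qed
      have "(1 - r / R) / (2 * D) \<le> cmod (\<Sum>i\<le>n. (-z) ^ i * a \<omega> i)"
      proof (rule series_lower_bound[of r R K n h "a' \<omega>" D "a \<omega>" S \<epsilon>])
        show "a' \<omega> 0 = 1" by (simp add: a'_def)
        show "(\<Sum>i\<le>n. cmod (a \<omega> i) * R ^ i) \<le> S" using G(2) by (simp add: F2_def)
        show "(\<Sum>i\<le>K. cmod (a' \<omega> i) * R ^ i) \<le> S" using G(3) by (simp add: F3_def)
        show "(\<Sum>i\<le>K. cmod (a \<omega> i - a' \<omega> i)) \<le> \<epsilon>" using G(4) by (simp add: F4_def)
        show "(r / R) ^ K * S * (D * (real K + 1)) \<le> 1 / 8" "\<epsilon> * (D / (1 - r / R)) \<le> 1 / 8"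
          "(r / R) ^ K * S * (D / (1 - r / R)) \<le> 1 / 8"
          using K \<epsilon>(2) unfolding q_def[symmetric] by (simp_all only: less_imp_le)
      qed (use r R nK h hD z in auto)
      then show "(1 - q) / (2 * D) \<le> cmod (\<Sum>k\<le>n. (-z) ^ k * minor_sum n k (\<lambda>e. Y e \<omega> / ?s))"
        unfolding q_def a_def f_def .
    qed
  qed
qed

section \<open>Outliers\<close>

lemma iid_array_entries:
  assumes X: "iid_matrix \<mu> n M X" and \<mu>: "standardized_law \<mu>" and n: "n \<ge> 1"
  shows "iid_array M (\<lambda>e \<omega>. complex_of_real (sqrt (real n)) * X \<omega> $$ e) n \<mu>"
proof -
  interpret prob_space M using X by (simp add: iid_matrix_def)
  let ?s = "complex_of_real (sqrt (real n))"
  have "indep_vars (\<lambda>_. borel) (\<lambda>(i, j) \<omega>. X \<omega> $$ (i, j)) ({..<n} \<times> {..<n})"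
    using X by (simp add: iid_matrix_def)
  then have "indep_vars (\<lambda>_. borel) (\<lambda>e \<omega>. X \<omega> $$ e) ({..<n} \<times> {..<n})"
    by (simp only: case_prod_unfold prod.collapse)
  note indep = this
  have "(\<lambda>z. ?s * z) \<in> borel_measurable borel"
    by (intro borel_measurable_continuous_onI continuous_intros)
  from indep_vars_compose2[OF indep this]
  have "indep_vars (\<lambda>_. borel) (\<lambda>e \<omega>. ?s * X \<omega> $$ e) ({..<n} \<times> {..<n})" .
  moreover have "distr M borel (\<lambda>\<omega>. ?s * X \<omega> $$ e) = \<mu>" if "e \<in> {..<n} \<times> {..<n}" for e
  proof (cases e)
    case (Pair i j)
    then have ij: "i < n" "j < n" using that by auto
    have "\<forall>i<n. \<forall>j<n. distr M borel (\<lambda>\<omega>. ?s * X \<omega> $$ (i, j)) = \<mu>"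
      using X unfolding iid_matrix_def by (elim conjE)
    from this[rule_format, OF ij] show ?thesis unfolding Pair .
  qed
  moreover note \<mu>[unfolded standardized_law_def, THEN conjunct1]
    \<mu>[unfolded standardized_law_def, THEN conjunct2, THEN conjunct1]
  ultimately show ?thesis
    by (intro iid_array.intro iid_family.intro iid_family_axioms.intro iid_array_axioms.intro
        prob_space_axioms n finite_cartesian_product finite_lessThan)
qed

text \<open>The deterministic part of the comparison. The numerators are at most
  \<open>\<beta> * e\<close> and the determinant is at least \<beta> in modulus, so the resolvent
  form \<open>G\<close> is within \<open>e\<close> of \<open>W * U\<close>. Both have entries
  bounded in terms of \<open>s\<close>, where determinants of size \<open>k\<close> are
  Lipschitz.\<close>

lemma quotient_det_close:
  assumes A: "A \<in> carrier_mat n n" and U: "U \<in> carrier_mat n k" and W: "W \<in> carrier_mat k n"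
    and uU: "\<And>j. j < k \<Longrightarrow> (\<Sum>a<n. (cmod (U $$ (a, j)))\<^sup>2) = 1"
    and uW: "\<And>i. i < k \<Longrightarrow> (\<Sum>a<n. (cmod (W $$ (i, a)))\<^sup>2) \<le> s\<^sup>2" and s: "s \<ge> 0"
    and z: "cmod z \<le> 1" and \<beta>: "0 < \<beta>" "\<beta> \<le> cmod (Determinant.det (1\<^sub>m n - z \<cdot>\<^sub>m A))"
    and e: "0 \<le> e" "e \<le> 1"
    and d: "\<And>i j. i < k \<Longrightarrow> j < k \<Longrightarrow> cmod (\<Sum>l\<le>n. (-z) ^ l *
      (open_coeff n l (\<lambda>a. U $$ (a, j)) (\<lambda>a. W $$ (i, a)) (\<lambda>e. A $$ e) -
       closed_coeff n l (\<lambda>a. U $$ (a, j)) (\<lambda>a. W $$ (i, a)) (\<lambda>e. A $$ e))) \<le> \<beta> * e"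
  shows "cmod (Determinant.det (1\<^sub>m n - z \<cdot>\<^sub>m (A + U * W)) / Determinant.det (1\<^sub>m n - z \<cdot>\<^sub>m A) -
    Determinant.det (1\<^sub>m n - z \<cdot>\<^sub>m (U * W))) \<le> fact k * ((s + 2) ^ k * (real k * e))"
proof -
  let ?p = "Determinant.det (1\<^sub>m n - z \<cdot>\<^sub>m A)"
  have nz: "?p \<noteq> 0" using \<beta> by auto
  obtain G where G: "G \<in> carrier_mat k k"
    and q: "Determinant.det (1\<^sub>m n - z \<cdot>\<^sub>m (A + U * W)) = ?p * Determinant.det (1\<^sub>m k - z \<cdot>\<^sub>m G)"
    and GW: "\<And>i j. i < k \<Longrightarrow> j < k \<Longrightarrow> (G $$ (i, j) - (W * U) $$ (i, j)) * ?p = (\<Sum>l\<le>n. (-z) ^ l *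
      (open_coeff n l (\<lambda>a. U $$ (a, j)) (\<lambda>a. W $$ (i, a)) (\<lambda>e. A $$ e) -
       closed_coeff n l (\<lambda>a. U $$ (a, j)) (\<lambda>a. W $$ (i, a)) (\<lambda>e. A $$ e)))"
    using det_low_rank_perturbation[OF A U W nz] by blast
  have WU: "W * U \<in> carrier_mat k k" using W U by simp
  have close: "cmod (G $$ (i, j) - (W * U) $$ (i, j)) \<le> e" if "i < k" "j < k" for i j
  proof -
    have "cmod (G $$ (i, j) - (W * U) $$ (i, j)) * \<beta> \<le> cmod (G $$ (i, j) - (W * U) $$ (i, j)) * cmod ?p"
      using \<beta> by (intro mult_left_mono) auto
    also have "\<dots> \<le> \<beta> * e" unfolding norm_mult[symmetric] GW[OF that] by (rule d[OF that])
    finally show ?thesis using \<beta>(1) by (simp add: mult.commute)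
  qed
  have WUs: "cmod ((W * U) $$ (i, j)) \<le> s" if ij: "i < k" "j < k" for i j
  proof -
    have "(W * U) $$ (i, j) = (\<Sum>a<n. W $$ (i, a) * U $$ (a, j))"
      using ij W U by (simp add: scalar_prod_def atLeast0LessThan)
    then have 1: "cmod ((W * U) $$ (i, j)) \<le> (\<Sum>a<n. cmod (W $$ (i, a)) * cmod (U $$ (a, j)))"
      by (simp add: sum_norm_le norm_mult)
    have "(\<Sum>a<n. cmod (W $$ (i, a)) * cmod (U $$ (a, j)))\<^sup>2 \<le>
        (\<Sum>a<n. (cmod (W $$ (i, a)))\<^sup>2) * (\<Sum>a<n. (cmod (U $$ (a, j)))\<^sup>2)"
      by (rule Cauchy_Schwarz_ineq_sum)
    also have "\<dots> \<le> s\<^sup>2" using uW[OF ij(1)] by (simp add: uU[OF ij(2)])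
    finally have "(\<Sum>a<n. cmod (W $$ (i, a)) * cmod (U $$ (a, j))) \<le> s" by (rule power2_le_imp_le[OF _ s])
    with 1 show ?thesis by linarith
  qed
  have ent: "cmod ((1\<^sub>m k - z \<cdot>\<^sub>m H) $$ (i, j)) \<le> s + 2"
    if H: "H \<in> carrier_mat k k" and ij: "i < k" "j < k" and b: "cmod (H $$ (i, j)) \<le> s + 1" for H i j
  proof -
    have "(1\<^sub>m k - z \<cdot>\<^sub>m H) $$ (i, j) = (if i = j then 1 else 0) - z * H $$ (i, j)"
      using H ij by simp
    then have "cmod ((1\<^sub>m k - z \<cdot>\<^sub>m H) $$ (i, j)) \<le> cmod (if i = j then 1 else 0) + cmod z * cmod (H $$ (i, j))"
      by (metis norm_mult norm_triangle_ineq4)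
    also have "\<dots> \<le> 1 + 1 * (s + 1)" using z b by (intro add_mono mult_mono) auto
    finally show ?thesis by simp
  qed
  have cG: "cmod (G $$ (i, j)) \<le> s + 1" if "i < k" "j < k" for i j
    using close[OF that] WUs[OF that] e norm_triangle_sub[of "G $$ (i, j)" "(W * U) $$ (i, j)"] by linarith
  have cW: "cmod ((W * U) $$ (i, j)) \<le> s + 1" if "i < k" "j < k" for i j
    using WUs[OF that] by linarith
  have "cmod (Determinant.det (1\<^sub>m k - z \<cdot>\<^sub>m G) - Determinant.det (1\<^sub>m k - z \<cdot>\<^sub>m (W * U)))
      \<le> fact k * ((s + 2) ^ k * (real k * e))"
  proof (rule det_diff_le)
    show "1\<^sub>m k - z \<cdot>\<^sub>m G \<in> carrier_mat k k" "1\<^sub>m k - z \<cdot>\<^sub>m (W * U) \<in> carrier_mat k k"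
      by (intro minus_carrier_mat smult_carrier_mat G WU)+
    show "1 \<le> s + 2" using s by simp
    fix i j assume ij: "i < k" "j < k"
    show "cmod ((1\<^sub>m k - z \<cdot>\<^sub>m G) $$ (i, j)) \<le> s + 2" by (rule ent[OF G ij cG[OF ij]])
    show "cmod ((1\<^sub>m k - z \<cdot>\<^sub>m (W * U)) $$ (i, j)) \<le> s + 2" by (rule ent[OF WU ij cW[OF ij]])
    have "(1\<^sub>m k - z \<cdot>\<^sub>m G) $$ (i, j) - (1\<^sub>m k - z \<cdot>\<^sub>m (W * U)) $$ (i, j) =
        - (z * (G $$ (i, j) - (W * U) $$ (i, j)))"
      using G WU ij by (simp del: index_mult_mat add: algebra_simps)
    then have "cmod ((1\<^sub>m k - z \<cdot>\<^sub>m G) $$ (i, j) - (1\<^sub>m k - z \<cdot>\<^sub>m (W * U)) $$ (i, j)) =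
        cmod z * cmod (G $$ (i, j) - (W * U) $$ (i, j))"
      by (simp only: norm_minus_cancel norm_mult)
    also have "\<dots> \<le> 1 * e" by (intro mult_mono z close ij) auto
    finally show "cmod ((1\<^sub>m k - z \<cdot>\<^sub>m G) $$ (i, j) - (1\<^sub>m k - z \<cdot>\<^sub>m (W * U)) $$ (i, j)) \<le> e" by simp
  qed
  moreover have "Determinant.det (1\<^sub>m n - z \<cdot>\<^sub>m (U * W)) = Determinant.det (1\<^sub>m k - z \<cdot>\<^sub>m (W * U))"
    using det_one_minus_mult_commute[OF smult_carrier_mat[OF U] W, of z]
    by (simp only: mult_smult_assoc_mat[OF U W] mult_smult_distrib[OF W U])
  ultimately show ?thesis using nz by (simp add: q)
qed

text \<open>\<open>n0\<close> is chosen before \<open>U\<close> and \<open>W\<close>, as only the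
  lengths of their columns and rows enter the estimates. This lets the perturbation vary with
  \<open>n\<close>.\<close>

lemma perturbation_event:
  fixes \<mu> :: "complex measure" and r \<gamma> \<epsilon> s :: real and k :: nat
  assumes \<mu>: "standardized_law \<mu>" and r: "0 < r" "r < 1" and \<gamma>: "\<gamma> > 0" and \<epsilon>: "\<epsilon> > 0" and s: "s \<ge> 0"
  shows "\<exists>n0. \<forall>n\<ge>n0. \<forall>(M :: 'w measure) X U W. iid_matrix \<mu> n M X \<longrightarrow>
    U \<in> carrier_mat n k \<longrightarrow> W \<in> carrier_mat k n \<longrightarrow>
    (\<forall>j<k. (\<Sum>a<n. (cmod (U $$ (a, j)))\<^sup>2) = 1) \<longrightarrow> (\<forall>i<k. (\<Sum>a<n. (cmod (W $$ (i, a)))\<^sup>2) \<le> s\<^sup>2) \<longrightarrow>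
    (\<exists>G\<in>sets M. measure M G \<ge> 1 - \<gamma> \<and> (\<forall>\<omega>\<in>G. \<forall>z. cmod z \<le> r \<longrightarrow>
      Determinant.det (1\<^sub>m n - z \<cdot>\<^sub>m X \<omega>) \<noteq> 0 \<and>
      cmod (Determinant.det (1\<^sub>m n - z \<cdot>\<^sub>m (X \<omega> + U * W)) / Determinant.det (1\<^sub>m n - z \<cdot>\<^sub>m X \<omega>) -
        Determinant.det (1\<^sub>m n - z \<cdot>\<^sub>m (U * W))) \<le> \<epsilon>))"
proof -
  obtain \<beta> n1 where \<beta>: "\<beta> > 0" and n1: "\<And>n (M :: 'w measure) Y. n1 \<le> n \<Longrightarrow> iid_array M Y n \<mu> \<Longrightarrow>
    \<exists>G\<in>sets M. measure M G \<ge> 1 - \<gamma> / 2 \<and> (\<forall>\<omega>\<in>G. \<forall>z. cmod z \<le> r \<longrightarrow>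
      \<beta> \<le> cmod (\<Sum>k\<le>n. (-z) ^ k * minor_sum n k (\<lambda>e. Y e \<omega> / complex_of_real (sqrt (real n)))))"
    using det_lower_bound[OF \<mu> r half_gt_zero[OF \<gamma>], where ?'w = 'w] by (elim exE conjE) (rule that; blast)
  obtain T where T: "T \<ge> 0" "\<And>K. (\<Sum>m=1..K. 3 * (real m)\<^sup>2 * r ^ m) \<le> T"
    using summable_square_power[OF r] by blast
  define L where "L = fact k * ((s + 2) ^ k * real k)"
  have L: "L \<ge> 0" using s by (simp add: L_def)
  define e where "e = min 1 (\<epsilon> / (L + 1))"
  have e: "0 < e" "e \<le> 1" using \<epsilon> L by (auto simp: e_def)
  have Le: "fact k * ((s + 2) ^ k * (real k * e)) \<le> \<epsilon>"
  proof -
    have "L * e \<le> (L + 1) * (\<epsilon> / (L + 1))" using L e \<epsilon> by (intro mult_mono) (auto simp: e_def)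
    also have "\<dots> = \<epsilon>" using L by simp
    finally show ?thesis by (simp add: L_def mult.assoc)
  qed
  define t where "t = \<beta> * e"
  have t: "t > 0" using \<beta> e by (simp add: t_def)
  \<comment> \<open>Apart from the factor \<open>1 / sqrt n\<close>, a bound for the mean of the sum
    of all weighted coefficients of the \<open>k * k\<close> bilinear forms.\<close>
  define Q where "Q = real k * real k * (2 * s * T)"
  have Q: "Q \<ge> 0" using s T by (simp add: Q_def)
  define n0 where "n0 = max (max 1 n1) (nat \<lceil>(Q / (\<gamma> / 2 * t))\<^sup>2\<rceil>)"
  show ?thesis
  proof (intro exI[of _ n0] allI impI)
    fix n and M :: "'w measure" and X U W
    assume nn: "n0 \<le> n" and X: "iid_matrix \<mu> n M X" and U: "U \<in> carrier_mat n k" and W: "W \<in> carrier_mat k n"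
      and uU: "\<forall>j<k. (\<Sum>a<n. (cmod (U $$ (a, j)))\<^sup>2) = 1" and uW: "\<forall>i<k. (\<Sum>a<n. (cmod (W $$ (i, a)))\<^sup>2) \<le> s\<^sup>2"
    have ngt: "n \<ge> 1" "n1 \<le> n" using nn by (auto simp: n0_def)
    have Qn: "Q / sqrt (real n) \<le> \<gamma> / 2 * t"
    proof -
      have "(Q / (\<gamma> / 2 * t))\<^sup>2 \<le> real n"
        using nn real_nat_ceiling_ge[of "(Q / (\<gamma> / 2 * t))\<^sup>2"] unfolding n0_def by linarith
      then have "Q / (\<gamma> / 2 * t) \<le> sqrt (real n)" by (rule real_le_rsqrt)
      then show ?thesis using \<gamma> t ngt(1) by (simp add: field_simps)
    qed
    let ?s = "complex_of_real (sqrt (real n))"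
    define Y where "Y = (\<lambda>e \<omega>. ?s * X \<omega> $$ e)"
    have arr: "iid_array M Y n \<mu>" unfolding Y_def by (rule iid_array_entries[OF X \<mu> ngt(1)])
    interpret iid_array M Y n \<mu> by (rule arr)
    have s0: "?s \<noteq> 0" using ngt(1) by simp
    have f_eq: "Y e \<omega> / ?s = X \<omega> $$ e" for e \<omega> using s0 by (simp add: Y_def)
    obtain G1 where G1: "G1 \<in> sets M" "measure M G1 \<ge> 1 - \<gamma> / 2"
      and lb1: "\<forall>\<omega>\<in>G1. \<forall>z. cmod z \<le> r \<longrightarrow> \<beta> \<le> cmod (\<Sum>k\<le>n. (-z) ^ k * minor_sum n k (\<lambda>e. X \<omega> $$ e))"
      using n1[OF ngt(2) arr] unfolding f_eq by (elim bexE conjE) (rule that)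
    note lb = lb1[rule_format]
    define Z where "Z = (\<lambda>(i, j, l) \<omega>. open_coeff n l (\<lambda>a. U $$ (a, j)) (\<lambda>a. W $$ (i, a)) (\<lambda>e. Y e \<omega> / ?s) -
       closed_coeff n l (\<lambda>a. U $$ (a, j)) (\<lambda>a. W $$ (i, a)) (\<lambda>e. Y e \<omega> / ?s))"
    define J where "J = {..<k} \<times> {..<k} \<times> {..n}"
    define b where "b = (\<lambda>(i :: nat, j :: nat, l). 2 * real l * s / sqrt (real n))"
    define a where "a = (\<lambda>(i :: nat, j :: nat, l). r ^ l)"
    \<comment> \<open>This one random variable bounds all numerators at all \<open>z\<close> of the
      disc, so a single event settles the whole disc.\<close>
    define F where "F = (\<lambda>\<omega>. \<Sum>x\<in>J. cmod (Z x \<omega>) * a x)"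
    have cf: "centered_L2 \<mu> (\<lambda>z. z / ?s)" and qf: "(LINT z|\<mu>. (cmod (z / ?s))\<^sup>2) \<le> 1 / real n"
      using \<mu> by (simp_all add: centered_L2_def standardized_law_def norm_divide power_divide)
    have Zm: "Z x \<in> borel_measurable M" for x
    proof (cases x)
      case (fields i j l)
      have "(\<lambda>z. z / ?s) \<in> borel_measurable borel" by simp
      then show ?thesis unfolding fields Z_def prod.case by (rule measurable_open_closed)
    qed
    have Z2: "integrable M (\<lambda>\<omega>. (cmod (Z x \<omega>))\<^sup>2)" "expectation (\<lambda>\<omega>. (cmod (Z x \<omega>))\<^sup>2) \<le> (b x)\<^sup>2"
      if "x \<in> J" for x
    proof -
      obtain i j l where x: "x = (i, j, l)" by (cases x)
      have ij: "i < k" "j < k" using that by (auto simp: x J_def)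
      note sm = second_moment_open_closed[OF cf qf, of l "\<lambda>a. U $$ (a, j)" "\<lambda>a. W $$ (i, a)"]
      show "integrable M (\<lambda>\<omega>. (cmod (Z x \<omega>))\<^sup>2)" unfolding x Z_def prod.case by (rule sm(1))
      have "expectation (\<lambda>\<omega>. (cmod (Z x \<omega>))\<^sup>2) \<le> (2 * real l)\<^sup>2 / real n *
          ((\<Sum>b<n. (cmod (U $$ (b, j)))\<^sup>2) * (\<Sum>b<n. (cmod (W $$ (i, b)))\<^sup>2))"
        unfolding x Z_def prod.case by (rule sm(2))
      also have "\<dots> \<le> (2 * real l)\<^sup>2 / real n * (1 * s\<^sup>2)"
        using uU uW ij by (intro mult_left_mono) auto
      also have "\<dots> = (b x)\<^sup>2" by (simp add: b_def x power_mult_distrib power_divide)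
      finally show "expectation (\<lambda>\<omega>. (cmod (Z x \<omega>))\<^sup>2) \<le> (b x)\<^sup>2" .
    qed
    have fJ: "finite J" by (simp add: J_def)
    have b0: "0 \<le> b x" and a0: "0 \<le> a x" for x using s r by (cases x, simp add: b_def a_def)+
    have F: "integrable M F" "expectation F \<le> (\<Sum>x\<in>J. b x * a x)"
      unfolding F_def by (rule expectation_weighted_sum_le[OF fJ Zm Z2 b0 a0]; assumption)+
    have "(\<Sum>x\<in>J. b x * a x) = (\<Sum>i<k. \<Sum>j<k. \<Sum>l\<le>n. 2 * s / sqrt (real n) * (real l * r ^ l))"
      by (simp add: J_def b_def a_def sum.cartesian_product' mult_ac)
    also have "\<dots> = real k * real k * (2 * s / sqrt (real n) * (\<Sum>l\<le>n. real l * r ^ l))"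
      by (simp add: sum_distrib_left mult.assoc)
    also have "\<dots> \<le> real k * real k * (2 * s / sqrt (real n) * T)"
    proof -
      have "(\<Sum>l\<le>n. real l * r ^ l) = (\<Sum>l=1..n. real l * r ^ l)"
        by (rule sum.mono_neutral_right) auto
      also have "\<dots> \<le> (\<Sum>l=1..n. 3 * (real l)\<^sup>2 * r ^ l)"
      proof (rule sum_mono)
        fix l assume "l \<in> {1..n}"
        then have "real l * 1 \<le> real l * (3 * real l)" by (intro mult_left_mono) auto
        then have "real l \<le> 3 * (real l)\<^sup>2" by (simp add: power2_eq_square mult.left_commute)
        then show "real l * r ^ l \<le> 3 * (real l)\<^sup>2 * r ^ l" using r by (intro mult_right_mono) auto
      qed
      also have "\<dots> \<le> T" by (rule T(2))
      finally show ?thesis using s by (intro mult_left_mono) auto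
    qed
    also have "\<dots> = Q / sqrt (real n)" by (simp add: Q_def)
    finally have "expectation F \<le> \<gamma> / 2 * t" using F(2) Qn by linarith
    note E = markov_event[OF F(1) _ this t]
    have F0: "0 \<le> F \<omega>" for \<omega> unfolding F_def by (intro sum_nonneg mult_nonneg_nonneg a0 norm_ge_zero)
    let ?G = "G1 \<inter> {\<omega> \<in> space M. F \<omega> \<le> t}"
    show "\<exists>G\<in>sets M. measure M G \<ge> 1 - \<gamma> \<and> (\<forall>\<omega>\<in>G. \<forall>z. cmod z \<le> r \<longrightarrow>
      Determinant.det (1\<^sub>m n - z \<cdot>\<^sub>m X \<omega>) \<noteq> 0 \<and>
      cmod (Determinant.det (1\<^sub>m n - z \<cdot>\<^sub>m (X \<omega> + U * W)) / Determinant.det (1\<^sub>m n - z \<cdot>\<^sub>m X \<omega>) -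
        Determinant.det (1\<^sub>m n - z \<cdot>\<^sub>m (U * W))) \<le> \<epsilon>)"
    proof (intro bexI[of _ ?G] conjI ballI allI impI)
      note PI = prob_Int_ge[OF G1(1) E(1)[OF F0] G1(2) E(2)[OF F0]]
      show "?G \<in> sets M" by (rule PI(1))
      show "1 - \<gamma> \<le> measure M ?G" using PI(2) by simp
      fix \<omega> z assume \<omega>: "\<omega> \<in> ?G" and z: "cmod z \<le> r"
      have A: "X \<omega> \<in> carrier_mat n n" using \<omega> X by (auto simp: iid_matrix_def)
      have lb': "\<beta> \<le> cmod (Determinant.det (1\<^sub>m n - z \<cdot>\<^sub>m X \<omega>))"
        unfolding det_one_minus_smult[OF A] by (rule lb) (use \<omega> z in auto)
      show "Determinant.det (1\<^sub>m n - z \<cdot>\<^sub>m X \<omega>) \<noteq> 0" using lb' \<beta> by auto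
      have "cmod (Determinant.det (1\<^sub>m n - z \<cdot>\<^sub>m (X \<omega> + U * W)) / Determinant.det (1\<^sub>m n - z \<cdot>\<^sub>m X \<omega>) -
          Determinant.det (1\<^sub>m n - z \<cdot>\<^sub>m (U * W))) \<le> fact k * ((s + 2) ^ k * (real k * e))"
      proof (rule quotient_det_close[OF A U W _ _ s _ \<beta> lb' less_imp_le[OF e(1)] e(2)])
        fix i j assume ij: "i < k" "j < k"
        have "cmod (\<Sum>l\<le>n. (-z) ^ l * Z (i, j, l) \<omega>) \<le> (\<Sum>l\<le>n. cmod (Z (i, j, l) \<omega>) * a (i, j, l))"
        proof (rule sum_norm_le)
          fix l
          have "cmod z ^ l * cmod (Z (i, j, l) \<omega>) \<le> r ^ l * cmod (Z (i, j, l) \<omega>)"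
            using z by (intro mult_right_mono power_mono) auto
          then show "cmod ((-z) ^ l * Z (i, j, l) \<omega>) \<le> cmod (Z (i, j, l) \<omega>) * a (i, j, l)"
            by (simp add: norm_mult norm_power a_def mult.commute)
        qed
        also have "\<dots> = (\<Sum>x\<in>(\<lambda>l. (i, j, l)) ` {..n}. cmod (Z x \<omega>) * a x)"
          by (subst sum.reindex) (auto simp: inj_on_def)
        also have "\<dots> \<le> F \<omega>" unfolding F_def
          by (rule sum_mono2[OF fJ]) (use ij a0 in \<open>auto simp: J_def\<close>)
        also have "\<dots> \<le> \<beta> * e" using \<omega> by (simp add: t_def)
        finally show "cmod (\<Sum>l\<le>n. (-z) ^ l *
            (open_coeff n l (\<lambda>a. U $$ (a, j)) (\<lambda>a. W $$ (i, a)) (\<lambda>e. X \<omega> $$ e) -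
             closed_coeff n l (\<lambda>a. U $$ (a, j)) (\<lambda>a. W $$ (i, a)) (\<lambda>e. X \<omega> $$ e))) \<le> \<beta> * e"
          unfolding Z_def f_eq prod.case .
      qed (use uU uW z r in auto)
      with Le show "cmod (Determinant.det (1\<^sub>m n - z \<cdot>\<^sub>m (X \<omega> + U * W)) / Determinant.det (1\<^sub>m n - z \<cdot>\<^sub>m X \<omega>) -
          Determinant.det (1\<^sub>m n - z \<cdot>\<^sub>m (U * W))) \<le> \<epsilon>" by linarith
    qed
  qed
qed

text \<open>For each \<open>n \<ge> 1\<close> a measurable event on which \<open>P n\<close> holds
  is taken with probability within \<open>1 / Suc n\<close> of the supremum. This sequence serves
  every \<gamma> at once, whereas the events of the hypothesis may change with \<gamma>.\<close>

lemma whp_intro: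
  assumes prob: "\<And>n. n \<ge> 1 \<Longrightarrow> prob_space (M n)"
    and ev: "\<And>\<gamma>. \<gamma> > 0 \<Longrightarrow> \<forall>\<^sub>F n in sequentially. \<exists>E\<in>sets (M n). measure (M n) E \<ge> 1 - \<gamma> \<and> (\<forall>\<omega>\<in>E. P n \<omega>)"
  shows "whp M P"
proof -
  define S where "S = (\<lambda>n. {E \<in> sets (M n). \<forall>\<omega>\<in>E. P n \<omega>})"
  have ne: "{} \<in> S n" for n by (simp add: S_def)
  have le1: "measure (M n) E \<le> 1" if "n \<ge> 1" for n E
    using prob_space.prob_le_1[OF prob[OF that]] .
  have "\<exists>E\<in>S n. n \<ge> 1 \<longrightarrow> (\<forall>E'\<in>S n. measure (M n) E' \<le> measure (M n) E + 1 / real (Suc n))" for n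
  proof (cases "n \<ge> 1")
    case True
    have bdd: "bdd_above (measure (M n) ` S n)" using le1[OF True] by (intro bdd_aboveI2) auto
    have "(SUP E\<in>S n. measure (M n) E) - 1 / real (Suc n) < (SUP E\<in>S n. measure (M n) E)" by simp
    then obtain E where E: "E \<in> S n" "(SUP E\<in>S n. measure (M n) E) - 1 / real (Suc n) < measure (M n) E"
      using less_cSUP_iff[OF _ bdd] ne by blast
    have "measure (M n) E' \<le> measure (M n) E + 1 / real (Suc n)" if "E' \<in> S n" for E'
      using cSUP_upper[OF that bdd] E(2) by linarith
    with E(1) show ?thesis by blast
  qed (use ne in auto)
  then obtain E where ES: "\<And>n. E n \<in> S n"
    and opt: "\<And>n E'. n \<ge> 1 \<Longrightarrow> E' \<in> S n \<Longrightarrow> measure (M n) E' \<le> measure (M n) (E n) + 1 / real (Suc n)"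
    by metis
  have "(\<lambda>n. measure (M n) (E n)) \<longlonglongrightarrow> 1"
  proof (rule tendstoI)
    fix \<gamma> :: real assume \<gamma>: "\<gamma> > 0"
    have "\<forall>\<^sub>F n in sequentially. 1 / real (Suc n) < \<gamma> / 2"
      using order_tendstoD(2)[OF LIMSEQ_Suc[OF lim_1_over_n], of "\<gamma> / 2"] \<gamma> by simp
    moreover have "\<forall>\<^sub>F n in sequentially. \<exists>E\<in>sets (M n). measure (M n) E \<ge> 1 - \<gamma> / 2 \<and> (\<forall>\<omega>\<in>E. P n \<omega>)"
      using ev[of "\<gamma> / 2"] \<gamma> by simp
    ultimately show "\<forall>\<^sub>F n in sequentially. dist (measure (M n) (E n)) 1 < \<gamma>"
      using eventually_ge_at_top[of 1]
    proof eventually_elim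
      case (elim n)
      then obtain E' where E': "E' \<in> S n" "measure (M n) E' \<ge> 1 - \<gamma> / 2" by (auto simp: S_def)
      show ?case using opt[OF elim(3) E'(1)] E'(2) elim(1) le1[OF elim(3), of "E n"]
        unfolding dist_real_def by linarith
    qed
  qed
  then show ?thesis unfolding whp_def using ES by (intro exI[of _ E]) (auto simp: S_def)
qed

text \<open>The members of \<open>as\<close> are listed before those of \<open>S'\<close>. Labels
  start at 1 and list positions at 0, hence the shift.\<close>

lemma labelling_of_split:
  assumes S: "S = mset as + S'"
  shows "\<exists>f. S = image_mset f (mset_set {1..size S}) \<and> (\<forall>j\<in>{1..length as}. f j = as ! (j - 1)) \<and>
    (\<forall>i\<in>{length as + 1..size S}. f i \<in># S')"
proof -
  obtain bs where bs: "mset bs = S'" using ex_mset by blast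
  let ?xs = "as @ bs"
  have len: "size S = length ?xs" by (simp add: S flip: bs)
  define f where "f = (\<lambda>i. ?xs ! (i - 1))"
  have "map f [1..<Suc (length ?xs)] = ?xs"
    by (rule nth_equalityI) (simp_all add: f_def del: upt_Suc)
  then have "mset ?xs = image_mset f (mset [1..<Suc (length ?xs)])" by (metis mset_map)
  also have "\<dots> = image_mset f (mset_set {1..size S})"
    by (simp only: mset_upt len atLeastLessThanSuc_atLeastAtMost)
  finally have 1: "S = image_mset f (mset_set {1..size S})" by (simp add: S flip: bs)
  have 2: "f j = as ! (j - 1)" if "j \<in> {1..length as}" for j
    using that by (auto simp: f_def nth_append)
  have 3: "f i \<in># S'" if "i \<in> {length as + 1..size S}" for i
  proof -
    have "\<not> i - 1 < length as" "i - 1 - length as < length bs" using that by (auto simp: len)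
    then have "f i \<in> set bs" by (simp add: f_def nth_append)
    then show ?thesis by (simp flip: bs)
  qed
  from 1 2 3 show ?thesis by blast
qed

text \<open>Only the values on \<open>{1..size S}\<close> count, so up to restriction there are
  finitely many labellings and the cost attains its minimum.\<close>

lemma optimal_labelling:
  fixes cost :: "nat \<Rightarrow> complex \<Rightarrow> real"
  shows "\<exists>f. S = image_mset f (mset_set {1..size S}) \<and>
    (\<forall>g. S = image_mset g (mset_set {1..size S}) \<longrightarrow> (\<Sum>i=1..size S. cost i (f i)) \<le> (\<Sum>i=1..size S. cost i (g i)))"
proof -
  let ?I = "{1..size S}"
  let ?V = "{f \<in> ?I \<rightarrow>\<^sub>E set_mset S. S = image_mset f (mset_set ?I)}"
  have restr: "restrict g ?I \<in> ?V" if "S = image_mset g (mset_set ?I)" for g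
  proof -
    have "image_mset (restrict g ?I) (mset_set ?I) = S"
      by (subst (2) that, rule image_mset_cong) simp
    moreover have "g i \<in># S" if "i \<in> ?I" for i by (subst \<open>S = _\<close>) (use that in auto)
    ultimately show ?thesis by auto
  qed
  obtain as where as: "mset as = S" using ex_mset by blast
  obtain f0 where "S = image_mset f0 (mset_set ?I)" using labelling_of_split[of S as "{#}"] as by auto
  then have ne: "?V \<noteq> {}" using restr by blast
  have "finite (?I \<rightarrow>\<^sub>E set_mset S)" by (intro finite_PiE) auto
  then have fin: "finite ?V" by (rule finite_subset[rotated]) blast
  obtain f where f: "f \<in> ?V" "\<And>g. g \<in> ?V \<Longrightarrow> (\<Sum>i\<in>?I. cost i (f i)) \<le> (\<Sum>i\<in>?I. cost i (g i))"
    using ex_is_arg_min_if_finite[OF fin ne, of "\<lambda>f. \<Sum>i\<in>?I. cost i (f i)"]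
    unfolding is_arg_min_linorder by blast
  have "(\<Sum>i\<in>?I. cost i (f i)) \<le> (\<Sum>i\<in>?I. cost i (g i))" if "S = image_mset g (mset_set ?I)" for g
    using f(2)[OF restr[OF that]] by simp
  with f(1) show ?thesis by blast
qed

lemma prod_mset_split_nonzero:
  fixes f :: "complex \<Rightarrow> complex"
  assumes "f 0 = 1" "\<not> P 0"
  shows "(\<Prod>x\<in>#E. f x) = (\<Prod>x\<in>#filter_mset P E. f x) * (\<Prod>x\<in>#{#x \<in># {#x \<in># E. x \<noteq> 0#}. \<not> P x#}. f x)"
  using assms by (induction E) (auto simp: ac_simps)

text \<open>The matching of zeros is applied to the eigenvalues of
  \<open>X n \<omega> + C n\<close>, with the reciprocal of \<open>det (1 - z X)\<close> as the
  zero-free factor \<open>w\<close>. The list \<open>as\<close> may depend on \<epsilon>; a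
  labelling common to all \<epsilon> is only made in the theorem.\<close>

lemma outlier_event:
  fixes \<mu> :: "complex measure" and M :: "nat \<Rightarrow> 'w measure" and X :: "nat \<Rightarrow> 'w \<Rightarrow> complex mat"
    and C :: "nat \<Rightarrow> complex mat" and c :: "nat \<Rightarrow> nat \<Rightarrow> complex" and \<delta> s \<gamma> \<epsilon> :: real
  assumes \<mu>: "standardized_law \<mu>" and X: "\<And>n. n \<ge> 1 \<Longrightarrow> iid_matrix \<mu> n (M n) (X n)"
    and \<delta>: "\<delta> > 0" and s: "s > 1 + \<delta>" and C: "\<And>n. C n \<in> carrier_mat n n"
    and rk: "\<forall>\<^sub>F n in sequentially. vec_space.rank n (C n) = k"
    and nrm: "\<forall>\<^sub>F n in sequentially. mat_op_norm (C n) \<le> s"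
    and big: "\<forall>\<^sub>F n in sequentially.
           {# z \<in># eigenvalue_mset (C n). cmod z > 1 + \<delta> #} = image_mset (c n) (mset_set {1..m})"
    and small: "\<forall>\<^sub>F n in sequentially.
           \<forall>z \<in># eigenvalue_mset (C n). cmod z > 1 + \<delta> \<or> cmod z \<le> 1 + \<delta> / 3"
    and \<gamma>: "\<gamma> > 0" and \<epsilon>: "\<epsilon> > 0"
  shows "\<forall>\<^sub>F n in sequentially. \<exists>G\<in>sets (M n). measure (M n) G \<ge> 1 - \<gamma> \<and>
    (\<forall>\<omega>\<in>G. \<exists>as S'. eigenvalue_mset (X n \<omega> + C n) = mset as + S' \<and> length as = m \<and>
      (\<forall>i<m. cmod (as ! i - c n (Suc i)) < \<epsilon>) \<and> (\<forall>x\<in>#S'. cmod x < 1 + \<delta> / 2))"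
proof -
  \<comment> \<open>\<open>5 / 12\<close> is the midpoint of \<open>1 / 3\<close> and
    \<open>1 / 2\<close>: the modulus \<open>1 / r\<close> lies above the small eigenvalues of
    \<open>C\<close> and below the claimed bound \<open>1 + \<delta> / 2\<close>.\<close>
  define r where "r = 1 / (1 + 5 * \<delta> / 12)"
  have r: "0 < r" "r < 1" "r * (1 + \<delta> / 3) < 1" "1 < r * (1 + \<delta>)" "1 / r < 1 + \<delta> / 2"
    using \<delta> by (auto simp: r_def field_simps)
  have a0: "0 \<le> 1 + \<delta> / 3" using \<delta> by simp
  obtain \<eta> where \<eta>: "\<eta> > 0" and match: "\<forall>cs Sm S w. length cs = m \<longrightarrow>
      (\<forall>c\<in>set cs. 1 + \<delta> < norm c \<and> norm c \<le> s) \<longrightarrow> (\<forall>x\<in>#Sm. norm x \<le> 1 + \<delta> / 3) \<longrightarrow> size Sm \<le> k \<longrightarrow>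
      w holomorphic_on ball 0 r \<longrightarrow> continuous_on (cball 0 r) w \<longrightarrow> (\<forall>z\<in>cball 0 r. w z \<noteq> 0) \<longrightarrow>
      (\<forall>z\<in>cball 0 r. norm ((\<Prod>x\<in>#S. 1 - z * x) * w z - (\<Prod>x\<leftarrow>cs. 1 - z * x) * (\<Prod>x\<in>#Sm. 1 - z * x)) \<le> \<eta>) \<longrightarrow>
      (\<exists>as S'. S = mset as + S' \<and> length as = m \<and> (\<forall>i<m. norm (as ! i - cs ! i) < \<epsilon>) \<and> (\<forall>x\<in>#S'. norm x < 1 / r))"
    using match_zeros[OF r(1) a0 r(3,4) \<epsilon>, of m s k] by (elim exE conjE) (rule that)
  note match = match[THEN spec, THEN spec, THEN spec, THEN spec,
    THEN mp, THEN mp, THEN mp, THEN mp, THEN mp, THEN mp, THEN mp, THEN mp]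
  have s0: "s \<ge> 0" using s \<delta> by simp
  obtain n0 where n0: "\<forall>n\<ge>n0. \<forall>(M :: 'w measure) X U W. iid_matrix \<mu> n M X \<longrightarrow>
    U \<in> carrier_mat n k \<longrightarrow> W \<in> carrier_mat k n \<longrightarrow>
    (\<forall>j<k. (\<Sum>a<n. (cmod (U $$ (a, j)))\<^sup>2) = 1) \<longrightarrow> (\<forall>i<k. (\<Sum>a<n. (cmod (W $$ (i, a)))\<^sup>2) \<le> s\<^sup>2) \<longrightarrow>
    (\<exists>G\<in>sets M. measure M G \<ge> 1 - \<gamma> \<and> (\<forall>\<omega>\<in>G. \<forall>z. cmod z \<le> r \<longrightarrow>
      Determinant.det (1\<^sub>m n - z \<cdot>\<^sub>m X \<omega>) \<noteq> 0 \<and>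
      cmod (Determinant.det (1\<^sub>m n - z \<cdot>\<^sub>m (X \<omega> + U * W)) / Determinant.det (1\<^sub>m n - z \<cdot>\<^sub>m X \<omega>) -
        Determinant.det (1\<^sub>m n - z \<cdot>\<^sub>m (U * W))) \<le> \<eta>))"
    using perturbation_event[OF \<mu> r(1,2) \<gamma> \<eta> s0, of k, where ?'w = 'w] by (elim exE) (rule that)
  note n0 = n0[THEN spec, THEN mp, THEN spec, THEN spec, THEN spec, THEN spec,
    THEN mp, THEN mp, THEN mp, THEN mp, THEN mp]
  from rk nrm big small eventually_ge_at_top[of "max n0 1"] show ?thesis
  proof eventually_elim
    case (elim n)
    have n: "n0 \<le> n" "n \<ge> 1" using elim(5) by auto
    obtain U W where U: "U \<in> carrier_mat n k" and W: "W \<in> carrier_mat k n" and CUW: "C n = U * W"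
      and uU: "\<forall>j<k. (\<Sum>a<n. (cmod (U $$ (a, j)))\<^sup>2) = 1" and uW: "\<forall>i<k. (\<Sum>a<n. (cmod (W $$ (i, a)))\<^sup>2) \<le> s\<^sup>2"
      using rank_factorization[OF C elim(1,2)] by blast
    obtain G where G: "G \<in> sets (M n)" "measure (M n) G \<ge> 1 - \<gamma>"
      and pG: "\<forall>\<omega>\<in>G. \<forall>z. cmod z \<le> r \<longrightarrow> Determinant.det (1\<^sub>m n - z \<cdot>\<^sub>m X n \<omega>) \<noteq> 0 \<and>
        cmod (Determinant.det (1\<^sub>m n - z \<cdot>\<^sub>m (X n \<omega> + C n)) / Determinant.det (1\<^sub>m n - z \<cdot>\<^sub>m X n \<omega>) -
        Determinant.det (1\<^sub>m n - z \<cdot>\<^sub>m C n)) \<le> \<eta>"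
      using n0[OF n(1) X[OF n(2)] U W uU uW] unfolding CUW[symmetric] by (elim bexE conjE) (rule that)
    note p0 = pG[THEN bspec, THEN spec, THEN mp, THEN conjunct1]
      and close = pG[THEN bspec, THEN spec, THEN mp, THEN conjunct2]
    define cs where "cs = map (c n) [1..<Suc m]"
    have mcs: "mset cs = {# z \<in># eigenvalue_mset (C n). cmod z > 1 + \<delta> #}"
      unfolding elim(3) cs_def mset_map mset_upt atLeastLessThanSuc_atLeastAtMost ..
    \<comment> \<open>The eigenvalue 0 has multiplicity at least \<open>n - k\<close>. It
      contributes factors 1 and is left out, since otherwise the size of \<open>Sm\<close> would
      grow with \<open>n\<close>.\<close>
    define Sm where "Sm = {#x \<in># {#x \<in># eigenvalue_mset (C n). x \<noteq> 0#}. \<not> cmod x > 1 + \<delta>#}"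
    have cs: "length cs = m" "\<forall>x\<in>set cs. 1 + \<delta> < cmod x \<and> cmod x \<le> s"
    proof -
      show "length cs = m" by (simp add: cs_def del: upt_Suc)
      show "\<forall>x\<in>set cs. 1 + \<delta> < cmod x \<and> cmod x \<le> s"
      proof
        fix x assume "x \<in> set cs"
        then have "x \<in># {# z \<in># eigenvalue_mset (C n). cmod z > 1 + \<delta> #}" by (simp flip: mcs)
        then show "1 + \<delta> < cmod x \<and> cmod x \<le> s" using eigenvalue_norm_le[OF C elim(2)] by auto
      qed
    qed
    have Sm: "\<forall>x\<in>#Sm. cmod x \<le> 1 + \<delta> / 3" "size Sm \<le> k"
    proof -
      show "\<forall>x\<in>#Sm. cmod x \<le> 1 + \<delta> / 3" using elim(4) by (auto simp: Sm_def)
      have "size Sm \<le> size {#x \<in># eigenvalue_mset (C n). x \<noteq> 0#}" unfolding Sm_def by (rule size_filter_mset_lesseq)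
      also have "\<dots> \<le> k" unfolding CUW by (rule card_nonzero_eigenvalues_le[OF U W])
      finally show "size Sm \<le> k" .
    qed
    have dC: "Determinant.det (1\<^sub>m n - z \<cdot>\<^sub>m C n) = (\<Prod>x\<leftarrow>cs. 1 - z * x) * (\<Prod>x\<in>#Sm. 1 - z * x)" for z
    proof -
      have "(\<Prod>x\<in>#{# x \<in># eigenvalue_mset (C n). cmod x > 1 + \<delta> #}. 1 - z * x) = (\<Prod>x\<leftarrow>cs. 1 - z * x)"
        by (simp only: mcs[symmetric] mset_map[symmetric] prod_mset_prod_list)
      moreover have "1 - z * 0 = 1" "\<not> 1 + \<delta> < cmod 0" using \<delta> by simp_all
      ultimately show ?thesis
        using prod_mset_split_nonzero[of "\<lambda>x. 1 - z * x" "\<lambda>x. 1 + \<delta> < cmod x" "eigenvalue_mset (C n)"]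
        unfolding det_one_minus_eigenvalues[OF C] Sm_def by simp
    qed
    show ?case
    proof (intro bexI[of _ G] conjI ballI G)
      fix \<omega> assume \<omega>: "\<omega> \<in> G"
      have "\<omega> \<in> space (M n)" using \<omega> sets.sets_into_space[OF G(1)] by blast
      then have A: "X n \<omega> \<in> carrier_mat n n" using X[OF n(2)] by (simp add: iid_matrix_def)
      \<comment> \<open>The explicit polynomial in place of the determinant makes holomorphy and
        continuity immediate.\<close>
      define w where "w = (\<lambda>z. 1 / (\<Sum>k\<le>n. (-z) ^ k * minor_sum n k (\<lambda>e. X n \<omega> $$ e)))"
      have w: "w z = 1 / Determinant.det (1\<^sub>m n - z \<cdot>\<^sub>m X n \<omega>)" for z
        by (simp only: w_def det_one_minus_smult[OF A])
      have nz: "(\<Sum>k\<le>n. (-z) ^ k * minor_sum n k (\<lambda>e. X n \<omega> $$ e)) \<noteq> 0" if "z \<in> cball 0 r" for z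
        using p0[OF \<omega>, of z] that unfolding det_one_minus_smult[OF A] by simp
      have "\<exists>as S'. eigenvalue_mset (X n \<omega> + C n) = mset as + S' \<and> length as = m \<and>
          (\<forall>i<m. norm (as ! i - cs ! i) < \<epsilon>) \<and> (\<forall>x\<in>#S'. norm x < 1 / r)"
      proof (rule match[OF cs Sm])
        show "w holomorphic_on ball 0 r" unfolding w_def
          by (intro holomorphic_intros) (use nz in auto)
        show "continuous_on (cball 0 r) w" unfolding w_def
          by (intro continuous_intros) (use nz in auto)
        show "\<forall>z\<in>cball 0 r. w z \<noteq> 0" using nz by (simp add: w_def)
        show "\<forall>z\<in>cball 0 r. norm ((\<Prod>x\<in>#eigenvalue_mset (X n \<omega> + C n). 1 - z * x) * w z -
            (\<Prod>x\<leftarrow>cs. 1 - z * x) * (\<Prod>x\<in>#Sm. 1 - z * x)) \<le> \<eta>"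
        proof
          fix z :: complex assume "z \<in> cball 0 r"
          then have cz: "cmod z \<le> r" by simp
          show "norm ((\<Prod>x\<in>#eigenvalue_mset (X n \<omega> + C n). 1 - z * x) * w z -
            (\<Prod>x\<leftarrow>cs. 1 - z * x) * (\<Prod>x\<in>#Sm. 1 - z * x)) \<le> \<eta>"
            using close[OF \<omega> cz]
            by (simp only: w dC det_one_minus_eigenvalues[OF add_carrier_mat[OF C]] times_divide_eq_right mult_1_right)
        qed
      qed
      then obtain as S' where as: "eigenvalue_mset (X n \<omega> + C n) = mset as + S'" "length as = m"
        "\<forall>i<m. norm (as ! i - cs ! i) < \<epsilon>" "\<forall>x\<in>#S'. norm x < 1 / r"
        by (elim exE conjE) (rule that)
      show "\<exists>as S'. eigenvalue_mset (X n \<omega> + C n) = mset as + S' \<and> length as = m \<and>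
          (\<forall>i<m. cmod (as ! i - c n (Suc i)) < \<epsilon>) \<and> (\<forall>x\<in>#S'. cmod x < 1 + \<delta> / 2)"
      proof (intro exI[of _ as] exI[of _ S'] conjI as(1,2) allI impI ballI)
        fix i assume i: "i < m"
        then have "cs ! i = c n (Suc i)" by (simp add: cs_def del: upt_Suc)
        then show "cmod (as ! i - c n (Suc i)) < \<epsilon>" using as(3) i by metis
      next
        fix x assume "x \<in># S'"
        with as(4) have "cmod x < 1 / r" by blast
        with r(5) show "cmod x < 1 + \<delta> / 2" by linarith
      qed
    qed
  qed
qed

text \<open>A single labelling with multiplicity lets convergence at all accuracies refer to the
  same eigenvalue. Outliers of \<open>C\<close> that approach each other attract several
  eigenvalues, and the labelling attaches one to each index; where \<open>c n j\<close> keeps its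
  distance from the others, a count in small discs makes "exactly one" explicit.\<close>

theorem theorem1p12:
  fixes \<mu> :: "complex measure"
    and M :: "nat \<Rightarrow> 'w measure"
    and X :: "nat \<Rightarrow> 'w \<Rightarrow> complex mat"
    and C :: "nat \<Rightarrow> complex mat"
    and c :: "nat \<Rightarrow> nat \<Rightarrow> complex"
    and k ktilde :: nat
    and \<delta> sstar :: real
  assumes "standardized_law \<mu>"
    and "\<And>n. n \<ge> 1 \<Longrightarrow> iid_matrix \<mu> n (M n) (X n)"
    and "k > 0" and "\<delta> > 0" and "sstar > 1 + \<delta>"
    and "\<And>n. C n \<in> carrier_mat n n"
    and "\<forall>\<^sub>F n in sequentially. vec_space.rank n (C n) = k"
    and "\<forall>\<^sub>F n in sequentially. mat_op_norm (C n) \<le> sstar"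
    and "\<forall>\<^sub>F n in sequentially.
           {# z \<in># eigenvalue_mset (C n). cmod z > 1 + \<delta> #} = image_mset (c n) (mset_set {1..ktilde})"
    and "\<forall>\<^sub>F n in sequentially.
           \<forall>z \<in># eigenvalue_mset (C n). cmod z > 1 + \<delta> \<or> cmod z \<le> 1 + \<delta> / 3"
  shows "\<exists>lam :: nat \<Rightarrow> 'w \<Rightarrow> nat \<Rightarrow> complex.
    (\<forall>n\<ge>1. \<forall>\<omega>\<in>space (M n).
       eigenvalue_mset (X n \<omega> + C n) = image_mset (lam n \<omega>) (mset_set {1..n})) \<and>
    (\<forall>j\<in>{1..ktilde}. converges_in_prob M (\<lambda>n \<omega>. lam n \<omega> j) (\<lambda>n. c n j)) \<and>
    (\<forall>j\<in>{1..ktilde}. \<forall>\<eta>>0.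
       (\<forall>\<^sub>F n in sequentially. \<forall>i\<in>{1..ktilde} - {j}. cmod (c n i - c n j) \<ge> \<eta>) \<longrightarrow>
       (\<forall>\<epsilon>. 0 < \<epsilon> \<and> \<epsilon> < min \<eta> (\<delta> / 2) \<longrightarrow>
          whp M (\<lambda>n \<omega>. size {# z \<in># eigenvalue_mset (X n \<omega> + C n). cmod (z - c n j) < \<epsilon> #} = 1))) \<and>
    whp M (\<lambda>n \<omega>. \<forall>i\<in>{ktilde+1..n}. cmod (lam n \<omega> i) < 1 + \<delta> / 2)"
proof -
  define S where "S = (\<lambda>n \<omega>. eigenvalue_mset (X n \<omega> + C n))"
  have size_S: "size (S n \<omega>) = n" for n \<omega>
    unfolding S_def by (rule char_poly_eigenvalues(2)[OF add_carrier_mat[OF assms(6)]])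
  \<comment> \<open>The distance to the centre for the outlier labels, and a penalty 1 for every
    further label whose eigenvalue leaves the disc of radius \<open>1 + \<delta> / 2\<close>. No
    tolerance occurs, so one minimiser works for all of them.\<close>
  define cost where "cost = (\<lambda>n i x. if i \<le> ktilde then cmod (x - c n i) else if cmod x < 1 + \<delta> / 2 then 0 else 1)"
  have cost_nonneg: "0 \<le> cost n i x" for n i x by (simp add: cost_def)
  define lam where "lam = (\<lambda>n \<omega>. SOME f. S n \<omega> = image_mset f (mset_set {1..size (S n \<omega>)}) \<and>
    (\<forall>g. S n \<omega> = image_mset g (mset_set {1..size (S n \<omega>)}) \<longrightarrow>
      (\<Sum>i=1..size (S n \<omega>). cost n i (f i)) \<le> (\<Sum>i=1..size (S n \<omega>). cost n i (g i))))"
  have opt: "S n \<omega> = image_mset (lam n \<omega>) (mset_set {1..n}) \<and>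
    (\<forall>g. S n \<omega> = image_mset g (mset_set {1..n}) \<longrightarrow>
      (\<Sum>i=1..n. cost n i (lam n \<omega> i)) \<le> (\<Sum>i=1..n. cost n i (g i)))" for n \<omega>
    using someI_ex[OF optimal_labelling[of "S n \<omega>" "cost n"]] unfolding lam_def size_S .
  have label: "S n \<omega> = image_mset (lam n \<omega>) (mset_set {1..n})" for n \<omega>
    using opt[of n \<omega>] by (rule conjunct1)
  have lam_le: "(\<Sum>i=1..n. cost n i (lam n \<omega> i)) \<le> (\<Sum>i=1..n. cost n i (g i))"
    if "S n \<omega> = image_mset g (mset_set {1..n})" for n \<omega> g
    using opt[of n \<omega>] that by blast
  define P where "P = (\<lambda>e n \<omega>. \<exists>as S'. S n \<omega> = mset as + S' \<and> length as = ktilde \<and>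
    (\<forall>i<ktilde. cmod (as ! i - c n (Suc i)) < e) \<and> (\<forall>x\<in>#S'. cmod x < 1 + \<delta> / 2))"
  have whpI: "whp M Q" if e: "e > 0" and Q: "\<forall>\<^sub>F n in sequentially. \<forall>\<omega>. P e n \<omega> \<longrightarrow> Q n \<omega>" for e Q
  proof (rule whp_intro)
    show "prob_space (M n)" if "n \<ge> 1" for n using assms(2)[OF that] by (simp add: iid_matrix_def)
    fix \<gamma> :: real assume \<gamma>: "\<gamma> > 0"
    have "\<forall>\<^sub>F n in sequentially. \<exists>G\<in>sets (M n). measure (M n) G \<ge> 1 - \<gamma> \<and> (\<forall>\<omega>\<in>G. P e n \<omega>)"
      unfolding P_def S_def by (rule outlier_event[OF assms(1,2,4,5,6,7,8,9,10) \<gamma> e])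
    with Q show "\<forall>\<^sub>F n in sequentially. \<exists>G\<in>sets (M n). measure (M n) G \<ge> 1 - \<gamma> \<and> (\<forall>\<omega>\<in>G. Q n \<omega>)"
      by eventually_elim meson
  qed
  \<comment> \<open>The splitting supplied by \<open>P\<close> yields a labelling of cost at most
    \<open>ktilde * e\<close>. The minimiser costs no more, and as costs are nonnegative the bound
    passes to each label.\<close>
  have lam_cost: "ktilde \<le> n \<and> (\<forall>i\<in>{1..n}. cost n i (lam n \<omega> i) \<le> real ktilde * e)" if "P e n \<omega>" for e n \<omega>
  proof
    obtain as S' where as: "S n \<omega> = mset as + S'" "length as = ktilde"
      "\<forall>i<ktilde. cmod (as ! i - c n (Suc i)) < e" "\<forall>x\<in>#S'. cmod x < 1 + \<delta> / 2"
      using \<open>P e n \<omega>\<close> unfolding P_def by blast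
    show kn: "ktilde \<le> n" using arg_cong[OF as(1), of size] by (simp add: size_S as(2))
    obtain f where f: "S n \<omega> = image_mset f (mset_set {1..n})" "\<forall>j\<in>{1..ktilde}. f j = as ! (j - 1)"
      "\<forall>i\<in>{ktilde + 1..n}. f i \<in># S'"
      using labelling_of_split[OF as(1)] unfolding size_S as(2) by blast
    have "(\<Sum>i=1..n. cost n i (lam n \<omega> i)) \<le> (\<Sum>i=1..n. cost n i (f i))" by (rule lam_le[OF f(1)])
    also have "\<dots> = (\<Sum>i=1..ktilde. cost n i (f i))"
      by (rule sum.mono_neutral_right) (use kn f(3) as(4) in \<open>auto simp: cost_def\<close>)
    also have "\<dots> \<le> (\<Sum>i=1..ktilde. e)"
    proof (rule sum_mono)
      fix i assume i: "i \<in> {1..ktilde}"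
      then have "i - 1 < ktilde" "Suc (i - 1) = i" by auto
      then have "cmod (as ! (i - 1) - c n i) < e" using as(3) by metis
      then show "cost n i (f i) \<le> e" using i f(2) by (simp add: cost_def)
    qed
    finally have tot: "(\<Sum>i=1..n. cost n i (lam n \<omega> i)) \<le> real ktilde * e" by simp
    show "\<forall>i\<in>{1..n}. cost n i (lam n \<omega> i) \<le> real ktilde * e"
    proof
      fix i assume "i \<in> {1..n}"
      then have "cost n i (lam n \<omega> i) \<le> (\<Sum>i=1..n. cost n i (lam n \<omega> i))"
        by (intro member_le_sum cost_nonneg) auto
      with tot show "cost n i (lam n \<omega> i) \<le> real ktilde * e" by linarith
    qed
  qed
  \<comment> \<open>Division by \<open>ktilde + 1\<close> makes the second inequality strict and
    covers \<open>ktilde = 0\<close>.\<close>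
  have scaled: "0 < \<epsilon> / (real ktilde + 1)" "real ktilde * (\<epsilon> / (real ktilde + 1)) < \<epsilon>" if "\<epsilon> > 0" for \<epsilon> :: real
    using that by (auto simp: field_simps)
  have one: "0 < (1 :: real)" by simp
  have conv: "converges_in_prob M (\<lambda>n \<omega>. lam n \<omega> j) (\<lambda>n. c n j)" if j: "j \<in> {1..ktilde}" for j
    unfolding converges_in_prob_def
  proof (intro allI impI)
    fix \<epsilon> :: real assume "\<epsilon> > 0"
    note sc = scaled[OF this]
    show "whp M (\<lambda>n \<omega>. cmod (lam n \<omega> j - c n j) < \<epsilon>)"
    proof (rule whpI[OF sc(1)], intro always_eventually allI impI)
      fix n \<omega> assume "P (\<epsilon> / (real ktilde + 1)) n \<omega>"
      from lam_cost[OF this] j have "cost n j (lam n \<omega> j) \<le> real ktilde * (\<epsilon> / (real ktilde + 1))" by auto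
      with sc(2) j show "cmod (lam n \<omega> j - c n j) < \<epsilon>" by (simp add: cost_def)
    qed
  qed
  \<comment> \<open>With total cost below 1 no label can incur the penalty 1.\<close>
  have rest: "whp M (\<lambda>n \<omega>. \<forall>i\<in>{ktilde+1..n}. cmod (lam n \<omega> i) < 1 + \<delta> / 2)"
  proof (rule whpI[OF scaled(1)[OF one]], intro always_eventually allI impI ballI)
    fix n \<omega> i assume P: "P (1 / (real ktilde + 1)) n \<omega>" and i: "i \<in> {ktilde + 1..n}"
    from lam_cost[OF P] i have "cost n i (lam n \<omega> i) \<le> real ktilde * (1 / (real ktilde + 1))" by auto
    also have "\<dots> < 1" by (rule scaled(2)[OF one])
    finally show "cmod (lam n \<omega> i) < 1 + \<delta> / 2" using i by (simp add: cost_def split: if_splits)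
  qed
  have unique: "whp M (\<lambda>n \<omega>. size {# z \<in># S n \<omega>. cmod (z - c n j) < \<epsilon> #} = 1)"
    if j: "j \<in> {1..ktilde}" and sep: "\<forall>\<^sub>F n in sequentially. \<forall>i\<in>{1..ktilde} - {j}. cmod (c n i - c n j) \<ge> \<eta>"
      and \<epsilon>: "0 < \<epsilon>" "\<epsilon> < \<eta>" "\<epsilon> < \<delta> / 2" for j \<eta> \<epsilon>
  proof (rule whpI)
    \<comment> \<open>Accuracy \<epsilon> puts the eigenvalue matched with \<open>c n j\<close> into
      the disc around it; accuracy \<open>\<eta> - \<epsilon>\<close> keeps those matched with the
      other centres out.\<close>
    show "0 < min \<epsilon> (\<eta> - \<epsilon>)" using \<epsilon> by simp
    from sep assms(9) show "\<forall>\<^sub>F n in sequentially. \<forall>\<omega>. P (min \<epsilon> (\<eta> - \<epsilon>)) n \<omega> \<longrightarrow>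
      size {# z \<in># S n \<omega>. cmod (z - c n j) < \<epsilon> #} = 1"
    proof eventually_elim
      case (elim n)
      have "c n j \<in># image_mset (c n) (mset_set {1..ktilde})" using j by simp
      then have cj: "cmod (c n j) > 1 + \<delta>" unfolding elim(2)[symmetric] by simp
      show ?case
      proof (intro allI impI)
        fix \<omega> assume "P (min \<epsilon> (\<eta> - \<epsilon>)) n \<omega>"
        then obtain as S' where as: "S n \<omega> = mset as + S'" "length as = ktilde"
          "\<And>i. i < ktilde \<Longrightarrow> cmod (as ! i - c n (Suc i)) < min \<epsilon> (\<eta> - \<epsilon>)" "\<forall>x\<in>#S'. cmod x < 1 + \<delta> / 2"
          unfolding P_def by blast
        \<comment> \<open>The moduli of \<open>x\<close> and \<open>c n j\<close> differ by more
          than \<open>\<delta> / 2\<close>.\<close>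
        have "\<not> cmod (x - c n j) < \<epsilon>" if "x \<in># S'" for x
        proof -
          have "cmod x < 1 + \<delta> / 2" using as(4) that by blast
          then show ?thesis using cj \<epsilon> norm_triangle_ineq2[of "c n j" x] norm_minus_commute[of x "c n j"] by linarith
        qed
        then have "{# z \<in># S'. cmod (z - c n j) < \<epsilon> #} = {#}" by (induction S') auto
        then have "size {# z \<in># S n \<omega>. cmod (z - c n j) < \<epsilon> #} = length (filter (\<lambda>z. cmod (z - c n j) < \<epsilon>) as)"
          by (simp add: as(1) flip: mset_filter)
        also have "\<dots> = card {i. i < ktilde \<and> cmod (as ! i - c n j) < \<epsilon>}"
          by (simp add: length_filter_conv_card as(2))
        also have "{i. i < ktilde \<and> cmod (as ! i - c n j) < \<epsilon>} = {j - 1}"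
        proof (rule Set.set_eqI)
          fix i
          have "cmod (as ! i - c n j) \<ge> \<epsilon>" if i: "i < ktilde" "i \<noteq> j - 1"
          proof -
            have "Suc i \<in> {1..ktilde} - {j}" using i by auto
            then have "cmod (c n (Suc i) - c n j) \<ge> \<eta>" using elim(1) by blast
            moreover have "cmod (c n (Suc i) - c n j) \<le> cmod (as ! i - c n j) + cmod (as ! i - c n (Suc i))"
              using norm_triangle_ineq4[of "as ! i - c n j" "as ! i - c n (Suc i)"] by simp
            ultimately show ?thesis using as(3)[OF i(1)] by linarith
          qed
          moreover have "j - 1 < ktilde" "Suc (j - 1) = j" using j by auto
          ultimately show "i \<in> {i. i < ktilde \<and> cmod (as ! i - c n j) < \<epsilon>} \<longleftrightarrow> i \<in> {j - 1}"
            using as(3)[of "j - 1"] by force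
        qed
        finally show "size {# z \<in># S n \<omega>. cmod (z - c n j) < \<epsilon> #} = 1" by simp
      qed
    qed
  qed
  show ?thesis
  proof (intro exI[of _ lam] conjI ballI allI impI)
    fix n \<omega> show "eigenvalue_mset (X n \<omega> + C n) = image_mset (lam n \<omega>) (mset_set {1..n})"
      using label[of n \<omega>] by (simp only: S_def)
  next
    fix j assume "j \<in> {1..ktilde}"
    then show "converges_in_prob M (\<lambda>n \<omega>. lam n \<omega> j) (\<lambda>n. c n j)" by (rule conv)
  next
    fix j \<eta> \<epsilon> assume "j \<in> {1..ktilde}" "\<forall>\<^sub>F n in sequentially. \<forall>i\<in>{1..ktilde} - {j}. cmod (c n i - c n j) \<ge> \<eta>"
      "0 < \<epsilon> \<and> \<epsilon> < min \<eta> (\<delta> / 2)"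
    then show "whp M (\<lambda>n \<omega>. size {# z \<in># eigenvalue_mset (X n \<omega> + C n). cmod (z - c n j) < \<epsilon> #} = 1)"
      using unique[of j \<eta> \<epsilon>] unfolding S_def by simp
  next
    show "whp M (\<lambda>n \<omega>. \<forall>i\<in>{ktilde+1..n}. cmod (lam n \<omega> i) < 1 + \<delta> / 2)" by (rule rest)
  qed
qed

end
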